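(* Consider the single-sensor in-order lossy-link model described in the context, the filtration $\mathcal F_t=\sigma(Q_1,(Y_k,Z_k),1\le k\le t)$, and, for an $\mathcal F_t$-stopping time $T$, the worst-case average detection delay $$\overline{\mathbb E}_1[T]=\sup_{\nu\ge 1}\operatorname{ess\,sup}\ \mathbb E_\nu\big[(T-\nu+1)^+\mid Q_1,Y_1^{\nu-1},Z_1^{\nu-1}\big].$$ Then, for the Markov process $\zeta_k=(Q_k,Y_k,Z_k)$, as $\gamma\to\infty$, $$\inf_{\{T:\ \mathbb E_\infty[T]\ge\gamma\}}\overline{\mathbb E}_1[T]\ \ge\ \big(I^{-1}+o(1)\big)\log\gamma ,$$ where the infimum is over $\mathcal F_t$-stopping times $T$ and $I$ is the information number defined in the context.
   Context: Time is divided into unit slots; slot $k$ is $[k-1,k)$. A sensor produces a new measurement in each slot with probability $r$, $0<r<1$, independently across slots; $A_k\in\{0,1\}$ indicates whether a measurement is produced in slot $k$. Each measurement is put in a packet which joins a first-come-first-served, infinite-buffer transmit queue. $Q_k$ is the number of packets in the queue at the beginning of slot $k$. If $Q_k>0$, the head-of-line packet is transmitted to the decision maker (DM) in slot $k$; a failed packet is retransmitted until success, and acknowledgments are error-free. $Y_k=1$ if the transmission in slot $k$ succeeds, $Y_k=0$ if it fails, and $Y_k=\emptyset$ if $Q_k=0$ (no transmission). The queue evolves as $Q_{k+1}=(Q_k-Y_k)^++A_k$ (with $\emptyset$ read as $0$ here). Packets are numbered sequentially in order of sampling, starting with the $Q_1$ packets present in the queue at the beginning of slot 1; $X_j$ is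 the measurement in packet $j$; $D_k$ is the number (index) of the last packet successfully received at the DM by the end of slot $k$. $Z_k=X_{D_k}$ if $Y_k=1$ and $Z_k=*$ (no measurement) otherwise. Change point: $\nu\ge1$ is an unknown deterministic integer. The measurements are independent; those sampled in slots $\le\nu$ (including the initial $Q_1$ packets) have density $f_0$, those sampled in slots $>\nu$ have density $f_1$, with $f_0\ne f_1$. The channel is memoryless, with $P(Y_k=1\mid Q_k>0)=p_0$ for $k\le\nu$ and $p_1$ for $k>\nu$. Given $\nu$, the channel is independent of the sampling process. It is assumed that $r<\min\{p_0,p_1\}$, that the system is in pre-change steady state when detection starts at slot 1, and that $Q_1$ is known to the DM. $\mathbb P_\nu,\mathbb E_\nu$ are the law and expectation with change point $\nu$; $\mathbb P_\infty,\mathbb E_\infty$ correspond to no change (all variables pre-change); $\mathbb P_0,\mathbb E_0$ correspond to all variables post-change. Notation: $Y_1^n=\{Y_1,\dots,Y_n\}$, similarly $Z_1^n$. Information number: let $$L_i=\mathbf 1_{\{Q_i>0\}}\log\frac{\mathbb P_0(Y_i\mid Q_i>0)}{\mathbb P_\infty(Y_i\mid Q_i>0)}+\mathbf 1_{\{Y_i=1,\,D_i>Q_1+S_\nu\}}\log\frac{f_1(Z_i)}{f_0(Z_i)},$$ where $S_\nu$ is the number of measurements produced in slots $1,\dots,\nu$. $I$ is the almost sure limit $\lim_{n\to\infty}\frac1n\sum_{i=1}^nL_i$ under $\mathbb P_0$ (with $S_\nu=S_0=0$); equivalently $$I=r\Big(\tfrac1{p_1}I(p_1,p_0)+I(f_1,f_0)\Big),$$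 with $I(p_1,p_0)=p_1\log\frac{p_1}{p_0}+(1-p_1)\log\frac{1-p_1}{1-p_0}$ and $I(f_1,f_0)=\int f_1\log\frac{f_1}{f_0}$. *)

theory Defs
  imports "HOL-Probability.Probability"
begin

text \<open>
  A sample point is a tuple \<open>(q, a, c, u, v)\<close>: \<open>q\<close> is the number of packets in the queue at the
  beginning of slot 1; \<open>a k\<close> tells whether a measurement is produced in slot \<open>k\<close>; \<open>c k\<close> tells
  whether a transmission in slot \<open>k\<close>, if there is one, succeeds; \<open>u j\<close> is the measurement in the
  \<open>j\<close>-th packet initially present (it matters only for \<open>1 \<le> j \<le> q\<close>); \<open>v k\<close> is the measurement
  produced in slot \<open>k\<close> (it matters only if \<open>a k\<close>). Slots and packets are numbered from 1, so that
  the coordinates with index 0 play no role.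
\<close>

type_synonym 'x outcome = "nat \<times> (nat \<Rightarrow> bool) \<times> (nat \<Rightarrow> bool) \<times> (nat \<Rightarrow> 'x) \<times> (nat \<Rightarrow> 'x)"

definition initial_queue :: "'x outcome \<Rightarrow> nat" where
  "initial_queue = (\<lambda>(q, a, c, u, v). q)"

definition arrival :: "nat \<Rightarrow> 'x outcome \<Rightarrow> bool" where
  "arrival k = (\<lambda>(q, a, c, u, v). a k)"

definition channel_ok :: "nat \<Rightarrow> 'x outcome \<Rightarrow> bool" where
  "channel_ok k = (\<lambda>(q, a, c, u, v). c k)"

definition initial_meas :: "nat \<Rightarrow> 'x outcome \<Rightarrow> 'x" where
  "initial_meas j = (\<lambda>(q, a, c, u, v). u j)"

definition slot_meas :: "nat \<Rightarrow> 'x outcome \<Rightarrow> 'x" where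
  "slot_meas k = (\<lambda>(q, a, c, u, v). v k)"


text \<open>The result of a slot: \<open>None\<close> stands for the absence of a transmission.\<close>

definition transmission :: "nat \<Rightarrow> bool \<Rightarrow> nat option" where
  "transmission q c = (if q > 0 then Some (of_bool c) else None)"

text \<open>Subtraction on the natural numbers is truncated, which is the positive part.\<close>

definition next_queue :: "nat \<Rightarrow> nat option \<Rightarrow> bool \<Rightarrow> nat" where
  "next_queue q y a = (q - (case y of None \<Rightarrow> 0 | Some s \<Rightarrow> s)) + of_bool a"

fun Q :: "nat \<Rightarrow> 'x outcome \<Rightarrow> nat" where
  "Q 0 \<omega> = initial_queue \<omega>"
| "Q (Suc 0) \<omega> = initial_queue \<omega>"
| "Q (Suc (Suc k)) \<omega> =
     next_queue (Q (Suc k) \<omega>) (transmission (Q (Suc k) \<omega>) (channel_ok (Suc k) \<omega>))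
       (arrival (Suc k) \<omega>)"

definition Y :: "nat \<Rightarrow> 'x outcome \<Rightarrow> nat option" where
  "Y k \<omega> = transmission (Q k \<omega>) (channel_ok k \<omega>)"

definition S :: "nat \<Rightarrow> 'x outcome \<Rightarrow> nat" where
  "S k \<omega> = card {i \<in> {1..k}. arrival i \<omega>}"

text \<open>Packets are served in the order of their numbers and a failed packet is retransmitted until
  success, so the number of the last received packet is the number of successes so far.\<close>

definition D :: "nat \<Rightarrow> 'x outcome \<Rightarrow> nat" where
  "D k \<omega> = card {i \<in> {1..k}. Y i \<omega> = Some 1}"

text \<open>Packet \<open>Q 1 + i\<close> with \<open>i \<ge> 1\<close> is the \<open>i\<close>-th one produced from slot 1 on.\<close>

definition X :: "nat \<Rightarrow> 'x outcome \<Rightarrow> 'x" where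
  "X j \<omega> = (if j \<le> Q 1 \<omega> then initial_meas j \<omega>
            else slot_meas (LEAST k. S k \<omega> = j - Q 1 \<omega>) \<omega>)"

definition Z :: "nat \<Rightarrow> 'x outcome \<Rightarrow> 'x option" where
  "Z k \<omega> = (if Y k \<omega> = Some 1 then Some (X (D k \<omega>) \<omega>) else None)"


text \<open>Steady state of the queue with measurement probability \<open>r\<close> and success probability \<open>p\<close>.\<close>

definition stationary_queue :: "real \<Rightarrow> real \<Rightarrow> nat pmf \<Rightarrow> bool" where
  "stationary_queue r p \<rho> \<longleftrightarrow>
     bind_pmf \<rho> (\<lambda>q. bind_pmf (bernoulli_pmf r) (\<lambda>a. bind_pmf (bernoulli_pmf p) (\<lambda>c.
       return_pmf (next_queue q (transmission q c) a)))) = \<rho>"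

text \<open>The law with change point \<open>\<nu>\<close>, where \<open>\<nu> = \<infinity>\<close> means that there is no change. All sources of
  randomness are independent, and \<open>\<rho>\<close> is the law of the initial queue length.\<close>

definition law ::
  "real \<Rightarrow> real \<Rightarrow> real \<Rightarrow> 'x measure \<Rightarrow> ('x \<Rightarrow> real) \<Rightarrow> ('x \<Rightarrow> real) \<Rightarrow> nat pmf \<Rightarrow> enat \<Rightarrow> 'x outcome measure"
where
  "law r p0 p1 \<mu> f0 f1 \<rho> \<nu> =
     measure_pmf \<rho> \<Otimes>\<^sub>M
     (\<Pi>\<^sub>M k\<in>UNIV. measure_pmf (bernoulli_pmf r)) \<Otimes>\<^sub>M
     (\<Pi>\<^sub>M k\<in>UNIV. measure_pmf (bernoulli_pmf (if enat k \<le> \<nu> then p0 else p1))) \<Otimes>\<^sub>M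
     (\<Pi>\<^sub>M j\<in>UNIV. density \<mu> (\<lambda>x. ennreal (f0 x))) \<Otimes>\<^sub>M
     (\<Pi>\<^sub>M k\<in>UNIV. density \<mu> (\<lambda>x. ennreal ((if enat k \<le> \<nu> then f0 else f1) x)))"


text \<open>The space of a measurement or no measurement (\<open>None\<close>).\<close>

definition option_space :: "'x measure \<Rightarrow> 'x option measure" where
  "option_space \<mu> = sigma (insert None (Some ` space \<mu>)) (insert {None} ((`) Some ` sets \<mu>))"

definition outcome_space :: "'x measure \<Rightarrow> 'x outcome set" where
  "outcome_space \<mu> = UNIV \<times> UNIV \<times> UNIV \<times> (UNIV \<rightarrow>\<^sub>E space \<mu>) \<times> (UNIV \<rightarrow>\<^sub>E space \<mu>)"

definition observed_slots :: "enat \<Rightarrow> nat set" where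
  "observed_slots t = {k. 1 \<le> k \<and> enat k \<le> t}"

text \<open>The sigma-algebra generated by \<open>Q 1\<close> and by \<open>(Y k, Z k)\<close> for \<open>1 \<le> k \<le> t\<close>. Time is
  extended by \<open>\<infinity>\<close> so that stopping times may be infinite.\<close>

definition observations :: "'x measure \<Rightarrow> enat \<Rightarrow> 'x outcome measure" where
  "observations \<mu> t =
     vimage_algebra (outcome_space \<mu>)
       (\<lambda>\<omega>. (Q 1 \<omega>, \<lambda>k\<in>observed_slots t. (Y k \<omega>, Z k \<omega>)))
       (count_space UNIV \<Otimes>\<^sub>M
         (\<Pi>\<^sub>M k\<in>observed_slots t. count_space UNIV \<Otimes>\<^sub>M option_space \<mu>))"


text \<open>\<open>P\<close> is the family of laws, indexed by the change point.\<close>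

definition mean_run_length :: "(enat \<Rightarrow> 'x outcome measure) \<Rightarrow> ('x outcome \<Rightarrow> enat) \<Rightarrow> ennreal" where
  "mean_run_length P T = (\<integral>\<^sup>+ \<omega>. ennreal_of_enat (T \<omega>) \<partial>P \<infinity>)"

text \<open>Subtraction on \<open>enat\<close> is truncated at 0, and \<open>\<infinity>\<close> minus a finite number is \<open>\<infinity>\<close>.\<close>

definition worst_case_delay ::
  "(enat \<Rightarrow> 'x outcome measure) \<Rightarrow> (enat \<Rightarrow> 'x outcome measure) \<Rightarrow> ('x outcome \<Rightarrow> enat) \<Rightarrow> ennreal"
where
  "worst_case_delay P F T =
     (SUP \<nu>\<in>{1::nat..}. esssup (P (enat \<nu>))
        (nn_cond_exp (P (enat \<nu>)) (F (enat (\<nu> - 1)))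
          (\<lambda>\<omega>. ennreal_of_enat (T \<omega> + 1 - enat \<nu>))))"


text \<open>The negative part of \<open>f * ln (f / g)\<close> is always integrable when \<open>f\<close> and \<open>g\<close> are probability
  densities and \<open>g\<close> vanishes only where \<open>f\<close> does; failure of integrability therefore means that
  the integral is \<open>\<infinity>\<close>. The convention \<open>0 * ln 0 = 0\<close> holds by totality of \<open>ln\<close>, but
  \<open>f * ln (f / 0) = \<infinity>\<close> for \<open>f > 0\<close> has to be imposed.\<close>

definition info_density :: "'x measure \<Rightarrow> ('x \<Rightarrow> real) \<Rightarrow> ('x \<Rightarrow> real) \<Rightarrow> ereal" where
  "info_density \<mu> f g =
     (if (AE x in \<mu>. g x = 0 \<longrightarrow> f x = 0) \<and> integrable \<mu> (\<lambda>x. f x * ln (f x / g x))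
      then ereal (\<integral>x. f x * ln (f x / g x) \<partial>\<mu>) else \<infinity>)"

text \<open>Same convention, for success probabilities in \<open>{0<..1}\<close>.\<close>

definition info_channel :: "real \<Rightarrow> real \<Rightarrow> ereal" where
  "info_channel p q =
     (if q = 1 \<and> p \<noteq> 1 then \<infinity>
      else ereal (p * ln (p / q) + (1 - p) * ln ((1 - p) / (1 - q))))"

definition info_number ::
  "real \<Rightarrow> real \<Rightarrow> real \<Rightarrow> 'x measure \<Rightarrow> ('x \<Rightarrow> real) \<Rightarrow> ('x \<Rightarrow> real) \<Rightarrow> ereal" where
  "info_number r p0 p1 \<mu> f0 f1 =
     ereal r * (ereal (1 / p1) * info_channel p1 p0 + info_density \<mu> f1 f0)"

end

theory Submission
  imports Defs
begin

text \<open>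
  Let \<open>T\<close> have mean run length at least \<open>\<gamma>\<close>. Since the queue has negative drift, optional stopping
  shows that it is empty in a positive proportion of the slots before \<open>T\<close>. Each slot \<open>t\<close> lies in at
  most \<open>m + 1\<close> of the windows \<open>{k + 1..k + m + 1}\<close>, so averaging over the slots \<open>k\<close> with empty queue
  gives one of them, with \<open>H = {k < T, Q k = 0}\<close>, for which \<open>T \<le> k + m + 1\<close> has conditional probability
  given \<open>H\<close> less than \<open>\<gamma> powr (- b)\<close> under the pre-change law, \<open>b < 1\<close> being as close to 1 as we like.
  The window length \<open>m\<close> is a little less than \<open>ln \<gamma> / I\<close>. Let the change happen at \<open>k + 1\<close>. On the
  window the likelihood ratio with respect to the pre-change law is a product of one factor for each
  busy slot and one for each arrival. Given \<open>H\<close>, its logarithm exceeds \<open>(I + \<delta>) m\<close> with small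
  probability: by the balance of the queue, which is empty in slot \<open>k\<close>, it is up to a bounded term at
  most a martingale plus a sum of independent variables with mean \<open>I\<close>. Hence
  \<open>T > k + m + 1\<close> has conditional probability close to 1 after the change as well. As \<open>H\<close> is observed
  before the change, the essential supremum of the conditional delay is at least about \<open>m\<close>.
\<close>

section \<open>Resampling coordinates of product measures\<close>

text \<open>A bound on the likelihood ratio that is uniform over all histories fails: after a long
  backlog every slot of the window is busy, and the channel yields \<kappa> per slot, where \<kappa>
  stands for I(p1,p0), instead of the long-run rate r \<kappa> / p1. This is why an empty queue is
  sought. The two laws differ also in coordinates that nobody sees: the channel in an idle slot and
  the measurement in a slot without arrival. A density on the whole sample space would contain their
  factors, and its logarithm would grow at the rate I(p1,p0) + I(f1,f0). They are integrated out by
  restricting the change of measure to functions that cannot tell unseen contents apart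
  (\<open>observable\<close>). A measurement is charged to the slot in which it is produced, not to
  the slot of its delivery. The ratio then reads packets that may still be waiting, which this
  invariance permits, and the contributions of the arrivals become independent with a common law.
  Only the mean of the measurement log-ratio is known to be finite, so its sum is controlled by
  truncation.\<close>

lemma pair_measure_shuffle:
  assumes "prob_space A" "prob_space B" "prob_space C" "prob_space E"
  shows "(A \<Otimes>\<^sub>M B) \<Otimes>\<^sub>M (C \<Otimes>\<^sub>M E) =
    distr ((A \<Otimes>\<^sub>M C) \<Otimes>\<^sub>M (B \<Otimes>\<^sub>M E)) ((A \<Otimes>\<^sub>M B) \<Otimes>\<^sub>M (C \<Otimes>\<^sub>M E))
      (\<lambda>((a, c), (b, d)). ((a, b), (c, d)))" (is "?L = ?R")
proof (rule measure_eqI)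
  interpret A: prob_space A by fact
  interpret B: prob_space B by fact
  interpret C: prob_space C by fact
  interpret E: prob_space E by fact
  interpret BC: pair_prob_space B C ..
  interpret CE: pair_prob_space C E ..
  interpret BE: pair_prob_space B E ..
  show "sets ?L = sets ?R" by simp
  fix T assume "T \<in> sets ?L"
  then have T[measurable]: "T \<in> sets ((A \<Otimes>\<^sub>M B) \<Otimes>\<^sub>M (C \<Otimes>\<^sub>M E))" .
  have "emeasure ?L T = (\<integral>\<^sup>+a. \<integral>\<^sup>+b. \<integral>\<^sup>+c. \<integral>\<^sup>+d. indicator T ((a, b), (c, d)) \<partial>E \<partial>C \<partial>B \<partial>A)"
    by (auto simp: CE.P.nn_integral_fst[symmetric] B.nn_integral_fst[symmetric]
        E.nn_integral_fst[symmetric] simp flip: nn_integral_indicator intro!: nn_integral_cong)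
  also have "\<dots> = (\<integral>\<^sup>+a. \<integral>\<^sup>+c. \<integral>\<^sup>+b. \<integral>\<^sup>+d. indicator T ((a, b), (c, d)) \<partial>E \<partial>B \<partial>C \<partial>A)"
    by (intro nn_integral_cong BC.Fubini'[symmetric]) measurable
  also have "\<dots> = emeasure ?R T"
  proof -
    have [measurable]: "(\<lambda>((a, c), (b, d)). ((a, b), (c, d))) \<in>
        (A \<Otimes>\<^sub>M C) \<Otimes>\<^sub>M (B \<Otimes>\<^sub>M E) \<rightarrow>\<^sub>M (A \<Otimes>\<^sub>M B) \<Otimes>\<^sub>M (C \<Otimes>\<^sub>M E)"
      by (simp add: split_beta')
    have "emeasure ?R T = (\<integral>\<^sup>+x. indicator T ((\<lambda>((a, c), (b, d)). ((a, b), (c, d))) x)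
        \<partial>((A \<Otimes>\<^sub>M C) \<Otimes>\<^sub>M (B \<Otimes>\<^sub>M E)))"
      by (subst nn_integral_indicator[symmetric], simp, rule nn_integral_distr) simp_all
    also have "\<dots> = (\<integral>\<^sup>+x. \<integral>\<^sup>+b. \<integral>\<^sup>+d. indicator T ((fst x, b), (snd x, d)) \<partial>E \<partial>B \<partial>(A \<Otimes>\<^sub>M C))"
      by (auto simp: BE.P.nn_integral_fst[symmetric] E.nn_integral_fst[symmetric] split_beta' space_pair_measure
          intro!: nn_integral_cong)
    also have "\<dots> = (\<integral>\<^sup>+a. \<integral>\<^sup>+c. \<integral>\<^sup>+b. \<integral>\<^sup>+d. indicator T ((a, b), (c, d)) \<partial>E \<partial>B \<partial>C \<partial>A)"
      by (subst C.nn_integral_fst[symmetric]) auto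
    finally show ?thesis by simp
  qed
  finally show "emeasure ?L T = emeasure ?R T" .
qed

text \<open>Independent renewals of two factors amount to one renewal of the pair. This allows a
  nested product to be resampled factor by factor, from the inside outwards.\<close>

lemma distr_pair_resample:
  assumes prob: "prob_space A" "prob_space A2" "prob_space B" "prob_space B2"
    and [measurable]: "case_prod \<phi> \<in> A \<Otimes>\<^sub>M A2 \<rightarrow>\<^sub>M A" "case_prod \<psi> \<in> B \<Otimes>\<^sub>M B2 \<rightarrow>\<^sub>M B"
  shows "distr (A \<Otimes>\<^sub>M A2) A (case_prod \<phi>) \<Otimes>\<^sub>M distr (B \<Otimes>\<^sub>M B2) B (case_prod \<psi>) =
    distr ((A \<Otimes>\<^sub>M B) \<Otimes>\<^sub>M (A2 \<Otimes>\<^sub>M B2)) (A \<Otimes>\<^sub>M B) (\<lambda>((x, y), (x', y')). (\<phi> x x', \<psi> y y'))"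
proof -
  have p: "prob_space (distr (B \<Otimes>\<^sub>M B2) B (case_prod \<psi>))"
    using prob by (intro prob_space.prob_space_distr prob_space_pair) auto
  have "distr (A \<Otimes>\<^sub>M A2) A (case_prod \<phi>) \<Otimes>\<^sub>M distr (B \<Otimes>\<^sub>M B2) B (case_prod \<psi>) =
      distr ((A \<Otimes>\<^sub>M A2) \<Otimes>\<^sub>M (B \<Otimes>\<^sub>M B2)) (A \<Otimes>\<^sub>M B) (\<lambda>(x, y). (case_prod \<phi> x, case_prod \<psi> y))"
    using p by (intro pair_measure_distr) (auto simp: prob_space_imp_sigma_finite)
  also have "\<dots> = distr ((A \<Otimes>\<^sub>M B) \<Otimes>\<^sub>M (A2 \<Otimes>\<^sub>M B2)) (A \<Otimes>\<^sub>M B) (\<lambda>((x, y), (x', y')). (\<phi> x x', \<psi> y y'))"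
    by (subst pair_measure_shuffle[OF prob])
      (simp add: distr_distr comp_def split_beta')
  finally show ?thesis .
qed

text \<open>For a first factor that is kept, such as the initial queue or the initial
  measurements.\<close>

lemma distr_pair_resample_snd:
  assumes prob: "prob_space A" "prob_space B" "prob_space B2"
    and [measurable]: "case_prod \<psi> \<in> B \<Otimes>\<^sub>M B2 \<rightarrow>\<^sub>M B"
  shows "A \<Otimes>\<^sub>M distr (B \<Otimes>\<^sub>M B2) B (case_prod \<psi>) =
    distr ((A \<Otimes>\<^sub>M B) \<Otimes>\<^sub>M B2) (A \<Otimes>\<^sub>M B) (\<lambda>((x, y), y'). (x, \<psi> y y'))"
proof (rule measure_eqI)
  interpret A: prob_space A by fact
  interpret B: prob_space B by fact
  interpret B2: prob_space B2 by fact
  interpret BB: pair_prob_space B B2 ..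
  interpret X: prob_space "distr (B \<Otimes>\<^sub>M B2) B (case_prod \<psi>)"
    by (intro BB.prob_space_distr) auto
  show "sets (A \<Otimes>\<^sub>M distr (B \<Otimes>\<^sub>M B2) B (case_prod \<psi>)) = 
    sets (distr ((A \<Otimes>\<^sub>M B) \<Otimes>\<^sub>M B2) (A \<Otimes>\<^sub>M B) (\<lambda>((x, y), y'). (x, \<psi> y y')))"
    by simp
  fix E assume "E \<in> sets (A \<Otimes>\<^sub>M distr (B \<Otimes>\<^sub>M B2) B (case_prod \<psi>))"
  then have [measurable]: "E \<in> sets (A \<Otimes>\<^sub>M B)" by simp
  have "emeasure (A \<Otimes>\<^sub>M distr (B \<Otimes>\<^sub>M B2) B (case_prod \<psi>)) E =
      (\<integral>\<^sup>+x. \<integral>\<^sup>+y. indicator E (x, y) \<partial>distr (B \<Otimes>\<^sub>M B2) B (case_prod \<psi>) \<partial>A)"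
    by (rule X.emeasure_pair_measure) simp
  also have "\<dots> = (\<integral>\<^sup>+x. \<integral>\<^sup>+y. \<integral>\<^sup>+y'. indicator E (x, \<psi> y y') \<partial>B2 \<partial>B \<partial>A)"
    by (auto simp: nn_integral_distr B2.nn_integral_fst[symmetric] intro!: nn_integral_cong)
  also have "\<dots> = emeasure (distr ((A \<Otimes>\<^sub>M B) \<Otimes>\<^sub>M B2) (A \<Otimes>\<^sub>M B) (\<lambda>((x, y), y'). (x, \<psi> y y'))) E"
    by (simp add: emeasure_distr nn_integral_distr B.nn_integral_fst[symmetric]
        B2.nn_integral_fst[symmetric] split_beta' flip: nn_integral_indicator)
  finally show "emeasure (A \<Otimes>\<^sub>M distr (B \<Otimes>\<^sub>M B2) B (case_prod \<psi>)) E =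
    emeasure (distr ((A \<Otimes>\<^sub>M B) \<Otimes>\<^sub>M B2) (A \<Otimes>\<^sub>M B) (\<lambda>((x, y), y'). (x, \<psi> y y'))) E" .
qed

lemma measurable_override_on[measurable]:
  "(\<lambda>(x, y). override_on x y J) \<in> PiM UNIV M \<Otimes>\<^sub>M PiM UNIV M \<rightarrow>\<^sub>M PiM UNIV M"
  unfolding override_on_def by (intro measurable_PiM_single') (auto simp: split_beta' space_PiM PiE_iff space_pair_measure)

text \<open>It suffices to compare cylinders. The preimage of a cylinder is a rectangle: its indices
  outside \<open>J\<close> are read from the first family, those in \<open>J\<close> from the
  second.\<close>

lemma PiM_override_on:
  fixes M M' :: "'i \<Rightarrow> 'b measure"
  assumes prob: "\<And>k. prob_space (M k)" "\<And>k. prob_space (M' k)"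
    and s[simp, measurable_cong]: "\<And>k. sets (M' k) = sets (M k)"
  shows "PiM UNIV (override_on M M' J) =
    distr (PiM UNIV M \<Otimes>\<^sub>M PiM UNIV M') (PiM UNIV M) (\<lambda>(x, y). override_on x y J)"
    (is "?L = ?R")
proof (rule measure_eqI_PiM_infinite[OF refl])
  have s1: "sets (override_on M M' J k) = sets (M k)" for k
    by (auto simp: override_on_def)
  have sP: "sets (PiM UNIV M') = sets (PiM UNIV M)"
    by (rule sets_PiM_cong) auto
  have sp: "space (M' k) = space (M k)" for k
    using s by (rule sets_eq_imp_space_eq)
  have m: "(\<lambda>(x, y). override_on x y J) \<in> PiM UNIV M \<Otimes>\<^sub>M PiM UNIV M' \<rightarrow>\<^sub>M PiM UNIV M"
    using measurable_override_on[of J M]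
    by (simp cong: measurable_cong_sets sets_pair_measure_cong add: sP)
  show sL: "sets ?R = sets (PiM UNIV (override_on M M' J))"
    by (auto intro!: sets_PiM_cong simp: s1)
  have pr: "prob_space (override_on M M' J k)" for k
    using prob by (simp add: override_on_def)
  interpret L: prob_space ?L by (intro prob_space_PiM pr)
  show "finite_measure ?L" by (rule L.finite_measure_axioms)
  fix A and F :: "'i set"
  assume F: "finite F" "F \<subseteq> UNIV" and A: "\<And>i. i \<in> F \<Longrightarrow> A i \<in> sets (override_on M M' J i)"
  have A': "i \<in> F \<Longrightarrow> A i \<in> sets (M i)" "i \<in> F \<Longrightarrow> A i \<in> sets (M' i)" for i
    using A[of i] by (auto simp: s1)
  interpret P: prob_space "PiM UNIV M" by (intro prob_space_PiM prob)
  interpret P': prob_space "PiM UNIV M'" by (intro prob_space_PiM prob)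
  have emb: "prod_emb UNIV (override_on M M' J) F (Pi\<^sub>E F A) = prod_emb UNIV M F (Pi\<^sub>E F A)"
    by (auto simp: prod_emb_def space_PiM sets_eq_imp_space_eq[OF s1])
  have E: "prod_emb UNIV M F (Pi\<^sub>E F A) \<in> sets (PiM UNIV M)"
    using A' F by (intro sets_PiM_I) auto
  have vi: "(\<lambda>(x, y). override_on x y J) -` prod_emb UNIV M F (Pi\<^sub>E F A) \<inter> space (PiM UNIV M \<Otimes>\<^sub>M PiM UNIV M')
     = prod_emb UNIV M (F - J) (Pi\<^sub>E (F - J) A) \<times> prod_emb UNIV M' (F \<inter> J) (Pi\<^sub>E (F \<inter> J) A)"
    by (auto simp: prod_emb_def space_PiM space_pair_measure override_on_def PiE_iff sp split: if_splits)
  have "emeasure ?R (prod_emb UNIV M F (Pi\<^sub>E F A)) =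
      emeasure (PiM UNIV M \<Otimes>\<^sub>M PiM UNIV M') (prod_emb UNIV M (F - J) (Pi\<^sub>E (F - J) A) \<times> prod_emb UNIV M' (F \<inter> J) (Pi\<^sub>E (F \<inter> J) A))"
    using E m by (simp add: emeasure_distr vi)
  also have "\<dots> = emeasure (PiM UNIV M) (prod_emb UNIV M (F - J) (Pi\<^sub>E (F - J) A)) *
      emeasure (PiM UNIV M') (prod_emb UNIV M' (F \<inter> J) (Pi\<^sub>E (F \<inter> J) A))"
    using A' F by (intro P'.emeasure_pair_measure_Times sets_PiM_I) auto
  also have "\<dots> = (\<Prod>i\<in>F - J. emeasure (M i) (A i)) * (\<Prod>i\<in>F \<inter> J. emeasure (M' i) (A i))"
    using A' F prob by (intro arg_cong2[where f="(*)"] emeasure_PiM_emb) auto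
  also have "\<dots> = (\<Prod>i\<in>(F - J) \<union> (F \<inter> J). emeasure (override_on M M' J i) (A i))"
    using F by (subst prod.union_disjoint) (auto simp: override_on_def)
  also have "(F - J) \<union> (F \<inter> J) = F" by auto
  finally show "emeasure ?L (prod_emb UNIV (override_on M M' J) F (Pi\<^sub>E F A)) =
     emeasure ?R (prod_emb UNIV (override_on M M' J) F (Pi\<^sub>E F A))"
    unfolding emb using A F by (simp add: emeasure_PiM_emb pr flip: emb)
qed

text \<open>\<open>N\<close> is realised as the \<open>j\<close>-th marginal of a whole family
  \<open>M'\<close>, so that overriding on \<open>{j}\<close> applies; the other coordinates of the
  second family are then projected away.\<close>

lemma PiM_fun_upd:
  fixes M :: "'i \<Rightarrow> 'b measure"
  assumes prob: "\<And>k. prob_space (M k)" "prob_space N"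
    and s[simp, measurable_cong]: "sets N = sets (M j)"
  shows "PiM UNIV (M(j := N)) = distr (PiM UNIV M \<Otimes>\<^sub>M N) (PiM UNIV M) (\<lambda>(x, y). x(j := y))"
proof -
  define M' where "M' = M(j := N)"
  have p': "prob_space (M' k)" and s': "sets (M' k) = sets (M k)" for k
    using prob by (auto simp: M'_def)
  have sP[measurable_cong]: "sets (PiM UNIV M') = sets (PiM UNIV M)"
    by (rule sets_PiM_cong) (auto simp: s')
  interpret N: prob_space N by fact
  have cN: "distr (PiM UNIV M') N (\<lambda>y. y j) = N"
    using distr_PiM_component[of UNIV M' j] p' by (simp add: M'_def)
  have mj[measurable]: "(\<lambda>y. y j) \<in> PiM UNIV M' \<rightarrow>\<^sub>M N"
    using measurable_component_singleton[of j UNIV M'] by (simp add: M'_def)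
  have "PiM UNIV M' = PiM UNIV (override_on M M' {j})"
    by (auto simp: M'_def override_on_def intro!: PiM_cong)
  also have "\<dots> = distr (PiM UNIV M \<Otimes>\<^sub>M PiM UNIV M') (PiM UNIV M) (\<lambda>(x, y). override_on x y {j})"
    by (intro PiM_override_on prob p' s')
  also have "(\<lambda>(x, y). override_on x y {j}) = (\<lambda>(x, y). x(j := y)) \<circ> (\<lambda>(x, y). (x, y j))"
    by (auto simp: override_on_def fun_eq_iff)
  also have "distr (PiM UNIV M \<Otimes>\<^sub>M PiM UNIV M') (PiM UNIV M) ((\<lambda>(x, y). x(j := y)) \<circ> (\<lambda>(x, y). (x, y j))) =
    distr (distr (PiM UNIV M \<Otimes>\<^sub>M PiM UNIV M') (PiM UNIV M \<Otimes>\<^sub>M N) (\<lambda>(x, y). (x, y j))) (PiM UNIV M) (\<lambda>(x, y). x(j := y))"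
  proof (rule distr_distr[symmetric])
    show "(\<lambda>(x, y). x(j := y)) \<in> PiM UNIV M \<Otimes>\<^sub>M N \<rightarrow>\<^sub>M PiM UNIV M"
      using measurable_add_dim[of j UNIV M] by (simp cong: measurable_cong_sets sets_pair_measure_cong)
    show "(\<lambda>(x, y). (x, y j)) \<in> PiM UNIV M \<Otimes>\<^sub>M PiM UNIV M' \<rightarrow>\<^sub>M PiM UNIV M \<Otimes>\<^sub>M N"
      by measurable
  qed
  also have "distr (PiM UNIV M \<Otimes>\<^sub>M PiM UNIV M') (PiM UNIV M \<Otimes>\<^sub>M N) (\<lambda>(x, y). (x, y j)) =
     distr (PiM UNIV M) (PiM UNIV M) (\<lambda>x. x) \<Otimes>\<^sub>M distr (PiM UNIV M') N (\<lambda>y. y j)"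
    by (intro pair_measure_distr[symmetric]) (auto simp: cN N.sigma_finite_measure_axioms)
  also have "\<dots> = PiM UNIV M \<Otimes>\<^sub>M N"
    by (simp add: cN distr_id)
  finally show ?thesis unfolding M'_def .
qed

section \<open>The queue as a function of the sample point\<close>

definition set_slot :: "nat \<Rightarrow> bool \<times> bool \<times> 'x \<Rightarrow> 'x outcome \<Rightarrow> 'x outcome" where
  "set_slot j = (\<lambda>(a', c', x) (q, a, c, u, v). (q, a(j := a'), c(j := c'), u, v(j := x)))"

lemma set_slot_simps[simp]:
  "initial_queue (set_slot j s \<omega>) = initial_queue \<omega>"
  "initial_meas i (set_slot j s \<omega>) = initial_meas i \<omega>"
  "arrival i (set_slot j s \<omega>) = (if i = j then fst s else arrival i \<omega>)"
  "channel_ok i (set_slot j s \<omega>) = (if i = j then fst (snd s) else channel_ok i \<omega>)"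
  "slot_meas i (set_slot j s \<omega>) = (if i = j then snd (snd s) else slot_meas i \<omega>)"
  by (auto simp: set_slot_def initial_queue_def initial_meas_def arrival_def channel_ok_def
      slot_meas_def split: prod.splits)

lemma Y_eq_Some_1: "Y k \<omega> = Some (Suc 0) \<longleftrightarrow> 0 < Q k \<omega> \<and> channel_ok k \<omega>"
  by (auto simp: Y_def transmission_def)

lemma Q_Suc_Suc:
  "Q (Suc (Suc k)) \<omega> =
    Q (Suc k) \<omega> - of_bool (channel_ok (Suc k) \<omega>) + of_bool (arrival (Suc k) \<omega>)"
  by (simp add: next_queue_def transmission_def)

declare Q.simps(3)[simp del]

lemma Q_Suc: "1 \<le> k \<Longrightarrow> Q (Suc k) \<omega> = Q k \<omega> - of_bool (channel_ok k \<omega>) + of_bool (arrival k \<omega>)"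
  by (cases k) (auto simp: Q_Suc_Suc)

section \<open>Counting arrivals and deliveries, and what they depend on\<close>

lemma S_0[simp]: "S 0 \<omega> = 0"
  by (simp add: S_def)

lemma S_Suc: "S (Suc k) \<omega> = S k \<omega> + of_bool (arrival (Suc k) \<omega>)"
proof -
  have "{i \<in> {1..Suc k}. arrival i \<omega>} =
    (if arrival (Suc k) \<omega> then insert (Suc k) {i \<in> {1..k}. arrival i \<omega>} else {i \<in> {1..k}. arrival i \<omega>})"
    by (auto simp: le_Suc_eq)
  then show ?thesis by (simp add: S_def)
qed

lemma D_0[simp]: "D 0 \<omega> = 0"
  by (simp add: D_def)

lemma D_Suc: "D (Suc k) \<omega> = D k \<omega> + of_bool (Y (Suc k) \<omega> = Some 1)"
proof -
  have "{i \<in> {1..Suc k}. Y i \<omega> = Some 1} =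
    (if Y (Suc k) \<omega> = Some 1 then insert (Suc k) {i \<in> {1..k}. Y i \<omega> = Some 1} else {i \<in> {1..k}. Y i \<omega> = Some 1})"
    by (auto simp: le_Suc_eq)
  then show ?thesis by (simp add: D_def)
qed

text \<open>Conservation of packets. The truncated subtraction loses nothing, since a success
  presupposes a nonempty queue.\<close>

lemma queue_balance: "Q (Suc k) \<omega> + D k \<omega> = Q 1 \<omega> + S k \<omega>"
proof (induction k)
  case (Suc k)
  then show ?case
    by (cases "Q (Suc k) \<omega>") (auto simp: Q_Suc_Suc D_Suc S_Suc Y_eq_Some_1)
qed simp

text \<open>Channel bits need to agree only in the busy slots of \<open>\<omega>\<close>;
  inductively these are also the busy slots of \<open>\<omega>'\<close>. This makes the channel of
  an idle slot invisible.\<close>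

lemma Q_cong:
  assumes "initial_queue \<omega> = initial_queue \<omega>'"
    and "\<And>i. 1 \<le> i \<Longrightarrow> i < k \<Longrightarrow> arrival i \<omega> = arrival i \<omega>'"
    and "\<And>i. 1 \<le> i \<Longrightarrow> i < k \<Longrightarrow> 0 < Q i \<omega> \<Longrightarrow> channel_ok i \<omega> = channel_ok i \<omega>'"
  shows "Q k \<omega> = Q k \<omega>'"
proof -
  have "i \<le> k \<Longrightarrow> Q i \<omega> = Q i \<omega>'" for i
  proof (induction i rule: induct_nat_012)
    case (ge2 i)
    then have "Q (Suc i) \<omega> = Q (Suc i) \<omega>'" by simp
    then show ?case
      using assms(2)[of "Suc i"] assms(3)[of "Suc i"] ge2
      by (cases "Q (Suc i) \<omega>") (auto simp: Q_Suc_Suc)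
  qed (use assms in simp_all)
  then show ?thesis by simp
qed

lemma Y_cong:
  assumes "initial_queue \<omega> = initial_queue \<omega>'"
    and "\<And>i. 1 \<le> i \<Longrightarrow> i < k \<Longrightarrow> arrival i \<omega> = arrival i \<omega>'"
    and "\<And>i. i \<le> k \<Longrightarrow> 0 < Q i \<omega> \<Longrightarrow> channel_ok i \<omega> = channel_ok i \<omega>'"
  shows "Y k \<omega> = Y k \<omega>'"
proof -
  have "Q k \<omega> = Q k \<omega>'"
    using assms by (intro Q_cong) auto
  then show ?thesis
    using assms(3)[of k] by (auto simp: Y_def transmission_def)
qed

lemma S_attained: "i \<le> S k \<omega> \<Longrightarrow> \<exists>l\<le>k. S l \<omega> = i"
proof (induction k)
  case (Suc k)
  show ?case
  proof (cases "i \<le> S k \<omega>")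
    case True
    then show ?thesis using Suc.IH le_SucI by blast
  next
    case False
    then have "S (Suc k) \<omega> = i"
      using Suc.prems by (cases "arrival (Suc k) \<omega>") (auto simp: S_Suc)
    then show ?thesis by blast
  qed
qed auto

text \<open>The delivered packet was in the queue when slot \<open>k\<close> began, so it was
  present initially or was produced before slot \<open>k\<close>.\<close>

lemma received_le: "Y k \<omega> = Some 1 \<Longrightarrow> 1 \<le> k \<Longrightarrow> D k \<omega> \<le> Q 1 \<omega> + S (k - 1) \<omega>"
  using queue_balance[of "k - 1" \<omega>] D_Suc[of "k - 1" \<omega>]
  by (auto simp: Y_eq_Some_1)

text \<open>A delivery in slot \<open>k\<close> concerns an earlier packet by
  \<open>received_le\<close>, so measurements are read only from slots before \<open>k\<close>, and
  among them only from those with an arrival.\<close>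

lemma Z_cong:
  assumes k: "1 \<le> k"
    and init: "initial_queue \<omega> = initial_queue \<omega>'" "\<And>j. initial_meas j \<omega> = initial_meas j \<omega>'"
    and arr: "\<And>i. 1 \<le> i \<Longrightarrow> i < k \<Longrightarrow> arrival i \<omega> = arrival i \<omega>'"
    and ch: "\<And>i. i \<le> k \<Longrightarrow> 0 < Q i \<omega> \<Longrightarrow> channel_ok i \<omega> = channel_ok i \<omega>'"
    and meas: "\<And>i. 1 \<le> i \<Longrightarrow> i < k \<Longrightarrow> arrival i \<omega> \<Longrightarrow> slot_meas i \<omega> = slot_meas i \<omega>'"
  shows "Z k \<omega> = Z k \<omega>'"
proof -
  have Y: "Y i \<omega> = Y i \<omega>'" if "i \<le> k" for i
    using assms that by (intro Y_cong) auto
  have D: "D k \<omega> = D k \<omega>'"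
    unfolding D_def using Y by (intro arg_cong[where f=card]) auto
  have S: "S l \<omega> = S l \<omega>'" if "l < k" for l
    unfolding S_def using arr that by (intro arg_cong[where f=card]) auto
  have Q1: "Q 1 \<omega> = Q 1 \<omega>'" using init by simp
  have "X (D k \<omega>) \<omega> = X (D k \<omega>') \<omega>'" if y: "Y k \<omega> = Some 1"
  proof (cases "D k \<omega> \<le> Q 1 \<omega>")
    case True
    then show ?thesis using init D by (simp add: X_def)
  next
    case False
    define i where "i = D k \<omega> - Q 1 \<omega>"
    have i: "1 \<le> i" "i \<le> S (k - 1) \<omega>"
      using False received_le[OF y k] by (auto simp: i_def)
    define l where "l = (LEAST l. S l \<omega> = i)"
    obtain l' where l': "l' \<le> k - 1" "S l' \<omega> = i"
      using S_attained[OF i(2)] by auto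
    have Sl: "S l \<omega> = i" unfolding l_def by (rule LeastI[of _ l']) fact
    have lk: "l < k" using Least_le[of "\<lambda>l. S l \<omega> = i", OF l'(2)] l'(1) k by (simp add: l_def)
    have less: "S m \<omega> \<noteq> i" if "m < l" for m
      using not_less_Least[of m "\<lambda>l. S l \<omega> = i"] that by (simp add: l_def)
    \<comment> \<open>By minimality of \<open>l\<close> the count jumps at \<open>l\<close>, hence
      \<open>l\<close> is a slot with an arrival and the hypothesis on measurements covers
      it.\<close>
    have l0: "l \<noteq> 0" using Sl i by (cases l) auto
    then have a: "arrival l \<omega>"
      using Sl less[of "l - 1"] S_Suc[of "l - 1" \<omega>] by (cases l) (auto split: if_splits)
    have "(LEAST l. S l \<omega>' = i) = l"
    proof (rule Least_equality)
      show "S l \<omega>' = i" using S[OF lk] Sl by simp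
      show "l \<le> m" if "S m \<omega>' = i" for m
        using less[of m] S[of m] that lk by (cases "m < l") auto
    qed
    then show ?thesis
      using False D Q1 meas[of l] l0 lk a
      by (simp add: X_def i_def[symmetric] flip: l_def) (simp add: l_def i_def)
  qed
  then show ?thesis
    using Y[of k] by (simp add: Z_def)
qed

lemma Q_set_slot[simp]: "k \<le> j \<Longrightarrow> Q k (set_slot j s \<omega>) = Q k \<omega>"
  by (rule Q_cong) auto

lemma Y_set_slot[simp]: "k < j \<Longrightarrow> Y k (set_slot j s \<omega>) = Y k \<omega>"
  by (rule Y_cong) auto

lemma Z_set_slot[simp]: "1 \<le> k \<Longrightarrow> k < j \<Longrightarrow> Z k (set_slot j s \<omega>) = Z k \<omega>"
  by (rule Z_cong) auto

text \<open>The decision maker cannot tell apart two contents of a slot, begun with \<open>q\<close> packets in the queue,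
  that are related as follows.\<close>

definition same_slot :: "nat \<Rightarrow> bool \<times> bool \<times> 'x \<Rightarrow> bool \<times> bool \<times> 'x \<Rightarrow> bool" where
  "same_slot q s s' \<longleftrightarrow> fst s = fst s' \<and> (0 < q \<longrightarrow> fst (snd s) = fst (snd s')) \<and>
     (fst s \<longrightarrow> snd (snd s) = snd (snd s'))"

lemma same_slot_cong:
  assumes "same_slot (Q j \<omega>) s s'"
  shows Q_same_slot: "Q k (set_slot j s \<omega>) = Q k (set_slot j s' \<omega>)"
    and Y_same_slot: "Y k (set_slot j s \<omega>) = Y k (set_slot j s' \<omega>)"
    and Z_same_slot: "1 \<le> k \<Longrightarrow> Z k (set_slot j s \<omega>) = Z k (set_slot j s' \<omega>)"
  using assms
  by (auto simp: same_slot_def intro!: Q_cong Y_cong Z_cong)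

text \<open>The sets that do not separate \<open>\<omega>\<close> from \<open>\<omega>'\<close> are
  closed under complements and countable unions, and the generating preimages are among
  them.\<close>

lemma sets_observations_cong:
  assumes E: "E \<in> sets (observations \<mu> t)"
    and \<omega>: "\<omega> \<in> outcome_space \<mu>" "\<omega>' \<in> outcome_space \<mu>"
    and "Q 1 \<omega> = Q 1 \<omega>'" "\<And>k. 1 \<le> k \<Longrightarrow> enat k \<le> t \<Longrightarrow> Y k \<omega> = Y k \<omega>' \<and> Z k \<omega> = Z k \<omega>'"
  shows "\<omega> \<in> E \<longleftrightarrow> \<omega>' \<in> E"
proof -
  have eq: "(\<lambda>k\<in>observed_slots t. (Y k \<omega>, Z k \<omega>)) = (\<lambda>k\<in>observed_slots t. (Y k \<omega>', Z k \<omega>'))"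
    using assms by (intro restrict_ext) (auto simp: observed_slots_def)
  show ?thesis
    using E unfolding observations_def sets_vimage_algebra
    by (induction rule: sigma_sets.induct) (use \<omega> eq assms(4) in auto)
qed

section \<open>Measurability in one sigma-algebra that is common to all laws\<close>

definition outcome_algebra :: "'x measure \<Rightarrow> 'x outcome measure" where
  "outcome_algebra \<mu> = count_space UNIV \<Otimes>\<^sub>M (\<Pi>\<^sub>M k\<in>UNIV. count_space UNIV) \<Otimes>\<^sub>M
     (\<Pi>\<^sub>M k\<in>UNIV. count_space UNIV) \<Otimes>\<^sub>M (\<Pi>\<^sub>M j\<in>UNIV. \<mu>) \<Otimes>\<^sub>M (\<Pi>\<^sub>M k\<in>UNIV. \<mu>)"

lemma space_outcome_algebra: "space (outcome_algebra \<mu>) = outcome_space \<mu>"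
  by (auto simp: outcome_algebra_def outcome_space_def space_pair_measure space_PiM)

lemma measurable_discrete2:
  fixes g :: "'a::countable \<Rightarrow> 'b::countable \<Rightarrow> 'c"
  assumes "f1 \<in> M \<rightarrow>\<^sub>M count_space UNIV" "f2 \<in> M \<rightarrow>\<^sub>M count_space UNIV"
  shows "(\<lambda>x. g (f1 x) (f2 x)) \<in> M \<rightarrow>\<^sub>M count_space UNIV"
  by (rule measurable_compose_countable[OF _ assms(1)],
      rule measurable_compose_countable[OF _ assms(2)]) simp

lemma measurable_coordinates[measurable]:
  shows measurable_initial_queue: "initial_queue \<in> outcome_algebra \<mu> \<rightarrow>\<^sub>M count_space UNIV"
    and measurable_arrival: "arrival k \<in> outcome_algebra \<mu> \<rightarrow>\<^sub>M count_space UNIV"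
    and measurable_channel_ok: "channel_ok k \<in> outcome_algebra \<mu> \<rightarrow>\<^sub>M count_space UNIV"
    and measurable_initial_meas: "initial_meas k \<in> outcome_algebra \<mu> \<rightarrow>\<^sub>M \<mu>"
    and measurable_slot_meas: "slot_meas k \<in> outcome_algebra \<mu> \<rightarrow>\<^sub>M \<mu>"
  unfolding initial_queue_def arrival_def channel_ok_def initial_meas_def slot_meas_def outcome_algebra_def
  by simp_all

lemma measurable_Q[measurable]: "Q k \<in> outcome_algebra \<mu> \<rightarrow>\<^sub>M count_space UNIV"
proof (induction k rule: induct_nat_012)
  case (ge2 k)
  have "(\<lambda>\<omega>. Q (Suc k) \<omega> - of_bool (channel_ok (Suc k) \<omega>)) \<in> outcome_algebra \<mu> \<rightarrow>\<^sub>M count_space UNIV"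
    by (rule measurable_discrete2[OF ge2(2) measurable_channel_ok])
  from measurable_discrete2[OF this measurable_arrival]
  have "(\<lambda>\<omega>. Q (Suc k) \<omega> - of_bool (channel_ok (Suc k) \<omega>) + of_bool (arrival (Suc k) \<omega>))
      \<in> outcome_algebra \<mu> \<rightarrow>\<^sub>M count_space UNIV" .
  then show ?case by (simp add: Q_Suc_Suc[abs_def])
qed (simp_all add: Q.simps[abs_def])

lemma measurable_Y[measurable]: "Y k \<in> outcome_algebra \<mu> \<rightarrow>\<^sub>M count_space UNIV"
  unfolding Y_def[abs_def] by (rule measurable_discrete2[OF measurable_Q measurable_channel_ok])

lemma measurable_S[measurable]: "S k \<in> outcome_algebra \<mu> \<rightarrow>\<^sub>M count_space UNIV"
  by (induction k) (auto simp: S_0[abs_def] S_Suc[abs_def] intro!: measurable_discrete2 measurable_arrival)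

lemma measurable_D[measurable]: "D k \<in> outcome_algebra \<mu> \<rightarrow>\<^sub>M count_space UNIV"
  by (induction k) (auto simp: D_0[abs_def] D_Suc[abs_def] intro!: measurable_discrete2 measurable_Y)

lemma measurable_X[measurable]: "X j \<in> outcome_algebra \<mu> \<rightarrow>\<^sub>M \<mu>"
proof -
  have e: "Measurable.pred (outcome_algebra \<mu>) (\<lambda>\<omega>. S k \<omega> = j - Q 1 \<omega>)" for k
    by (rule measurable_discrete2[OF measurable_S measurable_Q])
  have l: "(\<lambda>\<omega>. LEAST k. S k \<omega> = j - Q 1 \<omega>) \<in> outcome_algebra \<mu> \<rightarrow>\<^sub>M count_space UNIV"
    using e by (rule measurable_Least)
  have "(\<lambda>\<omega>. slot_meas (LEAST k. S k \<omega> = j - Q 1 \<omega>) \<omega>) \<in> outcome_algebra \<mu> \<rightarrow>\<^sub>M \<mu>"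
    by (rule measurable_compose_countable[OF _ l]) measurable
  moreover have "Measurable.pred (outcome_algebra \<mu>) (\<lambda>\<omega>. j \<le> Q 1 \<omega>)"
    by (rule measurable_compose[OF measurable_Q]) simp
  ultimately show ?thesis
    unfolding X_def[abs_def] by (intro measurable_If measurable_initial_meas) (simp_all add: pred_def)
qed

lemma space_option_space: "space (option_space \<mu>) = insert None (Some ` space \<mu>)"
  unfolding option_space_def using sets.sets_into_space[of _ \<mu>] by (subst space_measure_of) auto

lemma measurable_Some[measurable]: "Some \<in> \<mu> \<rightarrow>\<^sub>M option_space \<mu>"
  unfolding option_space_def
proof (rule measurable_measure_of)
  show "insert {None} ((`) Some ` sets \<mu>) \<subseteq> Pow (insert None (Some ` space \<mu>))"
    using sets.sets_into_space[of _ \<mu>] by auto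
  show "Some \<in> space \<mu> \<rightarrow> insert None (Some ` space \<mu>)"
    by simp
  fix A assume "A \<in> insert {None} ((`) Some ` sets \<mu>)"
  then consider "A = {None}" | B where "A = Some ` B" "B \<in> sets \<mu>"
    by blast
  then show "Some -` A \<inter> space \<mu> \<in> sets \<mu>"
  proof cases
    case 1
    then have "Some -` A = {}" by auto
    then show ?thesis by simp
  next
    case 2
    then show ?thesis by (simp add: inj_vimage_image_eq)
  qed
qed

lemma measurable_Z[measurable]: "Z k \<in> outcome_algebra \<mu> \<rightarrow>\<^sub>M option_space \<mu>"
proof -
  have 1: "(\<lambda>\<omega>. Some (X (D k \<omega>) \<omega>)) \<in> outcome_algebra \<mu> \<rightarrow>\<^sub>M option_space \<mu>"
    by (rule measurable_compose[OF measurable_compose_countable[OF measurable_X measurable_D] measurable_Some])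
  have 2: "Measurable.pred (outcome_algebra \<mu>) (\<lambda>\<omega>. Y k \<omega> = Some 1)"
    by (rule measurable_compose[OF measurable_Y]) simp
  have 3: "(\<lambda>\<omega>. None) \<in> outcome_algebra \<mu> \<rightarrow>\<^sub>M option_space \<mu>"
    by (simp add: space_option_space)
  show ?thesis
    unfolding Z_def[abs_def] using 2 by (intro measurable_If[OF 1 3]) (simp add: pred_def)
qed

lemma space_observations: "space (observations \<mu> t) = outcome_space \<mu>"
  by (simp add: observations_def)

lemma sets_observations_subset: "sets (observations \<mu> t) \<subseteq> sets (outcome_algebra \<mu>)"
  unfolding observations_def
  by (intro sets_image_in_sets) (auto simp: space_outcome_algebra intro!: measurable_Pair measurable_restrict
      measurable_Q measurable_Y measurable_Z)

text \<open>Emptiness in slot \<open>k\<close> shows at time \<open>k\<close> as the absence of a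
  transmission. The queue of slot \<open>k + 1\<close> would depend on the arrival in slot
  \<open>k\<close>, which is not among the observations; hence windows are opened by the condition
  \<open>Q k \<omega> = 0\<close>.\<close>

lemma observations_queue_empty: "{\<omega> \<in> outcome_space \<mu>. Q k \<omega> = 0} \<in> sets (observations \<mu> (enat k))"
  if "1 \<le> k"
proof -
  let ?f = "\<lambda>\<omega>. (Q 1 \<omega>, \<lambda>k\<in>observed_slots (enat k). (Y k \<omega>, Z k \<omega>))"
  let ?N = "count_space UNIV \<Otimes>\<^sub>M (\<Pi>\<^sub>M k\<in>observed_slots (enat k). count_space UNIV \<Otimes>\<^sub>M option_space \<mu>)"
  have k: "k \<in> observed_slots (enat k)" using that by (simp add: observed_slots_def)
  have m: "?f \<in> outcome_algebra \<mu> \<rightarrow>\<^sub>M ?N"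
    by (auto intro!: measurable_Pair measurable_restrict measurable_Q measurable_Y measurable_Z)
  have "Measurable.pred ?N (\<lambda>z. fst (snd z k) = None)"
    by (rule measurable_compose[where N="count_space UNIV"])
      (auto intro!: measurable_compose[OF measurable_snd measurable_compose[OF measurable_component_singleton[OF k]]])
  then have "{z \<in> space ?N. fst (snd z k) = None} \<in> sets ?N"
    by (simp add: pred_def)
  then have "?f -` {z \<in> space ?N. fst (snd z k) = None} \<inter> outcome_space \<mu> \<in> sets (observations \<mu> (enat k))"
    unfolding observations_def by (rule in_vimage_algebra)
  also have "?f -` {z \<in> space ?N. fst (snd z k) = None} \<inter> outcome_space \<mu> = {\<omega> \<in> outcome_space \<mu>. Q k \<omega> = 0}"
    using k measurable_space[OF m]
    by (auto simp: space_outcome_algebra Y_def transmission_def split: if_splits)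
  finally show ?thesis .
qed

lemma sets_observations_mono:
  assumes "s \<le> t"
  shows "sets (observations \<mu> s) \<subseteq> sets (observations \<mu> t)"
proof -
  let ?f = "\<lambda>t \<omega>. (Q 1 \<omega>, \<lambda>k\<in>observed_slots t. (Y k \<omega>, Z k \<omega>))"
  let ?N = "\<lambda>t. count_space UNIV \<Otimes>\<^sub>M (\<Pi>\<^sub>M k\<in>observed_slots t. count_space UNIV \<Otimes>\<^sub>M option_space \<mu>)"
  let ?g = "\<lambda>z. (fst z, restrict (snd z) (observed_slots s))"
  have sub: "observed_slots s \<subseteq> observed_slots t"
    using assms by (auto simp: observed_slots_def)
  have "?f t \<in> outcome_algebra \<mu> \<rightarrow>\<^sub>M ?N t"
    by (auto intro!: measurable_Pair measurable_restrict measurable_Q measurable_Y measurable_Z)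
  then have "?f t \<in> outcome_space \<mu> \<rightarrow> space (?N t)"
    by (simp only: measurable_def space_outcome_algebra mem_Collect_eq)
  then have t: "?f t \<in> observations \<mu> t \<rightarrow>\<^sub>M ?N t"
    unfolding observations_def by (rule measurable_vimage_algebra1)
  have g: "?g \<in> ?N t \<rightarrow>\<^sub>M ?N s"
    by (intro measurable_Pair measurable_fst measurable_compose[OF measurable_snd measurable_restrict_subset[OF sub]])
  have fs: "?f s = (\<lambda>\<omega>. ?g (?f t \<omega>))"
    using sub by (auto simp: fun_eq_iff restrict_def)
  have "?f s \<in> observations \<mu> t \<rightarrow>\<^sub>M ?N s"
    by (subst fs) (rule measurable_compose[OF t g])
  then show ?thesis
    unfolding observations_def[of \<mu> s] by (intro sets_image_in_sets space_observations)
qed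

section \<open>Resampling slots\<close>

lemma measurable_set_slot[measurable]:
  "(\<lambda>(\<omega>, s). set_slot j s \<omega>) \<in> outcome_algebra \<mu> \<Otimes>\<^sub>M (count_space UNIV \<Otimes>\<^sub>M count_space UNIV \<Otimes>\<^sub>M \<mu>)
     \<rightarrow>\<^sub>M outcome_algebra \<mu>"
proof -
  have upd: "(\<lambda>x. (f x)(j := g x)) \<in> M \<rightarrow>\<^sub>M PiM UNIV (\<lambda>_. N)"
    if "f \<in> M \<rightarrow>\<^sub>M PiM UNIV (\<lambda>_. N)" "g \<in> M \<rightarrow>\<^sub>M N" for f :: "'c \<Rightarrow> nat \<Rightarrow> 'd" and g M N
    using measurable_compose[OF measurable_Pair[OF that(1,2)] measurable_add_dim[of j UNIV "\<lambda>_. N"]]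
    by simp
  show ?thesis
    unfolding set_slot_def outcome_algebra_def split_beta'
    by (intro measurable_Pair upd) simp_all
qed

text \<open>Arrivals are kept because their law does not depend on the change point.\<close>

definition replace_after :: "nat \<Rightarrow> (nat \<Rightarrow> bool) \<times> (nat \<Rightarrow> 'x) \<Rightarrow> 'x outcome \<Rightarrow> 'x outcome" where
  "replace_after n = (\<lambda>(c', v') (q, a, c, u, v). (q, a, override_on c c' {n<..}, u, override_on v v' {n<..}))"

lemma replace_after_simps[simp]:
  "initial_queue (replace_after n s \<omega>) = initial_queue \<omega>"
  "initial_meas i (replace_after n s \<omega>) = initial_meas i \<omega>"
  "arrival i (replace_after n s \<omega>) = arrival i \<omega>"
  "i \<le> n \<Longrightarrow> channel_ok i (replace_after n s \<omega>) = channel_ok i \<omega>"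
  "i \<le> n \<Longrightarrow> slot_meas i (replace_after n s \<omega>) = slot_meas i \<omega>"
  by (auto simp: replace_after_def initial_queue_def initial_meas_def arrival_def channel_ok_def
      slot_meas_def override_on_def split: prod.splits)

lemma Q_replace_after[simp]: "k \<le> Suc n \<Longrightarrow> Q k (replace_after n s \<omega>) = Q k \<omega>"
  by (rule Q_cong) auto

lemma Y_replace_after[simp]: "k \<le> n \<Longrightarrow> Y k (replace_after n s \<omega>) = Y k \<omega>"
  by (rule Y_cong) auto

lemma Z_replace_after[simp]: "1 \<le> k \<Longrightarrow> k \<le> n \<Longrightarrow> Z k (replace_after n s \<omega>) = Z k \<omega>"
  by (rule Z_cong) auto

lemma measurable_replace_after[measurable]:
  "(\<lambda>(\<omega>, s). replace_after n s \<omega>) \<in> outcome_algebra \<mu> \<Otimes>\<^sub>M ((\<Pi>\<^sub>M k\<in>UNIV. count_space UNIV) \<Otimes>\<^sub>M (\<Pi>\<^sub>M k\<in>UNIV. \<mu>))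
     \<rightarrow>\<^sub>M outcome_algebra \<mu>"
proof -
  have o: "(\<lambda>x. override_on (f x) (g x) {n<..}) \<in> M \<rightarrow>\<^sub>M PiM UNIV (\<lambda>_. N)"
    if "f \<in> M \<rightarrow>\<^sub>M PiM UNIV (\<lambda>_. N)" "g \<in> M \<rightarrow>\<^sub>M PiM UNIV (\<lambda>_. N)" for f g :: "'c \<Rightarrow> nat \<Rightarrow> 'd" and M N
    using measurable_compose[OF measurable_Pair[OF that(1,2)] measurable_override_on[of "{n<..}"]]
    by simp
  show ?thesis
    unfolding replace_after_def outcome_algebra_def split_beta'
    by (intro measurable_Pair o) simp_all
qed

section \<open>Product laws with an arbitrary law for each slot\<close>

definition slot_law :: "real \<Rightarrow> bool pmf \<Rightarrow> 'x measure \<Rightarrow> (bool \<times> bool \<times> 'x) measure" where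
  "slot_law r b N = measure_pmf (bernoulli_pmf r) \<Otimes>\<^sub>M measure_pmf b \<Otimes>\<^sub>M N"

locale outcome_law =
  fixes r :: real and \<rho> :: "nat pmf" and \<mu> N0 :: "'x measure"
  assumes prob_N0: "prob_space N0" and sets_N0: "sets N0 = sets \<mu>"
begin

text \<open>The laws of the slots are free parameters, so that moving the change point by one slot
  is an update at one index.\<close>

definition glaw :: "(nat \<Rightarrow> bool pmf) \<Rightarrow> (nat \<Rightarrow> 'x measure) \<Rightarrow> 'x outcome measure" where
  "glaw \<beta> N = measure_pmf \<rho> \<Otimes>\<^sub>M (\<Pi>\<^sub>M k\<in>UNIV. measure_pmf (bernoulli_pmf r)) \<Otimes>\<^sub>M
     (\<Pi>\<^sub>M k\<in>UNIV. measure_pmf (\<beta> k)) \<Otimes>\<^sub>M (\<Pi>\<^sub>M j\<in>UNIV. N0) \<Otimes>\<^sub>M PiM UNIV N"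

definition meas_law :: "'x measure \<Rightarrow> bool" where
  "meas_law N \<longleftrightarrow> prob_space N \<and> sets N = sets \<mu>"

lemma sets_slot_law:
  "meas_law N \<Longrightarrow> sets (slot_law r b N) = sets (count_space UNIV \<Otimes>\<^sub>M count_space UNIV \<Otimes>\<^sub>M \<mu>)"
  unfolding slot_law_def meas_law_def by (intro sets_pair_measure_cong) auto

lemma prob_space_slot_law: "meas_law N \<Longrightarrow> prob_space (slot_law r b N)"
  unfolding slot_law_def meas_law_def by (intro prob_space_pair) (auto simp: measure_pmf.prob_space_axioms)

lemma sets_glaw: "(\<And>k. meas_law (N k)) \<Longrightarrow> sets (glaw \<beta> N) = sets (outcome_algebra \<mu>)"
  unfolding glaw_def outcome_algebra_def meas_law_def
  by (intro sets_pair_measure_cong sets_PiM_cong) (auto simp: sets_N0)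

lemma space_glaw: "(\<And>k. meas_law (N k)) \<Longrightarrow> space (glaw \<beta> N) = outcome_space \<mu>"
  by (metis sets_glaw sets_eq_imp_space_eq space_outcome_algebra)

lemma prob_space_glaw: "(\<And>k. meas_law (N k)) \<Longrightarrow> prob_space (glaw \<beta> N)"
  unfolding glaw_def meas_law_def
  by (intro prob_space_pair prob_space_PiM) (auto simp: measure_pmf.prob_space_axioms prob_N0)

text \<open>By independence, overwriting slot \<open>j\<close> removes every trace of its former
  law. When the law of slot \<open>j\<close> is left as it was, this is the device that replaces
  conditioning on all other slots. The proof climbs the nested product from the measurements to the
  initial queue.\<close>

lemma glaw_resample_slot:
  assumes N: "\<And>k. meas_law (N k)" and N': "meas_law N'"
  shows "glaw (\<beta>(j := b)) (N(j := N')) =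
    distr (glaw \<beta> N \<Otimes>\<^sub>M slot_law r b N') (outcome_algebra \<mu>) (\<lambda>(\<omega>, s). set_slot j s \<omega>)"
proof -
  let ?R = "measure_pmf \<rho>" and ?A = "\<Pi>\<^sub>M k\<in>(UNIV :: nat set). measure_pmf (bernoulli_pmf r)"
    and ?C = "\<Pi>\<^sub>M k\<in>UNIV. measure_pmf (\<beta> k)" and ?U = "\<Pi>\<^sub>M j\<in>(UNIV :: nat set). N0" and ?V = "PiM UNIV N"
  let ?a = "measure_pmf (bernoulli_pmf r)" and ?b = "measure_pmf b"
  have pr: "prob_space (N k)" "prob_space N'" "sets N' = sets (N k)" for k
    using N[of k] N' by (auto simp: meas_law_def)
  have P: "prob_space ?R" "prob_space ?A" "prob_space ?C" "prob_space ?U" "prob_space ?V"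
    "prob_space ?a" "prob_space ?b"
    by (auto intro!: prob_space_PiM pr prob_N0 measure_pmf.prob_space_axioms)
  have upd: "(\<lambda>(x, y). x(j := y)) \<in> PiM UNIV M \<Otimes>\<^sub>M M' \<rightarrow>\<^sub>M PiM UNIV M"
    if "sets M' = sets (M j)" for M :: "nat \<Rightarrow> 'c measure" and M'
    using measurable_add_dim[of j UNIV M] that by (simp cong: measurable_cong_sets sets_pair_measure_cong)
  have A: "?A = distr (?A \<Otimes>\<^sub>M ?a) ?A (\<lambda>(x, y). x(j := y))"
    using PiM_fun_upd[of "\<lambda>_. ?a" ?a j] by (simp add: measure_pmf.prob_space_axioms fun_upd_idem)
  have C: "(\<Pi>\<^sub>M k\<in>UNIV. measure_pmf ((\<beta>(j := b)) k)) = distr (?C \<Otimes>\<^sub>M ?b) ?C (\<lambda>(x, y). x(j := y))"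
    using PiM_fun_upd[of "\<lambda>k. measure_pmf (\<beta> k)" ?b j]
    by (simp add: measure_pmf.prob_space_axioms fun_upd_def if_distrib cong: if_cong)
  have V: "PiM UNIV (N(j := N')) = distr (?V \<Otimes>\<^sub>M N') ?V (\<lambda>(x, y). x(j := y))"
    by (intro PiM_fun_upd pr)
  have mA: "(\<lambda>(x, y). x(j := y)) \<in> ?A \<Otimes>\<^sub>M ?a \<rightarrow>\<^sub>M ?A" by (intro upd) simp
  have mC: "(\<lambda>(x, y). x(j := y)) \<in> ?C \<Otimes>\<^sub>M ?b \<rightarrow>\<^sub>M ?C" by (intro upd) simp
  have mV: "(\<lambda>(x, y). x(j := y)) \<in> ?V \<Otimes>\<^sub>M N' \<rightarrow>\<^sub>M ?V" by (intro upd pr)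
  have V2: "?U \<Otimes>\<^sub>M PiM UNIV (N(j := N')) =
      distr ((?U \<Otimes>\<^sub>M ?V) \<Otimes>\<^sub>M N') (?U \<Otimes>\<^sub>M ?V) (case_prod (\<lambda>(u, v) y. (u, v(j := y))))"
    unfolding V by (subst distr_pair_resample_snd[OF P(4,5) pr(2) mV]) (simp add: split_beta')
  have mV2: "case_prod (\<lambda>(u, v) y. (u, v(j := y))) \<in> (?U \<Otimes>\<^sub>M ?V) \<Otimes>\<^sub>M N' \<rightarrow>\<^sub>M ?U \<Otimes>\<^sub>M ?V"
    using mV unfolding split_beta'
    by (intro measurable_Pair measurable_compose[OF _ mV[unfolded split_beta'], of "\<lambda>x. (snd (fst x), snd x)", simplified]) simp_all
  have P2: "prob_space (?U \<Otimes>\<^sub>M ?V)" by (intro prob_space_pair P)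
  have C2: "(\<Pi>\<^sub>M k\<in>UNIV. measure_pmf ((\<beta>(j := b)) k)) \<Otimes>\<^sub>M ?U \<Otimes>\<^sub>M PiM UNIV (N(j := N')) =
      distr ((?C \<Otimes>\<^sub>M ?U \<Otimes>\<^sub>M ?V) \<Otimes>\<^sub>M (?b \<Otimes>\<^sub>M N')) (?C \<Otimes>\<^sub>M ?U \<Otimes>\<^sub>M ?V)
       (case_prod (\<lambda>(c, u, v) (c', y). (c(j := c'), u, v(j := y))))"
    unfolding C V2 by (subst distr_pair_resample[OF P(3,7) P2 pr(2) mC mV2]) (simp add: split_beta')
  have mC2: "case_prod (\<lambda>(c, u, v) (c', y). (c(j := c'), u, v(j := y)))
      \<in> (?C \<Otimes>\<^sub>M ?U \<Otimes>\<^sub>M ?V) \<Otimes>\<^sub>M (?b \<Otimes>\<^sub>M N') \<rightarrow>\<^sub>M ?C \<Otimes>\<^sub>M ?U \<Otimes>\<^sub>M ?V"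
    unfolding split_beta'
    by (intro measurable_Pair
       measurable_compose[OF _ mC[unfolded split_beta'], of "\<lambda>x. (fst (fst x), fst (snd x))", simplified]
       measurable_compose[OF _ mV[unfolded split_beta'], of "\<lambda>x. (snd (snd (fst x)), snd (snd x))", simplified]) simp_all
  have P3: "prob_space (?C \<Otimes>\<^sub>M ?U \<Otimes>\<^sub>M ?V)" "prob_space (?b \<Otimes>\<^sub>M N')" by (intro prob_space_pair P pr)+
  have A2: "?A \<Otimes>\<^sub>M (\<Pi>\<^sub>M k\<in>UNIV. measure_pmf ((\<beta>(j := b)) k)) \<Otimes>\<^sub>M ?U \<Otimes>\<^sub>M PiM UNIV (N(j := N')) =
      distr ((?A \<Otimes>\<^sub>M ?C \<Otimes>\<^sub>M ?U \<Otimes>\<^sub>M ?V) \<Otimes>\<^sub>M (?a \<Otimes>\<^sub>M ?b \<Otimes>\<^sub>M N')) (?A \<Otimes>\<^sub>M ?C \<Otimes>\<^sub>M ?U \<Otimes>\<^sub>M ?V)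
       (case_prod (\<lambda>(a, c, u, v) (a', c', y). (a(j := a'), c(j := c'), u, v(j := y))))"
    unfolding C2 by (subst (1) A, subst distr_pair_resample[OF P(2,6) P3 mA mC2]) (simp add: split_beta')
  have mA2: "case_prod (\<lambda>(a, c, u, v) (a', c', y). (a(j := a'), c(j := c'), u, v(j := y)))
      \<in> (?A \<Otimes>\<^sub>M ?C \<Otimes>\<^sub>M ?U \<Otimes>\<^sub>M ?V) \<Otimes>\<^sub>M (?a \<Otimes>\<^sub>M ?b \<Otimes>\<^sub>M N') \<rightarrow>\<^sub>M ?A \<Otimes>\<^sub>M ?C \<Otimes>\<^sub>M ?U \<Otimes>\<^sub>M ?V"
    unfolding split_beta'
    by (intro measurable_Pair
       measurable_compose[OF _ mA[unfolded split_beta'], of "\<lambda>x. (fst (fst x), fst (snd x))", simplified]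
       measurable_compose[OF _ mC[unfolded split_beta'], of "\<lambda>x. (fst (snd (fst x)), fst (snd (snd x)))", simplified]
       measurable_compose[OF _ mV[unfolded split_beta'], of "\<lambda>x. (snd (snd (snd (fst x))), snd (snd (snd x)))", simplified]) simp_all
  have P4: "prob_space (?A \<Otimes>\<^sub>M ?C \<Otimes>\<^sub>M ?U \<Otimes>\<^sub>M ?V)" "prob_space (?a \<Otimes>\<^sub>M ?b \<Otimes>\<^sub>M N')" by (intro prob_space_pair P pr)+
  have "glaw (\<beta>(j := b)) (N(j := N')) =
      distr (glaw \<beta> N \<Otimes>\<^sub>M slot_law r b N') (glaw \<beta> N) (\<lambda>(\<omega>, s). set_slot j s \<omega>)"
    unfolding glaw_def A2 slot_law_def
    by (subst distr_pair_resample_snd[OF P(1) P4 mA2]) (simp add: split_beta' set_slot_def)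
  also have "\<dots> = distr (glaw \<beta> N \<Otimes>\<^sub>M slot_law r b N') (outcome_algebra \<mu>) (\<lambda>(\<omega>, s). set_slot j s \<omega>)"
    by (intro distr_cong sets_glaw N refl)
  finally show ?thesis .
qed

lemma glaw_override_on:
  assumes N: "\<And>k. meas_law (N k)" and N': "\<And>k. meas_law (N' k)"
  shows "glaw (override_on \<beta> \<beta>' {n<..}) (override_on N N' {n<..}) =
    distr (glaw \<beta> N \<Otimes>\<^sub>M ((\<Pi>\<^sub>M k\<in>UNIV. measure_pmf (\<beta>' k)) \<Otimes>\<^sub>M PiM UNIV N')) (outcome_algebra \<mu>)
      (\<lambda>(\<omega>, s). replace_after n s \<omega>)"
proof -
  let ?R = "measure_pmf \<rho>" and ?A = "\<Pi>\<^sub>M k\<in>(UNIV :: nat set). measure_pmf (bernoulli_pmf r)"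
    and ?C = "\<Pi>\<^sub>M k\<in>UNIV. measure_pmf (\<beta> k)" and ?U = "\<Pi>\<^sub>M j\<in>(UNIV :: nat set). N0" and ?V = "PiM UNIV N"
    and ?C' = "\<Pi>\<^sub>M k\<in>UNIV. measure_pmf (\<beta>' k)" and ?V' = "PiM UNIV N'"
  let ?J = "{n<..}"
  have pr: "prob_space (N k)" "prob_space (N' k)" "sets (N' k) = sets (N k)" for k
    using N[of k] N'[of k] by (auto simp: meas_law_def)
  have P: "prob_space ?R" "prob_space ?A" "prob_space ?C" "prob_space ?U" "prob_space ?V"
    "prob_space ?C'" "prob_space ?V'"
    by (auto intro!: prob_space_PiM pr prob_N0 measure_pmf.prob_space_axioms)
  have C: "(\<Pi>\<^sub>M k\<in>UNIV. measure_pmf (override_on \<beta> \<beta>' ?J k)) = distr (?C \<Otimes>\<^sub>M ?C') ?C (\<lambda>(x, y). override_on x y ?J)"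
    using PiM_override_on[of "\<lambda>k. measure_pmf (\<beta> k)" "\<lambda>k. measure_pmf (\<beta>' k)" ?J]
    by (simp add: measure_pmf.prob_space_axioms override_on_def if_distrib cong: if_cong)
  have V: "PiM UNIV (override_on N N' ?J) = distr (?V \<Otimes>\<^sub>M ?V') ?V (\<lambda>(x, y). override_on x y ?J)"
    by (intro PiM_override_on pr)
  have sC: "sets ?C' = sets ?C" and sV: "sets ?V' = sets ?V"
    by (intro sets_PiM_cong pr; simp)+
  have mC: "(\<lambda>(x, y). override_on x y ?J) \<in> ?C \<Otimes>\<^sub>M ?C' \<rightarrow>\<^sub>M ?C"
    using measurable_override_on[of ?J "\<lambda>k. measure_pmf (\<beta> k)"] sC
    by (simp cong: measurable_cong_sets sets_pair_measure_cong)
  have mV: "(\<lambda>(x, y). override_on x y ?J) \<in> ?V \<Otimes>\<^sub>M ?V' \<rightarrow>\<^sub>M ?V"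
    using measurable_override_on[of ?J N] sV
    by (simp cong: measurable_cong_sets sets_pair_measure_cong)
  have V2: "?U \<Otimes>\<^sub>M PiM UNIV (override_on N N' ?J) =
      distr ((?U \<Otimes>\<^sub>M ?V) \<Otimes>\<^sub>M ?V') (?U \<Otimes>\<^sub>M ?V) (case_prod (\<lambda>(u, v) y. (u, override_on v y ?J)))"
    unfolding V by (subst distr_pair_resample_snd[OF P(4,5,7) mV]) (simp add: split_beta')
  have mV2: "case_prod (\<lambda>(u, v) y. (u, override_on v y ?J)) \<in> (?U \<Otimes>\<^sub>M ?V) \<Otimes>\<^sub>M ?V' \<rightarrow>\<^sub>M ?U \<Otimes>\<^sub>M ?V"
    unfolding split_beta'
    by (intro measurable_Pair measurable_compose[OF _ mV[unfolded split_beta'], of "\<lambda>x. (snd (fst x), snd x)", simplified]) simp_all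
  have P2: "prob_space (?U \<Otimes>\<^sub>M ?V)" by (intro prob_space_pair P)
  have C2: "(\<Pi>\<^sub>M k\<in>UNIV. measure_pmf (override_on \<beta> \<beta>' ?J k)) \<Otimes>\<^sub>M ?U \<Otimes>\<^sub>M PiM UNIV (override_on N N' ?J) =
      distr ((?C \<Otimes>\<^sub>M ?U \<Otimes>\<^sub>M ?V) \<Otimes>\<^sub>M (?C' \<Otimes>\<^sub>M ?V')) (?C \<Otimes>\<^sub>M ?U \<Otimes>\<^sub>M ?V)
       (case_prod (\<lambda>(c, u, v) (c', y). (override_on c c' ?J, u, override_on v y ?J)))"
    unfolding C V2 by (subst distr_pair_resample[OF P(3,6) P2 P(7) mC mV2]) (simp add: split_beta')
  have mC2: "case_prod (\<lambda>(c, u, v) (c', y). (override_on c c' ?J, u, override_on v y ?J))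
      \<in> (?C \<Otimes>\<^sub>M ?U \<Otimes>\<^sub>M ?V) \<Otimes>\<^sub>M (?C' \<Otimes>\<^sub>M ?V') \<rightarrow>\<^sub>M ?C \<Otimes>\<^sub>M ?U \<Otimes>\<^sub>M ?V"
    unfolding split_beta'
    by (intro measurable_Pair
       measurable_compose[OF _ mC[unfolded split_beta'], of "\<lambda>x. (fst (fst x), fst (snd x))", simplified]
       measurable_compose[OF _ mV[unfolded split_beta'], of "\<lambda>x. (snd (snd (fst x)), snd (snd x))", simplified]) simp_all
  have P3: "prob_space (?C \<Otimes>\<^sub>M ?U \<Otimes>\<^sub>M ?V)" "prob_space (?C' \<Otimes>\<^sub>M ?V')" by (intro prob_space_pair P)+
  have A2: "?A \<Otimes>\<^sub>M (\<Pi>\<^sub>M k\<in>UNIV. measure_pmf (override_on \<beta> \<beta>' ?J k)) \<Otimes>\<^sub>M ?U \<Otimes>\<^sub>M PiM UNIV (override_on N N' ?J) =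
      distr ((?A \<Otimes>\<^sub>M ?C \<Otimes>\<^sub>M ?U \<Otimes>\<^sub>M ?V) \<Otimes>\<^sub>M (?C' \<Otimes>\<^sub>M ?V')) (?A \<Otimes>\<^sub>M ?C \<Otimes>\<^sub>M ?U \<Otimes>\<^sub>M ?V)
       (case_prod (\<lambda>(a, c, u, v) (c', y). (a, override_on c c' ?J, u, override_on v y ?J)))"
    unfolding C2 by (subst distr_pair_resample_snd[OF P(2) P3 mC2]) (simp add: split_beta')
  have mA2: "case_prod (\<lambda>(a, c, u, v) (c', y). (a, override_on c c' ?J, u, override_on v y ?J))
      \<in> (?A \<Otimes>\<^sub>M ?C \<Otimes>\<^sub>M ?U \<Otimes>\<^sub>M ?V) \<Otimes>\<^sub>M (?C' \<Otimes>\<^sub>M ?V') \<rightarrow>\<^sub>M ?A \<Otimes>\<^sub>M ?C \<Otimes>\<^sub>M ?U \<Otimes>\<^sub>M ?V"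
    unfolding split_beta'
    by (intro measurable_Pair
       measurable_compose[OF _ mC[unfolded split_beta'], of "\<lambda>x. (fst (snd (fst x)), fst (snd x))", simplified]
       measurable_compose[OF _ mV[unfolded split_beta'], of "\<lambda>x. (snd (snd (snd (fst x))), snd (snd x))", simplified]) simp_all
  have P4: "prob_space (?A \<Otimes>\<^sub>M ?C \<Otimes>\<^sub>M ?U \<Otimes>\<^sub>M ?V)" by (intro prob_space_pair P)+
  have "glaw (override_on \<beta> \<beta>' ?J) (override_on N N' ?J) =
      distr (glaw \<beta> N \<Otimes>\<^sub>M (?C' \<Otimes>\<^sub>M ?V')) (glaw \<beta> N) (\<lambda>(\<omega>, s). replace_after n s \<omega>)"
    unfolding glaw_def A2
    by (subst distr_pair_resample_snd[OF P(1) P4 P3(2) mA2]) (simp add: split_beta' replace_after_def)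
  also have "\<dots> = distr (glaw \<beta> N \<Otimes>\<^sub>M (?C' \<Otimes>\<^sub>M ?V')) (outcome_algebra \<mu>) (\<lambda>(\<omega>, s). replace_after n s \<omega>)"
    by (intro distr_cong sets_glaw N refl)
  finally show ?thesis .
qed

lemma nn_integral_resample_slot:
  assumes N: "\<And>k. meas_law (N k)" "meas_law N'" and f: "f \<in> borel_measurable (outcome_algebra \<mu>)"
  shows "(\<integral>\<^sup>+\<omega>. f \<omega> \<partial>glaw (\<beta>(j := b)) (N(j := N'))) =
    (\<integral>\<^sup>+\<omega>. \<integral>\<^sup>+s. f (set_slot j s \<omega>) \<partial>slot_law r b N' \<partial>glaw \<beta> N)"
proof -
  interpret L: prob_space "slot_law r b N'" using N by (intro prob_space_slot_law)
  note [measurable_cong] = sets_glaw[OF N(1)] sets_slot_law[OF N(2)]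
  note [measurable] = f
  show ?thesis
    unfolding glaw_resample_slot[OF N]
    by (simp add: nn_integral_distr L.nn_integral_fst[symmetric])
qed

lemma integral_resample_slot:
  fixes f :: "'x outcome \<Rightarrow> real"
  assumes N: "\<And>k. meas_law (N k)" and f: "integrable (glaw \<beta> N) f"
  shows "(\<integral>\<omega>. f \<omega> \<partial>glaw \<beta> N) =
    (\<integral>\<omega>. \<integral>s. f (set_slot j s \<omega>) \<partial>slot_law r (\<beta> j) (N j) \<partial>glaw \<beta> N)"
    and "integrable (glaw \<beta> N) (\<lambda>\<omega>. \<integral>s. f (set_slot j s \<omega>) \<partial>slot_law r (\<beta> j) (N j))"
proof -
  interpret L: prob_space "slot_law r (\<beta> j) (N j)" using N by (intro prob_space_slot_law)
  interpret P: prob_space "glaw \<beta> N" using N by (rule prob_space_glaw)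
  interpret PL: pair_prob_space "glaw \<beta> N" "slot_law r (\<beta> j) (N j)" ..
  note [measurable_cong] = sets_glaw[OF N] sets_slot_law[OF N]
  have [measurable]: "f \<in> borel_measurable (outcome_algebra \<mu>)"
    using borel_measurable_integrable[OF f] sets_glaw[OF N] by (simp cong: measurable_cong_sets)
  have *: "glaw \<beta> N = distr (glaw \<beta> N \<Otimes>\<^sub>M slot_law r (\<beta> j) (N j)) (outcome_algebra \<mu>) (\<lambda>(\<omega>, s). set_slot j s \<omega>)"
    using glaw_resample_slot[where N=N and N'="N j" and \<beta>=\<beta> and b="\<beta> j" and j=j] N by simp
  have i: "integrable (glaw \<beta> N \<Otimes>\<^sub>M slot_law r (\<beta> j) (N j)) (\<lambda>(\<omega>, s). f (set_slot j s \<omega>))"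
    using f by (subst (asm) *) (simp add: integrable_distr_eq split_beta')
  show "integrable (glaw \<beta> N) (\<lambda>\<omega>. \<integral>s. f (set_slot j s \<omega>) \<partial>slot_law r (\<beta> j) (N j))"
    using PL.integrable_fst'[OF i] by simp
  have "(\<integral>\<omega>. f \<omega> \<partial>glaw \<beta> N) = (\<integral>z. (\<lambda>(\<omega>, s). f (set_slot j s \<omega>)) z \<partial>(glaw \<beta> N \<Otimes>\<^sub>M slot_law r (\<beta> j) (N j)))"
    by (subst *) (simp add: integral_distr split_beta')
  also have "\<dots> = (\<integral>\<omega>. \<integral>s. f (set_slot j s \<omega>) \<partial>slot_law r (\<beta> j) (N j) \<partial>glaw \<beta> N)"
    using PL.integral_fst'[OF i] by simp
  finally show "(\<integral>\<omega>. f \<omega> \<partial>glaw \<beta> N) =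
    (\<integral>\<omega>. \<integral>s. f (set_slot j s \<omega>) \<partial>slot_law r (\<beta> j) (N j) \<partial>glaw \<beta> N)" .
qed

lemma replace_after_in_outcome_space:
  "\<omega> \<in> outcome_space \<mu> \<Longrightarrow> (\<And>k. v' k \<in> space \<mu>) \<Longrightarrow> replace_after n (c', v') \<omega> \<in> outcome_space \<mu>"
  by (auto simp: outcome_space_def replace_after_def PiE_iff override_on_def)

text \<open>The second law arises from the first by renewing channel and measurements after slot
  \<open>n\<close>, and an event observed up to \<open>n\<close> does not notice this
  renewal.\<close>

lemma emeasure_glaw_cong_upto:
  assumes N: "\<And>k. meas_law (N k)" "\<And>k. meas_law (N' k)"
    and eq: "\<And>k. k \<le> n \<Longrightarrow> \<beta> k = \<beta>' k" "\<And>k. k \<le> n \<Longrightarrow> N k = N' k"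
    and E: "E \<in> sets (observations \<mu> (enat n))"
  shows "emeasure (glaw \<beta> N) E = emeasure (glaw \<beta>' N') E"
proof -
  let ?CV = "(\<Pi>\<^sub>M k\<in>UNIV. measure_pmf (\<beta>' k)) \<Otimes>\<^sub>M PiM UNIV N'"
  let ?R = "\<lambda>(\<omega>, s). replace_after n s \<omega>"
  interpret CV: prob_space ?CV
    using N by (intro prob_space_pair prob_space_PiM) (auto simp: measure_pmf.prob_space_axioms meas_law_def)
  have EA: "E \<in> sets (outcome_algebra \<mu>)" using E sets_observations_subset by auto
  have sp: "space (PiM UNIV N') = (UNIV \<rightarrow>\<^sub>E space \<mu>)"
    using N(2) sets_eq_imp_space_eq[of "N' _" \<mu>] by (auto simp: space_PiM meas_law_def)
  have o: "override_on \<beta> \<beta>' {n<..} = \<beta>'" "override_on N N' {n<..} = N'"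
    using eq by (auto simp: override_on_def fun_eq_iff not_less)
  have *: "glaw \<beta>' N' = distr (glaw \<beta> N \<Otimes>\<^sub>M ?CV) (outcome_algebra \<mu>) ?R"
    using glaw_override_on[of N N' \<beta> \<beta>' n] N by (simp add: o)
  have sN: "sets (PiM UNIV N') = sets (\<Pi>\<^sub>M k\<in>UNIV. \<mu>)"
    using N(2) by (intro sets_PiM_cong) (auto simp: meas_law_def)
  have sC: "sets (\<Pi>\<^sub>M k\<in>UNIV. measure_pmf (\<beta>' k)) = sets (\<Pi>\<^sub>M k\<in>UNIV. count_space UNIV)"
    by (intro sets_PiM_cong) auto
  have m: "?R \<in> glaw \<beta> N \<Otimes>\<^sub>M ?CV \<rightarrow>\<^sub>M outcome_algebra \<mu>"
    using measurable_replace_after[of n \<mu>] sets_glaw[OF N(1)] sN sC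
    by (simp cong: measurable_cong_sets sets_pair_measure_cong)
  have "emeasure (glaw \<beta>' N') E = emeasure (glaw \<beta> N \<Otimes>\<^sub>M ?CV) (?R -` E \<inter> space (glaw \<beta> N \<Otimes>\<^sub>M ?CV))"
    unfolding * by (rule emeasure_distr[OF m EA])
  also have "?R -` E \<inter> space (glaw \<beta> N \<Otimes>\<^sub>M ?CV) = E \<times> space ?CV"
  proof -
    have "replace_after n (c', v') \<omega> \<in> E \<longleftrightarrow> \<omega> \<in> E"
      if "\<omega> \<in> outcome_space \<mu>" "v' \<in> UNIV \<rightarrow>\<^sub>E space \<mu>" for \<omega> c' v'
      using that
      by (intro sets_observations_cong[OF E] replace_after_in_outcome_space) (auto simp: PiE_iff)
    moreover have "E \<subseteq> outcome_space \<mu>"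
      using sets.sets_into_space[OF EA] by (simp add: space_outcome_algebra)
    ultimately show ?thesis
      by (intro set_eqI) (auto simp: space_pair_measure space_glaw[OF N(1)] sp simp del: space_PiM)
  qed
  also have "emeasure (glaw \<beta> N \<Otimes>\<^sub>M ?CV) (E \<times> space ?CV) = emeasure (glaw \<beta> N) E"
    using EA sets_glaw[OF N(1)] by (subst CV.emeasure_pair_measure_Times) (auto simp: CV.emeasure_space_1)
  finally show ?thesis ..
qed

end

section \<open>Change of measure\<close>

definition slot :: "nat \<Rightarrow> 'x outcome \<Rightarrow> bool \<times> bool \<times> 'x" where
  "slot k \<omega> = (arrival k \<omega>, channel_ok k \<omega>, slot_meas k \<omega>)"

lemma slot_set_slot[simp]: "slot k (set_slot j s \<omega>) = (if k = j then s else slot k \<omega>)"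
  by (simp add: slot_def)

abbreviation slot_algebra :: "'x measure \<Rightarrow> (bool \<times> bool \<times> 'x) measure" where
  "slot_algebra \<mu> \<equiv> count_space UNIV \<Otimes>\<^sub>M count_space UNIV \<Otimes>\<^sub>M \<mu>"

lemma measurable_slot[measurable]: "slot k \<in> outcome_algebra \<mu> \<rightarrow>\<^sub>M slot_algebra \<mu>"
  unfolding slot_def[abs_def]
  by (intro measurable_Pair measurable_arrival measurable_channel_ok measurable_slot_meas)

lemma set_slot_in_outcome_space:
  "\<omega> \<in> outcome_space \<mu> \<Longrightarrow> s \<in> space (slot_algebra \<mu>) \<Longrightarrow> set_slot j s \<omega> \<in> outcome_space \<mu>"
  by (auto simp: outcome_space_def set_slot_def space_pair_measure PiE_iff)

text \<open>Weaker than being determined by the observations up to some time: a function may read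
  the measurement of a packet that has not been delivered yet, as \<open>LR\<close> does, but not
  the channel of an idle slot nor the measurement of a slot without arrival.\<close>

definition observable :: "'x measure \<Rightarrow> ('x outcome \<Rightarrow> 'b) \<Rightarrow> bool" where
  "observable \<mu> f \<longleftrightarrow> (\<forall>j. \<forall>\<omega>\<in>outcome_space \<mu>. \<forall>s\<in>space (slot_algebra \<mu>). \<forall>s'\<in>space (slot_algebra \<mu>).
     same_slot (Q j \<omega>) s s' \<longrightarrow> f (set_slot j s \<omega>) = f (set_slot j s' \<omega>))"

lemma observable_comp2:
  "observable \<mu> f \<Longrightarrow> observable \<mu> g \<Longrightarrow> observable \<mu> (\<lambda>\<omega>. h (f \<omega>) (g \<omega>))"
  unfolding observable_def by metis

lemma observable_mem:
  assumes "E \<in> sets (observations \<mu> t)"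
  shows "observable \<mu> (\<lambda>\<omega>. \<omega> \<in> E)"
  unfolding observable_def
proof (intro allI ballI impI)
  fix j \<omega> s s' assume "\<omega> \<in> outcome_space \<mu>" "s \<in> space (slot_algebra \<mu>)" "s' \<in> space (slot_algebra \<mu>)"
    and "same_slot (Q j \<omega>) s s'"
  then show "(set_slot j s \<omega> \<in> E) = (set_slot j s' \<omega> \<in> E)"
    by (intro sets_observations_cong[OF assms] set_slot_in_outcome_space Q_same_slot conjI
        Y_same_slot Z_same_slot)
qed

lemma mem_set_slot_iff:
  assumes "E \<in> sets (observations \<mu> (enat k))" "k < j"
    and "\<omega> \<in> outcome_space \<mu>" "s \<in> space (slot_algebra \<mu>)"
  shows "set_slot j s \<omega> \<in> E \<longleftrightarrow> \<omega> \<in> E"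
  using assms(2-) by (intro sets_observations_cong[OF assms(1)] set_slot_in_outcome_space) auto

text \<open>The case of a finite information number: \<open>p0_eq_1\<close>, the density
  \<open>\<l>\<close> and the integrability of its logarithm express that both relative entropies
  are finite.\<close>

locale sensor = outcome_law r \<rho> \<mu> N0
  for r :: real and \<rho> :: "nat pmf" and \<mu> N0 :: "'x measure" +
  fixes p0 p1 :: real and N1 :: "'x measure" and \<l> :: "'x \<Rightarrow> real"
  assumes r_pos: "0 < r" and r_less: "r < p0" "r < p1" and p_le_1: "p0 \<le> 1" "p1 \<le> 1"
    and p0_eq_1: "p0 = 1 \<Longrightarrow> p1 = 1"
    and N1_eq: "N1 = density N0 (\<lambda>x. ennreal (\<l> x))" and prob_N1: "prob_space N1"
    and \<l>_measurable[measurable]: "\<l> \<in> borel_measurable \<mu>" and \<l>_nonneg: "\<And>x. 0 \<le> \<l> x"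
    and integrable_ln_\<l>: "integrable N1 (\<lambda>x. ln (\<l> x))"
    and stationary: "stationary_queue r p0 \<rho>"
begin

declare sets_N0[measurable_cong]

lemma sets_N1[measurable_cong]: "sets N1 = sets \<mu>"
  by (simp add: N1_eq sets_N0)

lemma meas_law_N0[simp]: "meas_law N0" and meas_law_N1[simp]: "meas_law N1"
  by (auto simp: meas_law_def prob_N0 prob_N1 sets_N0 sets_N1)

abbreviation "b0 \<equiv> bernoulli_pmf p0"
abbreviation "b1 \<equiv> bernoulli_pmf p1"

definition Pr :: "enat \<Rightarrow> 'x outcome measure" where
  "Pr \<nu> = glaw (\<lambda>k. if enat k \<le> \<nu> then b0 else b1) (\<lambda>k. if enat k \<le> \<nu> then N0 else N1)"

lemma sets_Pr[measurable_cong]: "sets (Pr \<nu>) = sets (outcome_algebra \<mu>)"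
  unfolding Pr_def by (intro sets_glaw) auto

lemma space_Pr: "space (Pr \<nu>) = outcome_space \<mu>"
  unfolding Pr_def by (intro space_glaw) auto

lemma prob_space_Pr: "prob_space (Pr \<nu>)"
  unfolding Pr_def by (intro prob_space_glaw) auto

lemma Pr_agree:
  assumes "E \<in> sets (observations \<mu> (enat n))" "enat n \<le> \<nu>" "enat n \<le> \<nu>'"
  shows "emeasure (Pr \<nu>) E = emeasure (Pr \<nu>') E"
  unfolding Pr_def
proof (rule emeasure_glaw_cong_upto[OF _ _ _ _ assms(1)])
  fix k assume "k \<le> n"
  then have "enat k \<le> \<nu>" "enat k \<le> \<nu>'"
    using assms(2,3) by (meson enat_ord_simps(1) order_trans)+
  then show "(if enat k \<le> \<nu> then b0 else b1) = (if enat k \<le> \<nu>' then b0 else b1)"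
    and "(if enat k \<le> \<nu> then N0 else N1) = (if enat k \<le> \<nu>' then N0 else N1)" by simp_all
qed auto

text \<open>If \<open>p0 = 1\<close> then \<open>p1 = 1\<close>, and the ratio of a failure is \<open>0 / 0 = 0\<close>.\<close>

definition ratio :: "bool \<Rightarrow> real" where
  "ratio c = (if c then p1 / p0 else (1 - p1) / (1 - p0))"

text \<open>The likelihood ratio of one slot, made of exactly those coordinates that
  \<open>same_slot\<close> compares. The factor of a measurement belongs to the slot of its
  arrival.\<close>

definition lik :: "nat \<Rightarrow> bool \<times> bool \<times> 'x \<Rightarrow> real" where
  "lik q s = (if 0 < q then ratio (fst (snd s)) else 1) * (if fst s then \<l> (snd (snd s)) else 1)"

lemma ratio_nonneg: "0 \<le> ratio c"
  using r_pos r_less p_le_1 by (auto simp: ratio_def)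

lemma lik_nonneg: "0 \<le> lik q s"
  by (simp add: lik_def ratio_nonneg \<l>_nonneg)

lemma lik_same_slot: "same_slot q s s' \<Longrightarrow> lik q s = lik q s'"
  by (auto simp: lik_def same_slot_def)

lemma pmf_b1: "pmf b1 c = ratio c * pmf b0 c"
  unfolding ratio_def using r_pos r_less p_le_1 p0_eq_1 by (cases c; cases "p0 = 1") auto

lemma measurable_lik[measurable]: "lik q \<in> borel_measurable (slot_algebra \<mu>)"
  unfolding lik_def[abs_def] by measurable

lemma nn_integral_slot_law:
  assumes "meas_law N" and [measurable]: "g \<in> borel_measurable (slot_algebra \<mu>)"
  shows "(\<integral>\<^sup>+s. g s \<partial>slot_law r b N) = (\<integral>\<^sup>+a. \<integral>\<^sup>+c. \<integral>\<^sup>+x. g (a, c, x) \<partial>N \<partial>b \<partial>bernoulli_pmf r)"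
proof -
  interpret N: prob_space N using assms by (simp add: meas_law_def)
  interpret bN: prob_space "measure_pmf b \<Otimes>\<^sub>M N"
    by (intro prob_space_pair measure_pmf.prob_space_axioms N.prob_space_axioms)
  have [measurable_cong]: "sets N = sets \<mu>" using assms by (simp add: meas_law_def)
  show ?thesis
    unfolding slot_law_def
    by (simp add: bN.nn_integral_fst[symmetric] N.nn_integral_fst[symmetric])
qed

text \<open>The seen coordinates contribute their densities. In an unseen coordinate
  \<open>g\<close> is constant, so it can be integrated against either probability law, and the
  factor 1 in \<open>lik\<close> is right.\<close>

lemma nn_integral_slot_change:
  assumes g[measurable]: "g \<in> borel_measurable (slot_algebra \<mu>)"
    and inv: "\<And>s s'. s \<in> space (slot_algebra \<mu>) \<Longrightarrow> s' \<in> space (slot_algebra \<mu>) \<Longrightarrow> same_slot q s s' \<Longrightarrow> g s = g s'"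
  shows "(\<integral>\<^sup>+s. g s \<partial>slot_law r b1 N1) = (\<integral>\<^sup>+s. ennreal (lik q s) * g s \<partial>slot_law r b0 N0)"
proof -
  interpret N0: prob_space N0 by (rule prob_N0)
  interpret N1: prob_space N1 by (rule prob_N1)
  define \<rho> where "\<rho> c = (if 0 < q then ratio c else 1)" for c
  define G where "G a c = (\<integral>\<^sup>+x. g (a, c, x) \<partial>N1)" for a c
  have sp: "space N0 = space \<mu>" "space N1 = space \<mu>"
    using sets_N0 sets_N1 by (auto dest: sets_eq_imp_space_eq)
  have \<rho>: "0 \<le> \<rho> c" for c by (simp add: \<rho>_def ratio_nonneg)
  have x: "(\<integral>\<^sup>+x. ennreal (lik q (a, c, x)) * g (a, c, x) \<partial>N0) = ennreal (\<rho> c) * G a c" for a c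
  proof (cases a)
    case True
    have "(\<integral>\<^sup>+x. ennreal (lik q (a, c, x)) * g (a, c, x) \<partial>N0) =
        (\<integral>\<^sup>+x. ennreal (\<rho> c) * (ennreal (\<l> x) * g (a, c, x)) \<partial>N0)"
      using True \<rho> \<l>_nonneg by (intro nn_integral_cong) (simp add: lik_def \<rho>_def ennreal_mult mult.assoc)
    also have "\<dots> = ennreal (\<rho> c) * G a c"
      by (simp add: nn_integral_cmult G_def N1_eq nn_integral_density)
    finally show ?thesis .
  next
    case False
    \<comment> \<open>Without an arrival the integrand ignores the measurement, so its value at any
      one point is its integral under \<open>N0\<close> as well as under \<open>N1\<close>.\<close>
    obtain x0 where x0: "x0 \<in> space \<mu>" using N0.not_empty sp by auto
    have c: "g (a, c, x) = g (a, c, x0)" if "x \<in> space \<mu>" for x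
      using that x0 False by (intro inv) (auto simp: space_pair_measure same_slot_def)
    have "(\<integral>\<^sup>+x. ennreal (lik q (a, c, x)) * g (a, c, x) \<partial>N0) = (\<integral>\<^sup>+x. ennreal (\<rho> c) * g (a, c, x0) \<partial>N0)"
      using False c by (intro nn_integral_cong) (auto simp: lik_def \<rho>_def sp)
    also have "\<dots> = ennreal (\<rho> c) * g (a, c, x0)" by (simp add: N0.emeasure_space_1)
    also have "g (a, c, x0) = (\<integral>\<^sup>+x. g (a, c, x0) \<partial>N1)" by (simp add: N1.emeasure_space_1)
    also have "\<dots> = G a c"
      unfolding G_def using c by (intro nn_integral_cong) (auto simp: sp)
    finally show ?thesis .
  qed
  have c: "(\<integral>\<^sup>+c. ennreal (\<rho> c) * G a c \<partial>b0) = (\<integral>\<^sup>+c. G a c \<partial>b1)" for a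
  proof (cases "0 < q")
    case True
    then show ?thesis
      using ratio_nonneg unfolding nn_integral_measure_pmf
      by (intro nn_integral_cong) (simp add: pmf_b1 \<rho>_def ennreal_mult mult_ac)
  next
    case False
    have "G a c = G a True" for c
      unfolding G_def using False
      by (intro nn_integral_cong inv) (auto simp: space_pair_measure same_slot_def sp)
    then have "G a = (\<lambda>c. G a True)" by auto
    then show ?thesis
      using False by (simp add: \<rho>_def) (metis measure_pmf.emeasure_space_1 nn_integral_const)
  qed
  show ?thesis
    by (simp add: nn_integral_slot_law x c G_def[symmetric])
qed

lemma measurable_lik_slot[measurable]:
  "(\<lambda>\<omega>. lik (Q k \<omega>) (slot k \<omega>)) \<in> borel_measurable (outcome_algebra \<mu>)"
  by (rule measurable_compose_countable[where f="\<lambda>q \<omega>. lik q (slot k \<omega>)", OF _ measurable_Q]) measurable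

text \<open>Slot \<open>n + 1\<close> is the only one whose law differs between the change points
  \<open>n\<close> and \<open>n + 1\<close>. Both laws are written as resamplings of the same base
  law in this slot, and the density is inserted inside.\<close>

lemma change_point_Suc:
  assumes f[measurable]: "f \<in> borel_measurable (outcome_algebra \<mu>)" and inv: "observable \<mu> f"
  shows "(\<integral>\<^sup>+\<omega>. f \<omega> \<partial>Pr (enat n)) =
    (\<integral>\<^sup>+\<omega>. ennreal (lik (Q (Suc n) \<omega>) (slot (Suc n) \<omega>)) * f \<omega> \<partial>Pr (enat (Suc n)))"
proof -
  let ?\<beta> = "\<lambda>k. if enat k \<le> enat (Suc n) then b0 else b1" and ?N = "\<lambda>k. if enat k \<le> enat (Suc n) then N0 else N1"
  have 0: "Pr (enat n) = glaw (?\<beta>(Suc n := b1)) (?N(Suc n := N1))"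
    unfolding Pr_def by (intro arg_cong2[where f=glaw]) (auto simp: fun_eq_iff)
  have 1: "Pr (enat (Suc n)) = glaw (?\<beta>(Suc n := b0)) (?N(Suc n := N0))"
    unfolding Pr_def by (intro arg_cong2[where f=glaw]) (auto simp: fun_eq_iff)
  have N: "meas_law (?N k)" for k by simp
  have m: "(\<lambda>\<omega>. ennreal (lik (Q (Suc n) \<omega>) (slot (Suc n) \<omega>)) * f \<omega>) \<in> borel_measurable (outcome_algebra \<mu>)"
    by measurable
  have sP: "space (glaw ?\<beta> ?N) = outcome_space \<mu>" by (intro space_glaw N)
  have "(\<integral>\<^sup>+\<omega>. f \<omega> \<partial>Pr (enat n)) = (\<integral>\<^sup>+\<omega>. \<integral>\<^sup>+s. f (set_slot (Suc n) s \<omega>) \<partial>slot_law r b1 N1 \<partial>glaw ?\<beta> ?N)"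
    unfolding 0 by (intro nn_integral_resample_slot N f) simp
  also have "\<dots> = (\<integral>\<^sup>+\<omega>. \<integral>\<^sup>+s. ennreal (lik (Q (Suc n) \<omega>) s) * f (set_slot (Suc n) s \<omega>) \<partial>slot_law r b0 N0 \<partial>glaw ?\<beta> ?N)"
  proof (intro nn_integral_cong nn_integral_slot_change)
    fix \<omega> assume "\<omega> \<in> space (glaw ?\<beta> ?N)"
    then have \<omega>: "\<omega> \<in> outcome_space \<mu>" unfolding sP .
    then have "Pair \<omega> \<in> slot_algebra \<mu> \<rightarrow>\<^sub>M outcome_algebra \<mu> \<Otimes>\<^sub>M slot_algebra \<mu>"
      by (intro measurable_Pair1') (simp add: space_outcome_algebra)
    from measurable_compose[OF measurable_compose[OF this measurable_set_slot] f]
    show "(\<lambda>s. f (set_slot (Suc n) s \<omega>)) \<in> borel_measurable (slot_algebra \<mu>)"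
      by simp
    show "f (set_slot (Suc n) s \<omega>) = f (set_slot (Suc n) s' \<omega>)"
      if "s \<in> space (slot_algebra \<mu>)" "s' \<in> space (slot_algebra \<mu>)" "same_slot (Q (Suc n) \<omega>) s s'" for s s'
      using inv \<omega> that unfolding observable_def by blast
  qed
  also have "\<dots> = (\<integral>\<^sup>+\<omega>. ennreal (lik (Q (Suc n) \<omega>) (slot (Suc n) \<omega>)) * f \<omega> \<partial>Pr (enat (Suc n)))"
    unfolding 1 by (subst nn_integral_resample_slot[OF N _ m]) simp_all
  finally show ?thesis .
qed

definition LR :: "nat \<Rightarrow> nat \<Rightarrow> 'x outcome \<Rightarrow> real" where
  "LR \<nu> n \<omega> = (\<Prod>k\<in>{\<nu><..n}. lik (Q k \<omega>) (slot k \<omega>))"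

lemma measurable_LR[measurable]: "LR \<nu> n \<in> borel_measurable (outcome_algebra \<mu>)"
  unfolding LR_def[abs_def] by measurable

lemma LR_nonneg: "0 \<le> LR \<nu> n \<omega>"
  unfolding LR_def by (intro prod_nonneg) (simp add: lik_nonneg)

lemma observable_LR: "observable \<mu> (LR \<nu> n)"
  unfolding observable_def LR_def
proof (intro allI ballI impI prod.cong refl)
  fix j k and \<omega> :: "'x outcome" and s s' :: "bool \<times> bool \<times> 'x"
  assume s: "same_slot (Q j \<omega>) s s'"
  then have "Q k (set_slot j s \<omega>) = Q k (set_slot j s' \<omega>)" by (rule Q_same_slot)
  moreover have "lik (Q j \<omega>) s = lik (Q j \<omega>) s'" using s by (rule lik_same_slot)
  ultimately show "lik (Q k (set_slot j s \<omega>)) (slot k (set_slot j s \<omega>)) =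
      lik (Q k (set_slot j s' \<omega>)) (slot k (set_slot j s' \<omega>))"
    by (cases "k = j") auto
qed

lemma LR_Suc: "\<nu> \<le> n \<Longrightarrow> LR \<nu> (Suc n) \<omega> = lik (Q (Suc n) \<omega>) (slot (Suc n) \<omega>) * LR \<nu> n \<omega>"
proof -
  assume "\<nu> \<le> n"
  then have "{\<nu><..Suc n} = insert (Suc n) {\<nu><..n}" by auto
  then show ?thesis by (simp add: LR_def)
qed

text \<open>The change point is moved later one slot at a time. The ratio collected so far is
  observable, so it can be absorbed into the function.\<close>

lemma change_of_measure:
  assumes f: "f \<in> borel_measurable (outcome_algebra \<mu>)" "observable \<mu> f" and "\<nu> \<le> n"
  shows "(\<integral>\<^sup>+\<omega>. f \<omega> \<partial>Pr (enat \<nu>)) = (\<integral>\<^sup>+\<omega>. ennreal (LR \<nu> n \<omega>) * f \<omega> \<partial>Pr (enat n))"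
  using \<open>\<nu> \<le> n\<close>
proof (induction n rule: dec_induct)
  case base
  then show ?case by (simp add: LR_def)
next
  case (step n)
  have o: "observable \<mu> (\<lambda>\<omega>. ennreal (LR \<nu> n \<omega>) * f \<omega>)"
    by (rule observable_comp2[OF observable_LR f(2), of "\<lambda>x y. ennreal x * y"])
  have "(\<integral>\<^sup>+\<omega>. f \<omega> \<partial>Pr (enat \<nu>)) = (\<integral>\<^sup>+\<omega>. ennreal (LR \<nu> n \<omega>) * f \<omega> \<partial>Pr (enat n))"
    by (rule step)
  also have "\<dots> = (\<integral>\<^sup>+\<omega>. ennreal (lik (Q (Suc n) \<omega>) (slot (Suc n) \<omega>)) * (ennreal (LR \<nu> n \<omega>) * f \<omega>) \<partial>Pr (enat (Suc n)))"
    using f(1) by (intro change_point_Suc o) measurable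
  also have "\<dots> = (\<integral>\<^sup>+\<omega>. ennreal (LR \<nu> (Suc n) \<omega>) * f \<omega> \<partial>Pr (enat (Suc n)))"
    using step by (intro nn_integral_cong) (simp add: LR_Suc ennreal_mult lik_nonneg LR_nonneg mult.assoc)
  finally show ?case .
qed

text \<open>\<open>E\<close> is cut at the level \<open>K\<close> of the ratio. Below the level the
  density is at most \<open>K\<close>, and an event observed up to \<open>n\<close> has the same
  probability under a change at \<open>n\<close> as under no change.\<close>

lemma Pr_le_change:
  assumes E: "E \<in> sets (observations \<mu> (enat n))" and "\<nu> \<le> n" and "0 \<le> K"
  shows "emeasure (Pr (enat \<nu>)) E \<le>
    ennreal K * emeasure (Pr \<infinity>) E + emeasure (Pr (enat \<nu>)) {\<omega>\<in>E. LR \<nu> n \<omega> > K}"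
proof -
  have EA[measurable]: "E \<in> sets (outcome_algebra \<mu>)" using E sets_observations_subset by auto
  have sub: "E \<subseteq> outcome_space \<mu>" using sets.sets_into_space[OF EA] by (simp add: space_outcome_algebra)
  let ?f = "\<lambda>\<omega>. if \<omega> \<in> E \<and> LR \<nu> n \<omega> \<le> K then 1 else 0 :: ennreal"
  have o: "observable \<mu> ?f"
    using observable_comp2[OF observable_mem[OF E] observable_LR, of "\<lambda>x y. if x \<and> y \<le> K then 1 else 0"] .
  have m: "?f \<in> borel_measurable (outcome_algebra \<mu>)" by measurable
  let ?P = "Pr (enat \<nu>)" and ?A = "{\<omega>\<in>E. LR \<nu> n \<omega> \<le> K}" and ?B = "{\<omega>\<in>E. LR \<nu> n \<omega> > K}"
  have AB[measurable]: "?A \<in> sets (outcome_algebra \<mu>)" "?B \<in> sets (outcome_algebra \<mu>)"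
    by measurable
  have "emeasure ?P ?A = (\<integral>\<^sup>+\<omega>. indicator ?A \<omega> \<partial>?P)"
    by (rule nn_integral_indicator[symmetric]) (simp add: sets_Pr)
  also have "\<dots> = (\<integral>\<^sup>+\<omega>. ?f \<omega> \<partial>?P)"
    by (intro nn_integral_cong) (auto simp: indicator_def)
  also have "\<dots> = (\<integral>\<^sup>+\<omega>. ennreal (LR \<nu> n \<omega>) * ?f \<omega> \<partial>Pr (enat n))"
    by (rule change_of_measure[OF m o \<open>\<nu> \<le> n\<close>])
  also have "\<dots> \<le> (\<integral>\<^sup>+\<omega>. ennreal K * indicator E \<omega> \<partial>Pr (enat n))"
    by (intro nn_integral_mono) (auto simp: indicator_def LR_nonneg intro!: ennreal_leI)
  also have "\<dots> = ennreal K * emeasure (Pr (enat n)) E"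
    by (rule nn_integral_cmult_indicator) (simp add: sets_Pr)
  also have "emeasure (Pr (enat n)) E = emeasure (Pr \<infinity>) E"
    by (rule Pr_agree[OF E]) auto
  finally have A: "emeasure ?P ?A \<le> ennreal K * emeasure (Pr \<infinity>) E" .
  have "emeasure ?P E = emeasure ?P (?A \<union> ?B)"
    by (intro arg_cong[where f="emeasure ?P"]) auto
  also have "\<dots> \<le> emeasure ?P ?A + emeasure ?P ?B"
    by (intro emeasure_subadditive) (simp_all add: sets_Pr)
  also have "\<dots> \<le> ennreal K * emeasure (Pr \<infinity>) E + emeasure ?P ?B"
    by (intro add_right_mono A)
  finally show ?thesis .
qed

end

section \<open>Empty queues before the alarm\<close>

text \<open>The sum is the mean number of the events that occur.\<close>

lemma (in prob_space) sum_prob_le_overlap: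
  assumes "finite K" and [measurable]: "\<And>k. k \<in> K \<Longrightarrow> A k \<in> sets M"
    and overlap: "\<And>\<omega>. \<omega> \<in> space M \<Longrightarrow> card {k\<in>K. \<omega> \<in> A k} \<le> c"
  shows "(\<Sum>k\<in>K. prob (A k)) \<le> real c"
proof -
  have "(\<Sum>k\<in>K. prob (A k)) = expectation (\<lambda>\<omega>. \<Sum>k\<in>K. indicat_real (A k) \<omega>)"
    by (subst Bochner_Integration.integral_sum)
      (auto intro!: sum.cong integrable_real_indicator simp: less_top[symmetric])
  also have "\<dots> \<le> expectation (\<lambda>\<omega>. real c)"
  proof (rule integral_mono)
    fix \<omega> assume "\<omega> \<in> space M"
    have "(\<Sum>k\<in>K. indicat_real (A k) \<omega>) = real (card {k\<in>K. \<omega> \<in> A k})"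
      using \<open>finite K\<close> by (simp add: indicator_def sum.If_cases Int_def)
    then show "(\<Sum>k\<in>K. indicat_real (A k) \<omega>) \<le> real c"
      using overlap[OF \<open>\<omega> \<in> space M\<close>] by simp
  qed (auto intro!: Bochner_Integration.integrable_sum integrable_real_indicator simp: less_top[symmetric])
  also have "\<dots> = real c" by (simp add: prob_space)
  finally show ?thesis .
qed

text \<open>A finite \<open>t\<close> leaves only the \<open>c\<close> slots just before it, and no
  window reaches \<open>t = \<infinity>\<close>.\<close>

lemma card_window_le: "card {k\<in>K. enat k < t \<and> t \<le> enat (k + c)} \<le> c"
proof (cases t)
  case (enat n)
  have "card {k\<in>K. enat k < t \<and> t \<le> enat (k + c)} \<le> card {n - c..<n}"
    by (intro card_mono) (auto simp: enat)
  then show ?thesis by simp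
qed simp

lemma measurable_stopping_time_count_space:
  fixes T :: "'a \<Rightarrow> enat"
  assumes T: "stopping_time F T" and F: "\<And>t. sets (F t) \<subseteq> sets M" "\<And>t. space (F t) = space M"
  shows "T \<in> M \<rightarrow>\<^sub>M count_space UNIV"
proof -
  have le[measurable]: "Measurable.pred M (\<lambda>x. T x \<le> t)" for t
    using stopping_timeD[OF T, of t] F by (auto simp: pred_def)
  have "T -` {a} \<inter> space M = {x\<in>space M. T x \<le> a \<and> (\<forall>n. enat n < a \<longrightarrow> \<not> T x \<le> enat n)}" for a
  proof (intro set_eqI iffI)
    fix x assume "x \<in> {x\<in>space M. T x \<le> a \<and> (\<forall>n. enat n < a \<longrightarrow> \<not> T x \<le> enat n)}"
    then have x: "x \<in> space M" "T x \<le> a" "\<And>n. enat n < a \<Longrightarrow> \<not> T x \<le> enat n" by auto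
    have "\<not> T x < a"
    proof
      assume "T x < a"
      then obtain n where "T x = enat n" by (cases "T x") auto
      then show False using x(3)[of n] \<open>T x < a\<close> by simp
    qed
    then show "x \<in> T -` {a} \<inter> space M" using x by auto
  qed auto
  moreover have "{x\<in>space M. T x \<le> a \<and> (\<forall>n. enat n < a \<longrightarrow> \<not> T x \<le> enat n)} \<in> sets M" for a
    by measurable
  ultimately show ?thesis
    by (subst measurable_count_space_eq2_countable) auto
qed

section \<open>Geometric decay of the stationary queue\<close>

lemma nn_integral_bernoulli_pmf2:
  fixes f :: "bool \<Rightarrow> bool \<Rightarrow> real"
  assumes "0 \<le> r" "r \<le> 1" "0 \<le> p" "p \<le> 1" and f: "\<And>a c. 0 \<le> f a c"
  shows "(\<integral>\<^sup>+a. \<integral>\<^sup>+c. ennreal (f a c) \<partial>bernoulli_pmf p \<partial>bernoulli_pmf r) =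
    ennreal (r * (p * f True True + (1 - p) * f True False) + (1 - r) * (p * f False True + (1 - p) * f False False))"
proof -
  have m: "ennreal x * ennreal y + ennreal z * ennreal w = ennreal (y * x + w * z)"
    if "0 \<le> x" "0 \<le> y" "0 \<le> z" "0 \<le> w" for x y z w
    using that by (simp add: ennreal_mult mult.commute)
  show ?thesis
    using assms by (simp add: nn_integral_bernoulli_pmf m del: ennreal_plus)
qed

text \<open>One slot does not change the probability of \<open>{n<..}\<close>, so the flow from
  \<open>n\<close> upwards across this cut equals the flow from \<open>n + 1\<close> downwards. An
  empty queue has no transmission and would move up at rate \<open>r\<close> instead of
  \<open>r * (1 - p)\<close>, hence \<open>1 \<le> n\<close>.\<close>

lemma stationary_queue_ratio:
  assumes st: "stationary_queue r p \<rho>" and r: "0 \<le> r" "r \<le> 1" and p: "0 \<le> p" "p \<le> 1" and n: "1 \<le> n"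
  shows "pmf \<rho> (Suc n) * (p * (1 - r)) = pmf \<rho> n * (r * (1 - p))"
proof -
  let ?K = "\<lambda>q. bind_pmf (bernoulli_pmf r) (\<lambda>a. bind_pmf (bernoulli_pmf p) (\<lambda>c.
       return_pmf (next_queue q (transmission q c) a)))"
  \<comment> \<open>The queue moves by at most one per slot, so only the starts \<open>n\<close> and
    \<open>n + 1\<close> are undecided: the former crosses by an arrival with a failure, the latter
    falls back by a success without arrival.\<close>
  have K: "emeasure (?K q) {n<..} = indicator {Suc n<..} q + ennreal (1 - p * (1 - r)) * indicator {Suc n} q
      + ennreal (r * (1 - p)) * indicator {n} q" for q
  proof -
    have "emeasure (?K q) {n<..} = (\<integral>\<^sup>+a. \<integral>\<^sup>+c. ennreal (of_bool (n < next_queue q (transmission q c) a))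
        \<partial>bernoulli_pmf p \<partial>bernoulli_pmf r)"
      by (auto intro!: nn_integral_cong simp: indicator_def)
    also have "\<dots> = indicator {Suc n<..} q + ennreal (1 - p * (1 - r)) * indicator {Suc n} q
        + ennreal (r * (1 - p)) * indicator {n} q"
    proof (subst nn_integral_bernoulli_pmf2[OF r p])
      consider "q > Suc n" | "q = Suc n" | "q = n" | "q < n" by linarith
      then show "ennreal
          (r * (p * of_bool (n < next_queue q (transmission q True) True) +
              (1 - p) * of_bool (n < next_queue q (transmission q False) True)) +
           (1 - r) * (p * of_bool (n < next_queue q (transmission q True) False) +
              (1 - p) * of_bool (n < next_queue q (transmission q False) False))) =
         indicator {Suc n<..} q + ennreal (1 - p * (1 - r)) * indicator {Suc n} q
        + ennreal (r * (1 - p)) * indicator {n} q"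
        by cases (use n in \<open>auto simp: next_queue_def transmission_def algebra_simps\<close>)
    qed simp
    finally show ?thesis .
  qed
  have "emeasure \<rho> {n<..} = emeasure (bind_pmf \<rho> ?K) {n<..}"
    using st by (simp add: stationary_queue_def)
  also have "\<dots> = (\<integral>\<^sup>+q. indicator {Suc n<..} q + ennreal (1 - p * (1 - r)) * indicator {Suc n} q
      + ennreal (r * (1 - p)) * indicator {n} q \<partial>\<rho>)"
    by (subst emeasure_bind_pmf) (simp only: K)
  also have "\<dots> = emeasure \<rho> {Suc n<..} + ennreal (1 - p * (1 - r)) * emeasure \<rho> {Suc n} + ennreal (r * (1 - p)) * emeasure \<rho> {n}"
    by (simp add: nn_integral_add nn_integral_cmult)
  also have "emeasure \<rho> {n<..} = emeasure \<rho> {Suc n<..} + emeasure \<rho> {Suc n}"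
    by (subst plus_emeasure) (auto intro!: arg_cong[where f="emeasure \<rho>"])
  finally have "ennreal (measure \<rho> {Suc n<..} + pmf \<rho> (Suc n)) =
      ennreal (measure \<rho> {Suc n<..} + (1 - p * (1 - r)) * pmf \<rho> (Suc n) + (r * (1 - p)) * pmf \<rho> n)"
    using r p by (simp add: measure_pmf.emeasure_eq_measure measure_pmf_single ennreal_mult mult_le_one)
  then have "measure \<rho> {Suc n<..} + pmf \<rho> (Suc n) =
      measure \<rho> {Suc n<..} + (1 - p * (1 - r)) * pmf \<rho> (Suc n) + (r * (1 - p)) * pmf \<rho> n"
    using r p by (subst (asm) ennreal_inj) (auto intro!: add_nonneg_nonneg mult_nonneg_nonneg simp: mult_le_one)
  then show ?thesis by (simp add: algebra_simps)
qed

text \<open>Since \<open>r < p\<close>, the ratio \<open>x\<close> of successive probabilities is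
  below 1. The finite mean is the starting value for optional stopping.\<close>

lemma stationary_queue_mean:
  assumes st: "stationary_queue r p \<rho>" and "0 < r" "r < p" "p \<le> 1"
  shows "(\<integral>\<^sup>+q. ennreal (real q) \<partial>\<rho>) < \<infinity>"
proof -
  define x where "x = r * (1 - p) / (p * (1 - r))"
  have "r * (1 - p) < p * (1 - r)" using assms by (simp add: algebra_simps)
  then have x: "0 \<le> x" "x < 1" using assms by (auto simp: x_def)
  have step: "pmf \<rho> (Suc (Suc n)) = x * pmf \<rho> (Suc n)" for n
    using stationary_queue_ratio[OF st, of "Suc n"] assms by (simp add: x_def field_simps)
  have bound: "pmf \<rho> (Suc n) \<le> x ^ n" for n
    by (induction n) (use x in \<open>auto simp: step pmf_le_1 intro: mult_left_mono\<close>)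
  have sm: "summable (\<lambda>n. real (Suc n) * x ^ n)"
    using geometric_deriv_sums[of x] x by (auto simp: sums_iff)
  have "(\<integral>\<^sup>+q. ennreal (real q) \<partial>\<rho>) = (\<Sum>q. ennreal (pmf \<rho> q) * ennreal (real q))"
    by (simp add: nn_integral_measure_pmf nn_integral_count_space_nat)
  also have "\<dots> = (\<Sum>q. ennreal (pmf \<rho> (Suc q)) * ennreal (real (Suc q)))"
    by (subst suminf_offset[of _ 1]) auto
  also have "\<dots> \<le> (\<Sum>q. ennreal (real (Suc q) * x ^ q))"
    using bound by (intro suminf_le) (auto simp: mult.commute ennreal_mult[symmetric] intro!: ennreal_leI mult_left_mono simp del: of_nat_Suc)
  also have "\<dots> = ennreal (\<Sum>q. real (Suc q) * x ^ q)"
    using x sm by (intro suminf_ennreal2) auto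
  also have "\<dots> < \<infinity>" by simp
  finally show ?thesis .
qed

section \<open>Drift of the queue and optional stopping\<close>

context sensor
begin

lemma mean_initial_queue: "(\<integral>\<^sup>+\<omega>. ennreal (real (Q 1 \<omega>)) \<partial>Pr \<nu>) = (\<integral>\<^sup>+q. ennreal (real q) \<partial>\<rho>)"
proof -
  let ?V = "(\<Pi>\<^sub>M k\<in>(UNIV::nat set). measure_pmf (bernoulli_pmf r)) \<Otimes>\<^sub>M
     (\<Pi>\<^sub>M k\<in>UNIV. measure_pmf (if enat k \<le> \<nu> then b0 else b1)) \<Otimes>\<^sub>M (\<Pi>\<^sub>M j\<in>(UNIV :: nat set). N0) \<Otimes>\<^sub>M
     (\<Pi>\<^sub>M k\<in>UNIV. if enat k \<le> \<nu> then N0 else N1)"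
  interpret V: prob_space ?V
    by (intro prob_space_pair prob_space_PiM) (auto simp: measure_pmf.prob_space_axioms prob_N0 prob_N1)
  have "(\<integral>\<^sup>+\<omega>. ennreal (real (Q 1 \<omega>)) \<partial>Pr \<nu>) = (\<integral>\<^sup>+\<omega>. ennreal (real (fst \<omega>)) \<partial>(measure_pmf \<rho> \<Otimes>\<^sub>M ?V))"
    unfolding Pr_def glaw_def by (simp add: initial_queue_def split_beta')
  also have "\<dots> = (\<integral>\<^sup>+q. ennreal (real q) \<partial>\<rho>)"
    by (subst V.nn_integral_fst[symmetric]) (auto simp: V.emeasure_space_1)
  finally show ?thesis .
qed

text \<open>The mean loss \<open>p0\<close> of a busy slot is written as a gain on the left, which
  avoids subtraction of extended nonnegative numbers. For \<open>q = 0\<close> the truncated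
  difference cancels the channel bit.\<close>

lemma nn_integral_next_queue:
  "(\<integral>\<^sup>+s. ennreal (real (q - of_bool (fst (snd s)) + of_bool (fst s)) + p0 * of_bool (0 < q)) \<partial>slot_law r b0 N0) =
    ennreal (real q + r)"
proof -
  interpret N0: prob_space N0 by (rule prob_N0)
  have "(\<integral>\<^sup>+s. ennreal (real (q - of_bool (fst (snd s)) + of_bool (fst s)) + p0 * of_bool (0 < q)) \<partial>slot_law r b0 N0) =
    (\<integral>\<^sup>+a. \<integral>\<^sup>+c. ennreal (real (q - of_bool c + of_bool a) + p0 * of_bool (0 < q)) \<partial>b0 \<partial>bernoulli_pmf r)"
    by (subst nn_integral_slot_law) (auto simp: N0.emeasure_space_1)
  also have "\<dots> = ennreal (real q + r)"
    using r_pos r_less p_le_1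
    by (subst nn_integral_bernoulli_pmf2; cases q) (auto simp: algebra_simps)
  finally show ?thesis .
qed

text \<open>Neither \<open>A\<close> nor the queue at the beginning of slot \<open>k + 1\<close>
  depends on the contents of that slot, so the slot can be resampled and averaged first.\<close>

lemma queue_drift:
  assumes A: "A \<in> sets (observations \<mu> (enat k))"
  shows "(\<integral>\<^sup>+\<omega>. ennreal (real (Q (Suc (Suc k)) \<omega>) + p0 * of_bool (0 < Q (Suc k) \<omega>)) * indicator A \<omega> \<partial>Pr \<infinity>) =
    (\<integral>\<^sup>+\<omega>. ennreal (real (Q (Suc k) \<omega>) + r) * indicator A \<omega> \<partial>Pr \<infinity>)"
proof -
  have AA[measurable]: "A \<in> sets (outcome_algebra \<mu>)" using A sets_observations_subset by auto
  let ?f = "\<lambda>\<omega>. ennreal (real (Q (Suc (Suc k)) \<omega>) + p0 * of_bool (0 < Q (Suc k) \<omega>)) * indicator A \<omega>"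
  have m: "?f \<in> borel_measurable (outcome_algebra \<mu>)" by measurable
  have P: "Pr \<infinity> = glaw (\<lambda>_. b0) (\<lambda>_. N0)" by (simp add: Pr_def)
  have sP: "space (glaw (\<lambda>_. b0) (\<lambda>_. N0)) = outcome_space \<mu>" using space_Pr[of \<infinity>] by (simp add: P)
  have "(\<integral>\<^sup>+\<omega>. ?f \<omega> \<partial>Pr \<infinity>) = (\<integral>\<^sup>+\<omega>. \<integral>\<^sup>+s. ?f (set_slot (Suc k) s \<omega>) \<partial>slot_law r b0 N0 \<partial>Pr \<infinity>)"
    using nn_integral_resample_slot[where N="\<lambda>_. N0" and N'=N0 and \<beta>="\<lambda>_. b0" and b=b0 and j="Suc k", OF _ _ m]
    by (simp add: P fun_upd_idem)
  also have "\<dots> = (\<integral>\<^sup>+\<omega>. (\<integral>\<^sup>+s. ennreal (real (Q (Suc k) \<omega> - of_bool (fst (snd s)) + of_bool (fst s)) + p0 * of_bool (0 < Q (Suc k) \<omega>)) * indicator A \<omega>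
      \<partial>slot_law r b0 N0) \<partial>Pr \<infinity>)"
  proof (intro nn_integral_cong)
    fix \<omega> s assume \<omega>: "\<omega> \<in> space (Pr \<infinity>)" and s: "s \<in> space (slot_law r b0 N0)"
    then have "s \<in> space (slot_algebra \<mu>)"
      using sets_eq_imp_space_eq[OF sets_slot_law[OF meas_law_N0]] by blast
    then have "indicator A (set_slot (Suc k) s \<omega>) = (indicator A \<omega> :: ennreal)"
      using mem_set_slot_iff[OF A, of "Suc k" \<omega> s] \<omega> by (simp add: space_Pr indicator_def)
    then show "?f (set_slot (Suc k) s \<omega>) = ennreal (real (Q (Suc k) \<omega> - of_bool (fst (snd s)) + of_bool (fst s)) + p0 * of_bool (0 < Q (Suc k) \<omega>)) * indicator A \<omega>"
      by (simp add: Q_Suc_Suc)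
  qed
  also have "\<dots> = (\<integral>\<^sup>+\<omega>. ennreal (real (Q (Suc k) \<omega>) + r) * indicator A \<omega> \<partial>Pr \<infinity>)"
  proof (intro nn_integral_cong)
    fix \<omega> :: "'x outcome"
    have "(\<lambda>s. ennreal (real (Q (Suc k) \<omega> - of_bool (fst (snd s)) + of_bool (fst s)) + p0 * of_bool (0 < Q (Suc k) \<omega>)))
        \<in> borel_measurable (slot_law r b0 N0)"
      unfolding measurable_cong_sets[OF sets_slot_law[OF meas_law_N0] refl] by measurable
    then show "(\<integral>\<^sup>+s. ennreal (real (Q (Suc k) \<omega> - of_bool (fst (snd s)) + of_bool (fst s)) + p0 * of_bool (0 < Q (Suc k) \<omega>)) * indicator A \<omega>
      \<partial>slot_law r b0 N0) = ennreal (real (Q (Suc k) \<omega>) + r) * indicator A \<omega>"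
      by (subst nn_integral_multc) (simp_all only: nn_integral_next_queue)
  qed
  finally show ?thesis .
qed

lemma stopping_time_greater_sets:
  assumes T: "stopping_time (observations \<mu>) T"
  shows "{\<omega>\<in>outcome_space \<mu>. t < T \<omega>} \<in> sets (observations \<mu> t)"
  using stopping_timeD2[OF T, of t] by (simp add: pred_def space_observations)

lemma measurable_stopping_time_Pr:
  assumes T: "stopping_time (observations \<mu>) T"
  shows "T \<in> Pr \<nu> \<rightarrow>\<^sub>M count_space UNIV"
  using measurable_stopping_time_count_space[OF T, of "outcome_algebra \<mu>"]
  by (simp add: sets_observations_subset space_observations space_outcome_algebra
      measurable_cong_sets[OF sets_Pr refl])

text \<open>Optional stopping of the queue length, whose drift is \<open>r - p0\<close> in a busy slot and \<open>r\<close> in an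
  idle one.\<close>

lemma sum_prob_not_stopped:
  assumes T: "stopping_time (observations \<mu>) T"
  shows "ennreal p0 * (\<Sum>k<n. emeasure (Pr \<infinity>) {\<omega>\<in>outcome_space \<mu>. enat k < T \<omega>})
    \<le> (\<integral>\<^sup>+q. ennreal (real q) \<partial>\<rho>) + ennreal r * (\<Sum>k<n. emeasure (Pr \<infinity>) {\<omega>\<in>outcome_space \<mu>. enat k < T \<omega>})
      + ennreal p0 * (\<Sum>k<n. emeasure (Pr \<infinity>) {\<omega>\<in>outcome_space \<mu>. enat k < T \<omega> \<and> Q (Suc k) \<omega> = 0})"
proof -
  let ?A = "\<lambda>k. {\<omega>\<in>outcome_space \<mu>. enat k < T \<omega>}"
  let ?B = "\<lambda>k. {\<omega>\<in>outcome_space \<mu>. enat k < T \<omega> \<and> Q (Suc k) \<omega> = 0}"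
  let ?e = "\<lambda>k. \<integral>\<^sup>+\<omega>. ennreal (real (Q (Suc k) \<omega>)) * indicator (?A k) \<omega> \<partial>Pr \<infinity>"
  let ?P = "emeasure (Pr \<infinity>)"
  have A: "?A k \<in> sets (observations \<mu> (enat k))" for k
    by (rule stopping_time_greater_sets[OF T])
  then have AA[measurable]: "?A k \<in> sets (outcome_algebra \<mu>)" for k
    using sets_observations_subset by blast
  have "?B k = ?A k \<inter> {\<omega>\<in>space (outcome_algebra \<mu>). Q (Suc k) \<omega> = 0}" for k
    by (auto simp: space_outcome_algebra)
  then have BB[measurable]: "?B k \<in> sets (outcome_algebra \<mu>)" for k
    using AA[of k] by simp
  have p: "0 \<le> p0" "0 \<le> r" using r_pos r_less by auto
  \<comment> \<open>The next queue length is enlarged from \<open>?A (Suc k)\<close> to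
    \<open>?A k\<close>. The term \<open>p0\<close> on \<open>?A k\<close> is supplied by the drift
    identity if slot \<open>k + 1\<close> is busy and by \<open>?B k\<close> if it is idle.\<close>
  have step: "?e (Suc k) + ennreal p0 * ?P (?A k) \<le> ?e k + ennreal r * ?P (?A k) + ennreal p0 * ?P (?B k)" for k
  proof -
    have "?e (Suc k) + ennreal p0 * ?P (?A k) =
        (\<integral>\<^sup>+\<omega>. ennreal (real (Q (Suc (Suc k)) \<omega>)) * indicator (?A (Suc k)) \<omega> + ennreal p0 * indicator (?A k) \<omega> \<partial>Pr \<infinity>)"
      by (subst nn_integral_add) (auto simp: nn_integral_cmult_indicator sets_Pr)
    also have "\<dots> \<le> (\<integral>\<^sup>+\<omega>. ennreal (real (Q (Suc (Suc k)) \<omega>) + p0 * of_bool (0 < Q (Suc k) \<omega>)) * indicator (?A k) \<omega>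
        + ennreal p0 * indicator (?B k) \<omega> \<partial>Pr \<infinity>)"
    proof (intro nn_integral_mono)
      fix \<omega> :: "'x outcome"
      have "enat (Suc k) < T \<omega> \<Longrightarrow> enat k < T \<omega>"
        by (rule less_trans[of _ "enat (Suc k)"]) auto
      then show "ennreal (real (Q (Suc (Suc k)) \<omega>)) * indicator (?A (Suc k)) \<omega> + ennreal p0 * indicator (?A k) \<omega>
        \<le> ennreal (real (Q (Suc (Suc k)) \<omega>) + p0 * of_bool (0 < Q (Suc k) \<omega>)) * indicator (?A k) \<omega>
        + ennreal p0 * indicator (?B k) \<omega>"
        using p by (cases "Q (Suc k) \<omega>") (auto simp: indicator_def)
    qed
    also have "\<dots> = (\<integral>\<^sup>+\<omega>. ennreal (real (Q (Suc (Suc k)) \<omega>) + p0 * of_bool (0 < Q (Suc k) \<omega>)) * indicator (?A k) \<omega> \<partial>Pr \<infinity>)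
        + ennreal p0 * ?P (?B k)"
      by (subst nn_integral_add) (auto simp: nn_integral_cmult_indicator sets_Pr)
    also have "\<dots> = (\<integral>\<^sup>+\<omega>. ennreal (real (Q (Suc k) \<omega>) + r) * indicator (?A k) \<omega> \<partial>Pr \<infinity>) + ennreal p0 * ?P (?B k)"
      by (subst queue_drift[OF A]) simp
    also have "(\<integral>\<^sup>+\<omega>. ennreal (real (Q (Suc k) \<omega>) + r) * indicator (?A k) \<omega> \<partial>Pr \<infinity>) =
        (\<integral>\<^sup>+\<omega>. ennreal (real (Q (Suc k) \<omega>)) * indicator (?A k) \<omega> + ennreal r * indicator (?A k) \<omega> \<partial>Pr \<infinity>)"
      using p by (intro nn_integral_cong) (simp add: distrib_right)
    also have "\<dots> = ?e k + ennreal r * ?P (?A k)"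
      by (subst nn_integral_add) (auto simp: nn_integral_cmult_indicator sets_Pr)
    finally show ?thesis .
  qed
  have e0: "?e 0 \<le> (\<integral>\<^sup>+q. ennreal (real q) \<partial>\<rho>)"
    unfolding mean_initial_queue[of \<infinity>, symmetric]
    by (intro nn_integral_mono) (auto simp: indicator_def)
  have "?e n + ennreal p0 * (\<Sum>k<n. ?P (?A k)) \<le> ?e 0 + ennreal r * (\<Sum>k<n. ?P (?A k)) + ennreal p0 * (\<Sum>k<n. ?P (?B k))"
  proof (induction n)
    case (Suc n)
    have "?e (Suc n) + ennreal p0 * (\<Sum>k<Suc n. ?P (?A k)) =
        (?e (Suc n) + ennreal p0 * ?P (?A n)) + ennreal p0 * (\<Sum>k<n. ?P (?A k))"
      by (simp add: distrib_left add_ac)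
    also have "\<dots> \<le> (?e n + ennreal r * ?P (?A n) + ennreal p0 * ?P (?B n)) + ennreal p0 * (\<Sum>k<n. ?P (?A k))"
      by (intro add_right_mono step)
    also have "\<dots> = (?e n + ennreal p0 * (\<Sum>k<n. ?P (?A k))) + ennreal r * ?P (?A n) + ennreal p0 * ?P (?B n)"
      by (simp add: add_ac)
    also have "\<dots> \<le> (?e 0 + ennreal r * (\<Sum>k<n. ?P (?A k)) + ennreal p0 * (\<Sum>k<n. ?P (?B k))) + ennreal r * ?P (?A n) + ennreal p0 * ?P (?B n)"
      by (intro add_right_mono Suc)
    also have "\<dots> = ?e 0 + ennreal r * (\<Sum>k<Suc n. ?P (?A k)) + ennreal p0 * (\<Sum>k<Suc n. ?P (?B k))"
      by (simp add: distrib_left add_ac)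
    finally show ?case .
  qed simp
  also have "\<dots> \<le> (\<integral>\<^sup>+q. ennreal (real q) \<partial>\<rho>) + ennreal r * (\<Sum>k<n. ?P (?A k)) + ennreal p0 * (\<Sum>k<n. ?P (?B k))"
    by (intro add_right_mono e0)
  finally show ?thesis
    by (rule order_trans[rotated]) simp
qed

definition mean_queue :: real where
  "mean_queue = enn2real (\<integral>\<^sup>+q. ennreal (real q) \<partial>\<rho>)"

lemma mean_queue: "(\<integral>\<^sup>+q. ennreal (real q) \<partial>\<rho>) = ennreal mean_queue" "0 \<le> mean_queue"
  using stationary_queue_mean[OF stationary r_pos r_less(1) p_le_1(1)] by (auto simp: mean_queue_def)

text \<open>The threshold is the bound on the mean of \<open>T\<close> that would hold if every slot
  failed. \<open>mean_queue\<close> comes from the initial queue, the summand \<open>p0\<close> from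
  a shift by one slot, and \<open>real (Suc m) / \<epsilon>\<close> bounds the number of idle slots
  before the alarm by the overlap of windows; \<open>p0 - r\<close> is the downward drift of a busy
  queue.\<close>

lemma exists_vulnerable_slot:
  assumes T: "stopping_time (observations \<mu>) T"
    and mean: "ennreal \<gamma> \<le> (\<integral>\<^sup>+\<omega>. ennreal_of_enat (T \<omega>) \<partial>Pr \<infinity>)"
    and \<epsilon>: "0 < \<epsilon>" and \<gamma>: "(mean_queue + p0 + p0 * real (Suc m) / \<epsilon>) / (p0 - r) < \<gamma>"
  shows "\<exists>k\<ge>1. measure (Pr \<infinity>) {\<omega>\<in>outcome_space \<mu>. enat k < T \<omega> \<and> Q k \<omega> = 0 \<and> T \<omega> \<le> enat (k + Suc m)}
    < \<epsilon> * measure (Pr \<infinity>) {\<omega>\<in>outcome_space \<mu>. enat k < T \<omega> \<and> Q k \<omega> = 0}"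
proof (rule ccontr)
  interpret P: prob_space "Pr \<infinity>" by (rule prob_space_Pr)
  let ?A = "\<lambda>k. {\<omega>\<in>outcome_space \<mu>. enat k < T \<omega>}"
  let ?B = "\<lambda>k. {\<omega>\<in>outcome_space \<mu>. enat k < T \<omega> \<and> Q (Suc k) \<omega> = 0}"
  let ?H = "\<lambda>k. {\<omega>\<in>outcome_space \<mu>. enat k < T \<omega> \<and> Q k \<omega> = 0}"
  let ?W = "\<lambda>k. {\<omega>\<in>outcome_space \<mu>. enat k < T \<omega> \<and> Q k \<omega> = 0 \<and> T \<omega> \<le> enat (k + Suc m)}"
  let ?E = "\<lambda>k. {\<omega>\<in>outcome_space \<mu>. enat k < T \<omega> \<and> T \<omega> \<le> enat (k + 1)}"
  assume "\<not> ?thesis"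
  then have W: "\<epsilon> * P.prob (?H k) \<le> P.prob (?W k)" if "1 \<le> k" for k
    using that by (auto simp: not_less)
  have [measurable]: "T \<in> Pr \<infinity> \<rightarrow>\<^sub>M count_space UNIV" by (rule measurable_stopping_time_Pr[OF T])
  note sp = space_Pr[of \<infinity>, symmetric]
  have sets: "?A k \<in> P.events" "?B k \<in> P.events" "?H k \<in> P.events" "?W k \<in> P.events" "?E k \<in> P.events" for k
    unfolding sp by measurable
  have "(\<Sum>k<n. P.prob (?A k)) \<le> (mean_queue + p0 + p0 * real (Suc m) / \<epsilon>) / (p0 - r)" for n
  proof -
    have "\<epsilon> * (\<Sum>k=1..n. P.prob (?H k)) \<le> (\<Sum>k=1..n. P.prob (?W k))"
      unfolding sum_distrib_left by (intro sum_mono W) auto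
    also have "\<dots> \<le> real (Suc m)"
    proof (rule P.sum_prob_le_overlap)
      fix \<omega> 
      have "card {k\<in>{1..n}. \<omega> \<in> ?W k} \<le> card {k\<in>{1..n}. enat k < T \<omega> \<and> T \<omega> \<le> enat (k + Suc m)}"
        by (intro card_mono) auto
      also have "\<dots> \<le> Suc m" by (rule card_window_le)
      finally show "card {k\<in>{1..n}. \<omega> \<in> ?W k} \<le> Suc m" .
    qed ((rule finite_atLeastAtMost finite_lessThan sets)+)
    finally have H: "(\<Sum>k=1..n. P.prob (?H k)) \<le> real (Suc m) / \<epsilon>"
      using \<epsilon> by (simp add: field_simps)
    \<comment> \<open>\<open>?B k\<close> asks for an idle slot \<open>k + 1\<close> but only for
      \<open>T\<close> beyond \<open>k\<close>. Either \<open>T\<close> exceeds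
      \<open>k + 1\<close>, which is \<open>?H (Suc k)\<close>, or \<open>T = k + 1\<close>, which
      happens for at most one \<open>k\<close>.\<close>
    have E: "(\<Sum>k<n. P.prob (?E k)) \<le> real 1"
    proof (rule P.sum_prob_le_overlap)
      fix \<omega> 
      have "card {k\<in>{..<n}. \<omega> \<in> ?E k} \<le> card {k\<in>{..<n}. enat k < T \<omega> \<and> T \<omega> \<le> enat (k + 1)}"
        by (intro card_mono) auto
      also have "\<dots> \<le> 1" by (rule card_window_le)
      finally show "card {k\<in>{..<n}. \<omega> \<in> ?E k} \<le> 1" .
    qed ((rule finite_atLeastAtMost finite_lessThan sets)+)
    have "(\<Sum>k<n. P.prob (?B k)) \<le> (\<Sum>k<n. P.prob (?H (Suc k)) + P.prob (?E k))"
    proof (intro sum_mono)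
      fix k
      have "P.prob (?B k) \<le> P.prob (?H (Suc k) \<union> ?E k)"
        by (intro P.finite_measure_mono sets.Un sets) (auto simp: not_less)
      also have "\<dots> \<le> P.prob (?H (Suc k)) + P.prob (?E k)"
        by (intro measure_Un_le sets)
      finally show "P.prob (?B k) \<le> P.prob (?H (Suc k)) + P.prob (?E k)" .
    qed
    also have "\<dots> = (\<Sum>k=1..n. P.prob (?H k)) + (\<Sum>k<n. P.prob (?E k))"
      unfolding sum.distrib
      by (intro arg_cong2[where f="(+)"] refl sum.reindex_bij_witness[of _ "\<lambda>k. k - 1" Suc]) auto
    also have "\<dots> \<le> real (Suc m) / \<epsilon> + 1" using H E by simp
    finally have B: "(\<Sum>k<n. P.prob (?B k)) \<le> real (Suc m) / \<epsilon> + 1" .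
    have nn: "0 \<le> p0" "0 \<le> r" "0 \<le> (\<Sum>k<n. P.prob (?A k))" "0 \<le> (\<Sum>k<n. P.prob (?B k))"
      using r_pos r_less by (auto intro!: sum_nonneg)
    have "ennreal (p0 * (\<Sum>k<n. P.prob (?A k))) \<le>
       ennreal (mean_queue + r * (\<Sum>k<n. P.prob (?A k)) + p0 * (\<Sum>k<n. P.prob (?B k)))"
      using sum_prob_not_stopped[OF T, of n] nn mean_queue
      by (simp add: P.emeasure_eq_measure ennreal_mult)
    then have "p0 * (\<Sum>k<n. P.prob (?A k)) \<le>
       mean_queue + r * (\<Sum>k<n. P.prob (?A k)) + p0 * (\<Sum>k<n. P.prob (?B k))"
      using nn mean_queue by (subst (asm) ennreal_le_iff) (auto intro!: add_nonneg_nonneg mult_nonneg_nonneg)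
    also have "\<dots> \<le> mean_queue + r * (\<Sum>k<n. P.prob (?A k)) + p0 * (real (Suc m) / \<epsilon> + 1)"
      using B nn by (intro add_left_mono mult_left_mono)
    finally have "(p0 - r) * (\<Sum>k<n. P.prob (?A k)) \<le> mean_queue + p0 + p0 * real (Suc m) / \<epsilon>"
      by (simp add: algebra_simps)
    then show ?thesis
      using r_less by (simp add: field_simps)
  qed
  then have "(\<Sum>k<n. emeasure (Pr \<infinity>) (?A k)) \<le> ennreal ((mean_queue + p0 + p0 * real (Suc m) / \<epsilon>) / (p0 - r))" for n
    by (simp add: P.emeasure_eq_measure ennreal_leI)
  then have "(\<Sum>k. emeasure (Pr \<infinity>) (?A k)) \<le> ennreal ((mean_queue + p0 + p0 * real (Suc m) / \<epsilon>) / (p0 - r))"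
    by (intro suminf_le_const) auto
  moreover have "(\<integral>\<^sup>+\<omega>. ennreal_of_enat (T \<omega>) \<partial>Pr \<infinity>) = (\<Sum>k. emeasure (Pr \<infinity>) (?A k))"
    by (subst nn_integral_enat_function) (simp_all add: space_Pr)
  ultimately have "ennreal \<gamma> \<le> ennreal ((mean_queue + p0 + p0 * real (Suc m) / \<epsilon>) / (p0 - r))"
    using mean by simp
  moreover have "0 \<le> (mean_queue + p0 + p0 * real (Suc m) / \<epsilon>) / (p0 - r)"
    using r_pos r_less \<epsilon> mean_queue by (intro divide_nonneg_nonneg add_nonneg_nonneg mult_nonneg_nonneg) auto
  ultimately show False
    using \<gamma> by (subst (asm) ennreal_le_iff) auto
qed

end

section \<open>Concentration of the likelihood ratio\<close>

context sensor
begin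

lemma p_pos: "0 < p0" "0 < p1"
  using r_pos r_less by auto

definition \<kappa> :: real where
  "\<kappa> = p1 * ln (p1 / p0) + (1 - p1) * ln ((1 - p1) / (1 - p0))"

text \<open>Gibbs' inequality, summed over success and failure. The sign is needed to discard the
  final queue length when the backlog is bounded from above.\<close>

lemma \<kappa>_nonneg: "0 \<le> \<kappa>"
proof -
  have gibbs: "x - y \<le> x * ln (x / y)" if "0 < x" "0 < y" for x y :: real
  proof -
    have "ln (y / x) \<le> y / x - 1" using that by (intro ln_le_minus_one) auto
    then have "x * ln (y / x) \<le> x * (y / x - 1)" using that by (intro mult_left_mono) auto
    then show ?thesis using that by (simp add: ln_div algebra_simps)
  qed
  show ?thesis
  proof (cases "p1 = 1")
    case True
    then show ?thesis unfolding \<kappa>_def using p_pos p_le_1 by (simp add: ln_div)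
  next
    case False
    then have "p0 \<noteq> 1" using p0_eq_1 by auto
    with False have "p1 < 1" "p0 < 1" using p_le_1 by simp_all
    then show ?thesis
      using gibbs[of p1 p0] gibbs[of "1 - p1" "1 - p0"] p_pos by (simp add: \<kappa>_def)
  qed
qed

text \<open>Under success probability \<open>p1\<close> the logarithm of the channel ratio has mean
  \<kappa>. Deducting \<kappa> / \<open>p1\<close> for every success centres it.\<close>

definition busy_term :: "bool \<Rightarrow> real" where
  "busy_term c = ln (ratio c) - \<kappa> / p1 * of_bool c"

text \<open>A packet needs \<open>1 / p1\<close> transmissions on average, each worth \<kappa>. This
  amount, deducted from successes in \<open>busy_term\<close>, is credited to the packet at its
  arrival.\<close>

definition arrival_term :: "bool \<times> bool \<times> 'x \<Rightarrow> real" where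
  "arrival_term s = of_bool (fst s) * (\<kappa> / p1 + ln (\<l> (snd (snd s))))"

definition info :: real where
  "info = r * (\<kappa> / p1 + (\<integral>x. ln (\<l> x) \<partial>N1))"

lemma busy_term_mean: "p1 * busy_term True + (1 - p1) * busy_term False = 0"
  using p_pos by (simp add: busy_term_def ratio_def \<kappa>_def right_diff_distrib)

lemma queue_balance_interval:
  "\<nu> \<le> n \<Longrightarrow> (\<Sum>j\<in>{\<nu><..n}. of_bool (0 < Q j \<omega> \<and> channel_ok j \<omega>) - of_bool (arrival j \<omega>)) =
    real (Q (Suc \<nu>) \<omega>) - real (Q (Suc n) \<omega>)"
proof (induction n rule: dec_induct)
  case (step n)
  have "{\<nu><..Suc n} = insert (Suc n) {\<nu><..n}" using step by auto
  then show ?case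
    using step by (cases "Q (Suc n) \<omega>") (auto simp: Q_Suc_Suc)
qed simp

text \<open>The balance of the queue turns the number of successes into the number of arrivals, which costs
  a bounded term because the queue is empty just before the change.\<close>

lemma ln_LR_le:
  assumes k: "1 \<le> k" and empty: "Q k \<omega> = 0" and n: "Suc k \<le> n" and pos: "0 < LR (Suc k) n \<omega>"
  shows "ln (LR (Suc k) n \<omega>) \<le>
    (\<Sum>j\<in>{Suc k<..n}. (if 0 < Q j \<omega> then busy_term (channel_ok j \<omega>) else 0) + arrival_term (slot j \<omega>)) + 2 * \<kappa> / p1"
proof -
  let ?J = "{Suc k<..n}"
  have pos: "0 < lik (Q j \<omega>) (slot j \<omega>)" if "j \<in> ?J" for j
  proof -
    have "lik (Q j \<omega>) (slot j \<omega>) \<noteq> 0"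
      using pos that by (auto simp: LR_def dest!: prod_zero[of ?J "\<lambda>k. lik (Q k \<omega>) (slot k \<omega>)", rotated, OF bexI])
    then show ?thesis using lik_nonneg[of "Q j \<omega>" "slot j \<omega>"] by simp
  qed
  have "ln (LR (Suc k) n \<omega>) = (\<Sum>j\<in>?J. ln (lik (Q j \<omega>) (slot j \<omega>)))"
    unfolding LR_def by (rule ln_prod) (use pos in force)+
  also have "\<dots> = (\<Sum>j\<in>?J. ((if 0 < Q j \<omega> then busy_term (channel_ok j \<omega>) else 0) + arrival_term (slot j \<omega>)) +
      \<kappa> / p1 * (of_bool (0 < Q j \<omega> \<and> channel_ok j \<omega>) - of_bool (arrival j \<omega>)))"
  proof (intro sum.cong refl)
    fix j assume "j \<in> ?J"
    from pos[OF this] have "0 < Q j \<omega> \<Longrightarrow> 0 < ratio (channel_ok j \<omega>)" "arrival j \<omega> \<Longrightarrow> 0 < \<l> (slot_meas j \<omega>)"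
      using ratio_nonneg[of "channel_ok j \<omega>"] \<l>_nonneg[of "slot_meas j \<omega>"]
      by (auto simp: lik_def slot_def zero_less_mult_iff split: if_splits)
    then show "ln (lik (Q j \<omega>) (slot j \<omega>)) = (if 0 < Q j \<omega> then busy_term (channel_ok j \<omega>) else 0) + arrival_term (slot j \<omega>) +
      \<kappa> / p1 * (of_bool (0 < Q j \<omega> \<and> channel_ok j \<omega>) - of_bool (arrival j \<omega>))"
      by (auto simp: lik_def slot_def busy_term_def arrival_term_def ln_mult)
  qed
  also have "\<dots> = (\<Sum>j\<in>?J. (if 0 < Q j \<omega> then busy_term (channel_ok j \<omega>) else 0) + arrival_term (slot j \<omega>)) +
      \<kappa> / p1 * (real (Q (Suc (Suc k)) \<omega>) - real (Q (Suc n) \<omega>))"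
    by (simp only: sum.distrib sum_distrib_left[symmetric] queue_balance_interval[OF n])
  \<comment> \<open>An empty slot \<open>k\<close> leaves at most one packet for slot
    \<open>k + 1\<close> and two for slot \<open>k + 2\<close>, the first slot after the
    change.\<close>
  also have "\<kappa> / p1 * (real (Q (Suc (Suc k)) \<omega>) - real (Q (Suc n) \<omega>)) \<le> \<kappa> / p1 * 2"
    using \<kappa>_nonneg p_pos Q_Suc[of k \<omega>] Q_Suc_Suc[of k \<omega>] k empty by (intro mult_left_mono) auto
  finally show ?thesis by (simp add: mult.commute)
qed

section \<open>Moment bounds for sums over the slots after the change\<close>

lemma integral_slot_law:
  fixes f :: "bool \<times> bool \<times> 'x \<Rightarrow> real"
  assumes N: "meas_law N" and f[measurable]: "f \<in> borel_measurable (slot_algebra \<mu>)"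
    and int: "\<And>a c. integrable N (\<lambda>x. f (a, c, x))"
  shows "integrable (slot_law r b N) f"
    and "(\<integral>s. f s \<partial>slot_law r b N) = (\<integral>a. \<integral>c. \<integral>x. f (a, c, x) \<partial>N \<partial>b \<partial>bernoulli_pmf r)"
proof -
  interpret N: prob_space N using N by (simp add: meas_law_def)
  interpret bN: pair_prob_space "measure_pmf b" N ..
  interpret abN: pair_prob_space "measure_pmf (bernoulli_pmf r)" "measure_pmf b \<Otimes>\<^sub>M N" ..
  have [measurable_cong]: "sets N = sets \<mu>" using N by (simp add: meas_law_def)
  have fin: "integrable (measure_pmf p) (g :: bool \<Rightarrow> real)" for p g
    by (rule integrable_measure_pmf_finite) simp
  have 1: "integrable (measure_pmf b \<Otimes>\<^sub>M N) (\<lambda>y. f (a, y))" for a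
    by (rule bN.Fubini_integrable) (auto simp: fin int)
  then show *: "integrable (slot_law r b N) f"
    unfolding slot_law_def by (intro abN.Fubini_integrable) (auto simp: fin)
  have "(\<integral>s. f s \<partial>slot_law r b N) = (\<integral>a. \<integral>y. f (a, y) \<partial>(measure_pmf b \<Otimes>\<^sub>M N) \<partial>bernoulli_pmf r)"
    using abN.integral_fst'[OF *[unfolded slot_law_def]] by (simp add: slot_law_def)
  also have "\<dots> = (\<integral>a. \<integral>c. \<integral>x. f (a, c, x) \<partial>N \<partial>b \<partial>bernoulli_pmf r)"
    using bN.integral_fst'[OF 1] by simp
  finally show "(\<integral>s. f s \<partial>slot_law r b N) = (\<integral>a. \<integral>c. \<integral>x. f (a, c, x) \<partial>N \<partial>b \<partial>bernoulli_pmf r)" .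
qed

lemma measurable_arrival_term[measurable]: "arrival_term \<in> borel_measurable (slot_algebra \<mu>)"
  unfolding arrival_term_def[abs_def] by measurable

lemma arrival_term_mean:
  "integrable (slot_law r b1 N1) arrival_term" "(\<integral>s. arrival_term s \<partial>slot_law r b1 N1) = info"
proof -
  interpret N1: prob_space N1 by (rule prob_N1)
  have i: "integrable N1 (\<lambda>x. arrival_term (a, c, x))" for a c
    using integrable_ln_\<l> by (simp add: arrival_term_def)
  show "integrable (slot_law r b1 N1) arrival_term"
    by (intro integral_slot_law i) auto
  show "(\<integral>s. arrival_term s \<partial>slot_law r b1 N1) = info"
    using r_pos r_less p_le_1 p_pos integrable_ln_\<l>
    by (subst integral_slot_law[OF _ _ i])
      (auto simp: arrival_term_def integral_bernoulli_pmf info_def N1.prob_space algebra_simps)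
qed

text \<open>Orthogonality of martingale increments. The queue at the beginning of slot
  \<open>n + 1\<close> is fixed by earlier slots, so resampling this slot averages \<open>w\<close>
  to 0 and removes the cross term. The event \<open>H\<close> is unaffected because it is observed
  by time \<open>k\<close>, before that slot.\<close>

lemma second_moment:
  fixes w :: "nat \<Rightarrow> bool \<times> bool \<times> 'x \<Rightarrow> real"
  assumes w[measurable]: "\<And>q. w q \<in> borel_measurable (slot_algebra \<mu>)"
    and bound: "\<And>q s. \<bar>w q s\<bar> \<le> B"
    and mean0: "\<And>q. (\<integral>s. w q s \<partial>slot_law r b1 N1) = 0"
    and H: "H \<in> sets (observations \<mu> (enat k))" and "k \<le> \<nu>" and "\<nu> \<le> n"
  shows "(\<integral>\<omega>. indicator H \<omega> * (\<Sum>j\<in>{\<nu><..n}. w (Q j \<omega>) (slot j \<omega>))\<^sup>2 \<partial>Pr (enat \<nu>))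
    \<le> real (n - \<nu>) * B\<^sup>2 * measure (Pr (enat \<nu>)) H"
  using \<open>\<nu> \<le> n\<close>
proof (induction n rule: dec_induct)
  case (step n)
  let ?P = "Pr (enat \<nu>)" and ?L = "slot_law r b1 N1"
  interpret P: prob_space ?P by (rule prob_space_Pr)
  interpret L: prob_space ?L by (intro prob_space_slot_law) simp
  have [measurable_cong]: "sets ?L = sets (slot_algebra \<mu>)" by (intro sets_slot_law) simp
  have spL: "space ?L = space (slot_algebra \<mu>)" by (intro sets_eq_imp_space_eq sets_slot_law) simp
  have HA[measurable]: "H \<in> sets (outcome_algebra \<mu>)" using H sets_observations_subset by auto
  define \<Sigma> where "\<Sigma> n \<omega> = (\<Sum>j\<in>{\<nu><..n}. w (Q j \<omega>) (slot j \<omega>))" for n \<omega>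
  have mw[measurable]: "(\<lambda>\<omega>. w (Q j \<omega>) (slot j \<omega>)) \<in> borel_measurable (outcome_algebra \<mu>)" for j
    by (rule measurable_compose_countable[where f="\<lambda>q \<omega>. w q (slot j \<omega>)", OF _ measurable_Q]) measurable
  have m\<Sigma>[measurable]: "\<Sigma> n \<in> borel_measurable (outcome_algebra \<mu>)" for n
    unfolding \<Sigma>_def[abs_def] by measurable
  have b\<Sigma>: "\<bar>\<Sigma> n \<omega>\<bar> \<le> real (card {\<nu><..n}) * B" for n \<omega>
    unfolding \<Sigma>_def using bound by (intro order_trans[OF sum_abs] sum_bounded_above) auto
  have int: "integrable ?P (\<lambda>\<omega>. indicator H \<omega> * (\<Sigma> n \<omega>)\<^sup>2)" for n
  proof (rule P.integrable_const_bound)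
    show "AE \<omega> in ?P. norm (indicator H \<omega> * (\<Sigma> n \<omega>)\<^sup>2) \<le> (real (card {\<nu><..n}) * B)\<^sup>2"
      using power_mono[OF b\<Sigma>[of n], where n=2] by (auto simp: indicator_def)
  qed measurable
  have iw: "integrable ?L (w q)" for q
    by (rule L.integrable_const_bound[where B=B]) (use bound in auto)
  have bw2: "(w q s)\<^sup>2 \<le> B\<^sup>2" for q s
    using power_mono[OF bound[of q s], where n=2] by simp
  have iw2: "integrable ?L (\<lambda>s. (w q s)\<^sup>2)" for q
    by (rule L.integrable_const_bound[where B="B\<^sup>2"]) (use bw2 in auto)
  have Suc: "{\<nu><..Suc n} = insert (Suc n) {\<nu><..n}" using step by auto
  have inner: "(\<integral>s. indicator H (set_slot (Suc n) s \<omega>) * (\<Sigma> (Suc n) (set_slot (Suc n) s \<omega>))\<^sup>2 \<partial>?L)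
      \<le> indicator H \<omega> * (\<Sigma> n \<omega>)\<^sup>2 + B\<^sup>2 * indicator H \<omega>" if \<omega>: "\<omega> \<in> outcome_space \<mu>" for \<omega>
  proof -
    let ?q = "Q (Suc n) \<omega>"
    have \<Sigma>: "\<Sigma> (Suc n) (set_slot (Suc n) s \<omega>) = \<Sigma> n \<omega> + w ?q s" for s
      unfolding \<Sigma>_def Suc by (simp add: add.commute)
    have "(\<integral>s. indicator H (set_slot (Suc n) s \<omega>) * (\<Sigma> (Suc n) (set_slot (Suc n) s \<omega>))\<^sup>2 \<partial>?L) =
       (\<integral>s. indicator H \<omega> * ((\<Sigma> n \<omega>)\<^sup>2 + 2 * \<Sigma> n \<omega> * w ?q s + (w ?q s)\<^sup>2) \<partial>?L)"
    proof (intro Bochner_Integration.integral_cong refl)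
      fix s assume "s \<in> space ?L"
      then have "indicator H (set_slot (Suc n) s \<omega>) = (indicator H \<omega> :: real)"
        using mem_set_slot_iff[OF H, of "Suc n" \<omega> s] \<omega> step \<open>k \<le> \<nu>\<close> by (simp add: spL indicator_def)
      then show "indicator H (set_slot (Suc n) s \<omega>) * (\<Sigma> (Suc n) (set_slot (Suc n) s \<omega>))\<^sup>2 =
         indicator H \<omega> * ((\<Sigma> n \<omega>)\<^sup>2 + 2 * \<Sigma> n \<omega> * w ?q s + (w ?q s)\<^sup>2)"
        by (simp only: \<Sigma>) (simp add: power2_sum algebra_simps)
    qed
    also have "\<dots> = indicator H \<omega> * ((\<Sigma> n \<omega>)\<^sup>2 + (\<integral>s. (w ?q s)\<^sup>2 \<partial>?L))"
      using iw iw2 by (simp add: mean0 L.prob_space)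
    also have "\<dots> \<le> indicator H \<omega> * ((\<Sigma> n \<omega>)\<^sup>2 + B\<^sup>2)"
    proof -
      have "(\<integral>s. (w ?q s)\<^sup>2 \<partial>?L) \<le> (\<integral>s. B\<^sup>2 \<partial>?L)"
        using bw2 by (intro integral_mono iw2) auto
      then show ?thesis by (intro mult_left_mono add_left_mono) (auto simp: L.prob_space)
    qed
    finally show ?thesis by (simp add: algebra_simps)
  qed
  have P: "?P = glaw (\<lambda>k. if enat k \<le> enat \<nu> then b0 else b1) (\<lambda>k. if enat k \<le> enat \<nu> then N0 else N1)"
    by (simp add: Pr_def)
  have L: "slot_law r ((\<lambda>k. if enat k \<le> enat \<nu> then b0 else b1) (Suc n)) ((\<lambda>k. if enat k \<le> enat \<nu> then N0 else N1) (Suc n)) = ?L"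
    using step by simp
  have "(\<integral>\<omega>. indicator H \<omega> * (\<Sigma> (Suc n) \<omega>)\<^sup>2 \<partial>?P) =
      (\<integral>\<omega>. (\<integral>s. indicator H (set_slot (Suc n) s \<omega>) * (\<Sigma> (Suc n) (set_slot (Suc n) s \<omega>))\<^sup>2 \<partial>?L) \<partial>?P)"
    unfolding P L[symmetric] by (rule integral_resample_slot(1)[OF _ int[unfolded P]]) simp
  also have "\<dots> \<le> (\<integral>\<omega>. indicator H \<omega> * (\<Sigma> n \<omega>)\<^sup>2 + B\<^sup>2 * indicator H \<omega> \<partial>?P)"
  proof (rule integral_mono)
    show "integrable ?P (\<lambda>\<omega>. \<integral>s. indicator H (set_slot (Suc n) s \<omega>) * (\<Sigma> (Suc n) (set_slot (Suc n) s \<omega>))\<^sup>2 \<partial>?L)"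
      unfolding P L[symmetric] by (rule integral_resample_slot(2)[OF _ int[unfolded P]]) simp
    show "integrable ?P (\<lambda>\<omega>. indicator H \<omega> * (\<Sigma> n \<omega>)\<^sup>2 + B\<^sup>2 * indicator H \<omega>)"
      by (intro Bochner_Integration.integrable_add int integrable_mult_right)
        (simp add: integrable_real_indicator sets_Pr less_top[symmetric])
  qed (use inner in \<open>simp add: space_Pr\<close>)
  also have "\<dots> = (\<integral>\<omega>. indicator H \<omega> * (\<Sigma> n \<omega>)\<^sup>2 \<partial>?P) + B\<^sup>2 * measure ?P H"
    using int by (subst Bochner_Integration.integral_add)
      (auto simp: integrable_real_indicator sets_Pr less_top[symmetric] intro!: integrable_mult_right)
  also have "\<dots> \<le> real (n - \<nu>) * B\<^sup>2 * measure ?P H + B\<^sup>2 * measure ?P H"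
    using step unfolding \<Sigma>_def by simp
  also have "\<dots> = real (Suc n - \<nu>) * B\<^sup>2 * measure ?P H"
    using step by (simp add: Suc_diff_le algebra_simps)
  finally show ?case unfolding \<Sigma>_def .
qed simp

lemma chebyshev_after_change:
  fixes w :: "nat \<Rightarrow> bool \<times> bool \<times> 'x \<Rightarrow> real"
  assumes w[measurable]: "\<And>q. w q \<in> borel_measurable (slot_algebra \<mu>)"
    and bound: "\<And>q s. \<bar>w q s\<bar> \<le> B"
    and mean0: "\<And>q. (\<integral>s. w q s \<partial>slot_law r b1 N1) = 0"
    and H: "H \<in> sets (observations \<mu> (enat k))" and "k \<le> \<nu>" and "\<nu> \<le> n" and t: "0 < t"
  shows "measure (Pr (enat \<nu>)) {\<omega>\<in>H. t \<le> (\<Sum>j\<in>{\<nu><..n}. w (Q j \<omega>) (slot j \<omega>))}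
    \<le> real (n - \<nu>) * B\<^sup>2 / t\<^sup>2 * measure (Pr (enat \<nu>)) H"
proof -
  let ?P = "Pr (enat \<nu>)"
  interpret P: prob_space ?P by (rule prob_space_Pr)
  have HA[measurable]: "H \<in> sets (outcome_algebra \<mu>)" using H sets_observations_subset by auto
  let ?S = "\<lambda>\<omega>. \<Sum>j\<in>{\<nu><..n}. w (Q j \<omega>) (slot j \<omega>)"
  let ?E = "{\<omega>\<in>H. t \<le> ?S \<omega>}"
  have [measurable]: "(\<lambda>\<omega>. w (Q j \<omega>) (slot j \<omega>)) \<in> borel_measurable (outcome_algebra \<mu>)" for j
    by (rule measurable_compose_countable[where f="\<lambda>q \<omega>. w q (slot j \<omega>)", OF _ measurable_Q]) measurable
  have b: "\<bar>?S \<omega>\<bar> \<le> real (card {\<nu><..n}) * B" for \<omega>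
    using bound by (intro order_trans[OF sum_abs] sum_bounded_above) auto
  have int: "integrable ?P (\<lambda>\<omega>. indicator H \<omega> * (?S \<omega>)\<^sup>2)"
  proof (rule P.integrable_const_bound)
    show "AE \<omega> in ?P. norm (indicator H \<omega> * (?S \<omega>)\<^sup>2) \<le> (real (card {\<nu><..n}) * B)\<^sup>2"
      using power_mono[OF b, where n=2] by (auto simp: indicator_def)
  qed measurable
  have E[measurable]: "?E \<in> sets (outcome_algebra \<mu>)" by measurable
  have "t\<^sup>2 * measure ?P ?E = (\<integral>\<omega>. t\<^sup>2 * indicator ?E \<omega> \<partial>?P)"
    by (simp add: sets_Pr)
  also have "\<dots> \<le> (\<integral>\<omega>. indicator H \<omega> * (?S \<omega>)\<^sup>2 \<partial>?P)"
  proof (rule integral_mono[OF _ int])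
    show "integrable ?P (\<lambda>\<omega>. t\<^sup>2 * indicator ?E \<omega>)"
      by (intro integrable_mult_right) (simp add: integrable_real_indicator sets_Pr less_top[symmetric])
    show "t\<^sup>2 * indicator ?E \<omega> \<le> indicator H \<omega> * (?S \<omega>)\<^sup>2" for \<omega>
      using t by (auto simp: indicator_def intro: power_mono)
  qed
  also have "\<dots> \<le> real (n - \<nu>) * B\<^sup>2 * measure ?P H"
    by (intro second_moment[where k=k] w bound mean0 H \<open>k \<le> \<nu>\<close> \<open>\<nu> \<le> n\<close>)
  finally show ?thesis using t by (simp add: field_simps)
qed

text \<open>For the part cut off by truncation, which may lack a second moment. Each slot after the
  change is independent of \<open>H\<close>, so a first moment bound holds relative to
  \<open>H\<close>.\<close>

lemma markov_after_change:
  fixes R :: "bool \<times> bool \<times> 'x \<Rightarrow> real"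
  assumes R[measurable]: "R \<in> borel_measurable (slot_algebra \<mu>)" and nonneg: "\<And>s. 0 \<le> R s"
    and int: "integrable (slot_law r b1 N1) R"
    and H: "H \<in> sets (observations \<mu> (enat k))" and "k \<le> \<nu>" and t: "0 < t"
  shows "measure (Pr (enat \<nu>)) {\<omega>\<in>H. t \<le> (\<Sum>j\<in>{\<nu><..n}. R (slot j \<omega>))}
    \<le> real (n - \<nu>) * (\<integral>s. R s \<partial>slot_law r b1 N1) / t * measure (Pr (enat \<nu>)) H"
proof -
  let ?P = "Pr (enat \<nu>)" and ?L = "slot_law r b1 N1"
  interpret P: prob_space ?P by (rule prob_space_Pr)
  have HA[measurable]: "H \<in> sets (outcome_algebra \<mu>)" using H sets_observations_subset by auto
  have spL: "space ?L = space (slot_algebra \<mu>)" by (intro sets_eq_imp_space_eq sets_slot_law) simp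
  have one: "(\<integral>\<^sup>+\<omega>. indicator H \<omega> * ennreal (R (slot j \<omega>)) \<partial>?P) = ennreal ((\<integral>s. R s \<partial>?L) * measure ?P H)"
    if "\<nu> < j" for j
  proof -
    let ?\<beta> = "\<lambda>k. if enat k \<le> enat \<nu> then b0 else b1" and ?N = "\<lambda>k. if enat k \<le> enat \<nu> then N0 else N1"
    have P: "?P = glaw ?\<beta> ?N" by (simp add: Pr_def)
    have P': "?P = glaw (?\<beta>(j := b1)) (?N(j := N1))"
      unfolding P using that by (intro arg_cong2[where f=glaw]) (auto simp: fun_eq_iff)
    have m: "(\<lambda>\<omega>. indicator H \<omega> * ennreal (R (slot j \<omega>))) \<in> borel_measurable (outcome_algebra \<mu>)"
      by measurable
    have N: "meas_law (?N k)" for k by simp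
    have "(\<integral>\<^sup>+\<omega>. indicator H \<omega> * ennreal (R (slot j \<omega>)) \<partial>?P) =
        (\<integral>\<^sup>+\<omega>. \<integral>\<^sup>+s. indicator H (set_slot j s \<omega>) * ennreal (R (slot j (set_slot j s \<omega>))) \<partial>?L \<partial>?P)"
      unfolding P by (subst P'[unfolded P], rule nn_integral_resample_slot[OF N _ m]) simp
    also have "\<dots> = (\<integral>\<^sup>+\<omega>. \<integral>\<^sup>+s. indicator H \<omega> * ennreal (R s) \<partial>?L \<partial>?P)"
    proof (intro nn_integral_cong)
      fix \<omega> s assume "\<omega> \<in> space ?P" "s \<in> space ?L"
      then show "indicator H (set_slot j s \<omega>) * ennreal (R (slot j (set_slot j s \<omega>))) = indicator H \<omega> * ennreal (R s)"
        using mem_set_slot_iff[OF H, of j \<omega> s] that \<open>k \<le> \<nu>\<close> by (simp add: spL space_Pr indicator_def)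
    qed
    also have "\<dots> = (\<integral>\<^sup>+\<omega>. indicator H \<omega> * (\<integral>\<^sup>+s. ennreal (R s) \<partial>?L) \<partial>?P)"
      using sets_slot_law[OF meas_law_N1, of b1]
      by (intro nn_integral_cong nn_integral_cmult) (simp cong: measurable_cong_sets)
    also have "(\<integral>\<^sup>+s. ennreal (R s) \<partial>?L) = ennreal (\<integral>s. R s \<partial>?L)"
      using int nonneg by (intro nn_integral_eq_integral) auto
    also have "(\<integral>\<^sup>+\<omega>. indicator H \<omega> * ennreal (\<integral>s. R s \<partial>?L) \<partial>?P) = ennreal ((\<integral>s. R s \<partial>?L) * measure ?P H)"
      using nonneg by (subst nn_integral_multc)
        (auto simp: sets_Pr P.emeasure_eq_measure ennreal_mult mult.commute)
    finally show ?thesis .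
  qed
  let ?S = "\<lambda>\<omega>. \<Sum>j\<in>{\<nu><..n}. R (slot j \<omega>)"
  let ?E = "{\<omega>\<in>H. t \<le> ?S \<omega>}"
  have E[measurable]: "?E \<in> sets (outcome_algebra \<mu>)" by measurable
  have "ennreal (t * measure ?P ?E) = (\<integral>\<^sup>+\<omega>. ennreal t * indicator ?E \<omega> \<partial>?P)"
    using t by (simp add: nn_integral_cmult_indicator sets_Pr P.emeasure_eq_measure ennreal_mult)
  also have "\<dots> \<le> (\<integral>\<^sup>+\<omega>. (\<Sum>j\<in>{\<nu><..n}. indicator H \<omega> * ennreal (R (slot j \<omega>))) \<partial>?P)"
    using nonneg by (intro nn_integral_mono) (auto simp: indicator_def sum_nonneg intro!: ennreal_leI)
  also have "\<dots> = (\<Sum>j\<in>{\<nu><..n}. \<integral>\<^sup>+\<omega>. indicator H \<omega> * ennreal (R (slot j \<omega>)) \<partial>?P)"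
    by (intro nn_integral_sum) measurable
  also have "\<dots> = (\<Sum>j\<in>{\<nu><..n}. ennreal ((\<integral>s. R s \<partial>?L) * measure ?P H))"
    by (intro sum.cong one) auto
  also have "\<dots> = ennreal (real (n - \<nu>) * ((\<integral>s. R s \<partial>?L) * measure ?P H))"
    using nonneg by (simp add: ennreal_mult ennreal_of_nat_eq_real_of_nat)
  finally have "t * measure ?P ?E \<le> real (n - \<nu>) * ((\<integral>s. R s \<partial>?L) * measure ?P H)"
    using nonneg by (subst (asm) ennreal_le_iff) auto
  then show ?thesis using t by (simp add: field_simps)
qed

definition tail_term :: "real \<Rightarrow> bool \<times> bool \<times> 'x \<Rightarrow> real" where
  "tail_term B s = (if \<bar>arrival_term s\<bar> \<le> B then 0 else \<bar>arrival_term s\<bar>)"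

lemma measurable_tail_term[measurable]: "tail_term B \<in> borel_measurable (slot_algebra \<mu>)"
  unfolding tail_term_def[abs_def] by measurable

lemma borel_measurable_slot_law:
  "f \<in> borel_measurable (slot_algebra \<mu>) \<Longrightarrow> f \<in> borel_measurable (slot_law r b1 N1)"
  by (simp add: measurable_cong_sets[OF sets_slot_law[OF meas_law_N1] refl])

lemma integrable_tail_term: "integrable (slot_law r b1 N1) (tail_term B)"
  by (rule Bochner_Integration.integrable_bound[OF arrival_term_mean(1)])
    (auto intro!: borel_measurable_slot_law simp: tail_term_def)

lemma tail_term_small:
  assumes "0 < e"
  shows "\<exists>B\<ge>0. (\<integral>s. tail_term B s \<partial>slot_law r b1 N1) < e"
proof -
  let ?L = "slot_law r b1 N1"
  have "(\<lambda>n. \<integral>s. tail_term (real n) s \<partial>?L) \<longlonglongrightarrow> (\<integral>s. 0 \<partial>?L)"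
  proof (rule integral_dominated_convergence)
    show "integrable ?L (\<lambda>s. \<bar>arrival_term s\<bar>)" using arrival_term_mean(1) by simp
    show "AE s in ?L. (\<lambda>n. tail_term (real n) s) \<longlonglongrightarrow> 0"
    proof (rule AE_I2)
      fix s
      obtain n0 :: nat where n0: "\<bar>arrival_term s\<bar> \<le> real n0" using real_arch_simple by blast
      have "tail_term (real n) s = 0" if "n0 \<le> n" for n
        using n0 that by (simp add: tail_term_def)
      then show "(\<lambda>n. tail_term (real n) s) \<longlonglongrightarrow> 0"
        by (intro tendsto_eventually) (auto simp: eventually_sequentially)
    qed
    show "AE s in ?L. norm (tail_term (real n) s) \<le> \<bar>arrival_term s\<bar>" for n
      by (simp add: tail_term_def)
  qed (auto intro!: borel_measurable_slot_law)
  then have "\<forall>\<^sub>F n in sequentially. (\<integral>s. tail_term (real n) s \<partial>?L) < e"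
    by (rule order_tendstoD(2)) (simp add: \<open>0 < e\<close>)
  from eventually_happens'[OF sequentially_bot this]
  obtain n where "(\<integral>s. tail_term (real n) s \<partial>?L) < e" by blast
  then show ?thesis by (intro exI[of _ "real n"]) simp
qed

text \<open>The part of the arrival terms above a large level has small mean; the remaining part and the
  terms of the busy slots are bounded and centred given the past.\<close>

lemma LR_concentration:
  assumes \<delta>: "0 < \<delta>" and \<eta>: "0 < \<eta>"
  shows "\<exists>m0. \<forall>m\<ge>m0. \<forall>k\<ge>1. \<forall>H\<in>sets (observations \<mu> (enat k)). (\<forall>\<omega>\<in>H. Q k \<omega> = 0) \<longrightarrow>
    measure (Pr (enat (Suc k))) {\<omega>\<in>H. exp (real m * (info + \<delta>)) < LR (Suc k) (Suc k + m) \<omega>}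
      \<le> \<eta> * measure (Pr (enat (Suc k))) H"
proof -
  let ?L = "slot_law r b1 N1"
  interpret L: prob_space ?L by (intro prob_space_slot_law) simp
  \<comment> \<open>The first bound limits the shift of the mean by truncation to \<delta> / 4 per
    slot. The second makes the Markov bound 4e / \<delta>, at level m\<delta> / 4, at most \<eta> /
    2.\<close>
  have "0 < min (\<delta> / 4) (\<delta> * \<eta> / 8)" using \<delta> \<eta> by simp
  from tail_term_small[OF this] obtain B where B: "0 \<le> B"
    and e: "(\<integral>s. tail_term B s \<partial>?L) < min (\<delta> / 4) (\<delta> * \<eta> / 8)" by blast
  define e where "e = (\<integral>s. tail_term B s \<partial>?L)"
  have e: "0 \<le> e" "e \<le> \<delta> / 4" "e \<le> \<delta> * \<eta> / 8"
    using e by (auto simp: e_def tail_term_def intro!: Bochner_Integration.integral_nonneg)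
  define \<tau> where "\<tau> s = (if \<bar>arrival_term s\<bar> \<le> B then arrival_term s else 0)" for s
  have m\<tau>[measurable]: "\<tau> \<in> borel_measurable (slot_algebra \<mu>)" unfolding \<tau>_def[abs_def] by measurable
  have b\<tau>: "\<bar>\<tau> s\<bar> \<le> B" for s using B by (simp add: \<tau>_def)
  have i\<tau>: "integrable ?L \<tau>"
    by (rule L.integrable_const_bound[where B=B]) (use b\<tau> in \<open>auto intro!: borel_measurable_slot_law\<close>)
  define t where "t = (\<integral>s. \<tau> s \<partial>?L)"
  have bt: "\<bar>t\<bar> \<le> B"
  proof -
    have "\<bar>t\<bar> \<le> (\<integral>s. \<bar>\<tau> s\<bar> \<partial>?L)" unfolding t_def by (rule integral_abs_bound)
    also have "\<dots> \<le> (\<integral>s. B \<partial>?L)" using i\<tau> b\<tau> by (intro integral_mono) auto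
    finally show ?thesis by (simp add: L.prob_space)
  qed
  have t: "t \<le> info + e"
  proof -
    have "t \<le> (\<integral>s. arrival_term s + tail_term B s \<partial>?L)"
      unfolding t_def
      by (intro integral_mono i\<tau> Bochner_Integration.integrable_add arrival_term_mean integrable_tail_term)
        (auto simp: \<tau>_def tail_term_def)
    also have "\<dots> = info + e"
      unfolding e_def using arrival_term_mean integrable_tail_term by (subst Bochner_Integration.integral_add) auto
    finally show ?thesis .
  qed
  define w where "w q s = (if 0 < q then busy_term (fst (snd s)) else 0) + (\<tau> s - t)" for q :: nat and s
  define C where "C = \<bar>busy_term True\<bar> + \<bar>busy_term False\<bar> + 2 * B"
  have mw[measurable]: "w q \<in> borel_measurable (slot_algebra \<mu>)" for q
    unfolding w_def[abs_def] by measurable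
  have bw: "\<bar>w q s\<bar> \<le> C" for q s
    using b\<tau>[of s] bt by (cases "fst (snd s)") (auto simp: w_def C_def)
  have mean: "(\<integral>s. w q s \<partial>?L) = 0" for q
  proof -
    interpret N1: prob_space N1 by (rule prob_N1)
    have i: "integrable ?L (\<lambda>s. busy_term (fst (snd s)))" "(\<integral>s. busy_term (fst (snd s)) \<partial>?L) = 0"
      using busy_term_mean r_pos r_less p_le_1 p_pos
      by (auto simp: integral_slot_law N1.prob_space integral_bernoulli_pmf mult.commute)
    have "(\<integral>s. w q s \<partial>?L) = (\<integral>s. (if 0 < q then busy_term (fst (snd s)) else 0) \<partial>?L) + (\<integral>s. \<tau> s - t \<partial>?L)"
      unfolding w_def using i i\<tau> by (intro Bochner_Integration.integral_add) (cases "0 < q"; simp)+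
    also have "(\<integral>s. \<tau> s - t \<partial>?L) = 0"
      using i\<tau> by (simp add: t_def L.prob_space)
    finally show ?thesis using i by (cases "0 < q") auto
  qed
  \<comment> \<open>The first condition brings the Chebyshev bound 16 \<open>C\<^sup>2\<close> / (m
    \<open>\<delta>\<^sup>2\<close>) below \<eta> / 2, the second brings the backlog term 2\<kappa>
    / \<open>p1\<close> below m\<delta> / 4.\<close>
  obtain m0 :: nat where m0: "32 * C\<^sup>2 / (\<delta>\<^sup>2 * \<eta>) \<le> real m0" "8 * \<kappa> / (p1 * \<delta>) \<le> real m0" "1 \<le> real m0"
    using real_arch_simple[of "max (32 * C\<^sup>2 / (\<delta>\<^sup>2 * \<eta>)) (max (8 * \<kappa> / (p1 * \<delta>)) 1)"] by auto
  show ?thesis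
  proof (intro exI[of _ m0] allI ballI impI)
    fix m k :: nat and H
    assume m: "m0 \<le> m" and k: "1 \<le> k" and H: "H \<in> sets (observations \<mu> (enat k))"
      and empty: "\<forall>\<omega>\<in>H. Q k \<omega> = 0"
    let ?P = "Pr (enat (Suc k))"
    interpret P: prob_space ?P by (rule prob_space_Pr)
    have HA[measurable]: "H \<in> sets (outcome_algebra \<mu>)" using H sets_observations_subset by auto
    have m1: "32 * C\<^sup>2 / (\<delta>\<^sup>2 * \<eta>) \<le> real m" "8 * \<kappa> / (p1 * \<delta>) \<le> real m" "1 \<le> real m"
      using m0 m by (auto intro: order_trans)
    then have mpos: "0 < real m" by simp
    let ?n = "Suc k + m" and ?J = "{Suc k<..Suc k + m}"
    let ?E1 = "{\<omega>\<in>H. real m * \<delta> / 4 \<le> (\<Sum>j\<in>?J. w (Q j \<omega>) (slot j \<omega>))}"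
    let ?E2 = "{\<omega>\<in>H. real m * \<delta> / 4 \<le> (\<Sum>j\<in>?J. tail_term B (slot j \<omega>))}"
    have [measurable]: "(\<lambda>\<omega>. w (Q j \<omega>) (slot j \<omega>)) \<in> borel_measurable (outcome_algebra \<mu>)" for j
      by (rule measurable_compose_countable[where f="\<lambda>q \<omega>. w q (slot j \<omega>)", OF _ measurable_Q]) measurable
    have E: "?E1 \<in> sets (outcome_algebra \<mu>)" "?E2 \<in> sets (outcome_algebra \<mu>)"
      by measurable
    \<comment> \<open>Of the excess m\<delta>, a quarter is used by the truncated mean and a quarter
      by the backlog. The remaining half must come from the centred sum or from the tail sum, so one
      of them reaches m\<delta> / 4.\<close>
    have sub: "{\<omega>\<in>H. exp (real m * (info + \<delta>)) < LR (Suc k) ?n \<omega>} \<subseteq> ?E1 \<union> ?E2"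
    proof
      fix \<omega> assume "\<omega> \<in> {\<omega>\<in>H. exp (real m * (info + \<delta>)) < LR (Suc k) ?n \<omega>}"
      then have \<omega>: "\<omega> \<in> H" and LR: "exp (real m * (info + \<delta>)) < LR (Suc k) ?n \<omega>" by auto
      have pos: "0 < LR (Suc k) ?n \<omega>" using LR exp_gt_zero less_trans by blast
      have "real m * (info + \<delta>) < ln (LR (Suc k) ?n \<omega>)"
        using LR pos by (metis exp_less_cancel_iff exp_ln)
      also have "\<dots> \<le> (\<Sum>j\<in>?J. (if 0 < Q j \<omega> then busy_term (channel_ok j \<omega>) else 0) + arrival_term (slot j \<omega>)) + 2 * \<kappa> / p1"
        using empty \<omega> by (intro ln_LR_le k pos) auto
      also have "(\<Sum>j\<in>?J. (if 0 < Q j \<omega> then busy_term (channel_ok j \<omega>) else 0) + arrival_term (slot j \<omega>)) \<le>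
          (\<Sum>j\<in>?J. w (Q j \<omega>) (slot j \<omega>) + tail_term B (slot j \<omega>) + t)"
        by (intro sum_mono) (auto simp: w_def \<tau>_def tail_term_def slot_def)
      also have "\<dots> = (\<Sum>j\<in>?J. w (Q j \<omega>) (slot j \<omega>)) + (\<Sum>j\<in>?J. tail_term B (slot j \<omega>)) + real m * t"
        by (simp add: sum.distrib)
      also have "real m * t \<le> real m * (info + \<delta> / 4)"
        using t e by (intro mult_left_mono) auto
      also have "2 * \<kappa> / p1 \<le> real m * \<delta> / 4"
        using m1(2) p_pos \<delta> by (simp add: field_simps)
      finally have "real m * \<delta> / 2 < (\<Sum>j\<in>?J. w (Q j \<omega>) (slot j \<omega>)) + (\<Sum>j\<in>?J. tail_term B (slot j \<omega>))"
        by (simp add: algebra_simps)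
      then show "\<omega> \<in> ?E1 \<union> ?E2" using \<omega> by auto
    qed
    have t0: "0 < real m * \<delta> / 4" using \<delta> mpos by simp
    have "P.prob ?E1 \<le> real (?n - Suc k) * C\<^sup>2 / (real m * \<delta> / 4)\<^sup>2 * P.prob H"
      by (rule chebyshev_after_change[OF mw bw mean H _ _ t0]) auto
    also have "\<dots> \<le> \<eta> / 2 * P.prob H"
    proof (intro mult_right_mono)
      have "32 * C\<^sup>2 \<le> real m * (\<delta>\<^sup>2 * \<eta>)"
        using m1(1) \<delta> \<eta> by (simp add: field_simps)
      then show "real (?n - Suc k) * C\<^sup>2 / (real m * \<delta> / 4)\<^sup>2 \<le> \<eta> / 2"
        using mpos \<delta> \<eta> by (simp add: power2_eq_square field_simps)
    qed simp
    finally have P1: "P.prob ?E1 \<le> \<eta> / 2 * P.prob H" .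
    have "P.prob ?E2 \<le> real (?n - Suc k) * e / (real m * \<delta> / 4) * P.prob H"
      unfolding e_def
      by (rule markov_after_change[OF measurable_tail_term _ integrable_tail_term H _ t0]) (auto simp: tail_term_def)
    also have "\<dots> \<le> \<eta> / 2 * P.prob H"
      using mpos \<delta> \<eta> e by (intro mult_right_mono) (simp_all add: field_simps)
    finally have P2: "P.prob ?E2 \<le> \<eta> / 2 * P.prob H" .
    have "P.prob {\<omega>\<in>H. exp (real m * (info + \<delta>)) < LR (Suc k) ?n \<omega>} \<le> P.prob (?E1 \<union> ?E2)"
      using E by (intro P.finite_measure_mono sub) (auto simp: sets_Pr)
    also have "\<dots> \<le> P.prob ?E1 + P.prob ?E2"
      using E by (intro measure_Un_le) (auto simp: sets_Pr)
    also have "\<dots> \<le> \<eta> * P.prob H" using P1 P2 by simp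
    finally show "P.prob {\<omega>\<in>H. exp (real m * (info + \<delta>)) < LR (Suc k) ?n \<omega>} \<le> \<eta> * P.prob H" .
  qed
qed

end

section \<open>The lower bound\<close>

text \<open>The essential supremum dominates the average of the conditional expectation over
  \<open>H\<close>, and this average is that of \<open>f\<close> because \<open>H\<close> lies in
  the conditioning sigma-algebra.\<close>

lemma esssup_nn_cond_exp_ge:
  assumes M: "prob_space M" and sub: "subalgebra M G" and f: "f \<in> borel_measurable M"
    and H: "H \<in> sets G" "0 < measure M H"
    and le: "ennreal (a * measure M H) \<le> (\<integral>\<^sup>+\<omega>. indicator H \<omega> * f \<omega> \<partial>M)" and "0 \<le> a"
  shows "ennreal a \<le> esssup M (nn_cond_exp M G f)"
proof -
  interpret M: prob_space M by fact
  interpret sigma_finite_subalgebra M G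
    by (rule sigma_finite_subalgebra.intro[OF sub prob_space_imp_sigma_finite[OF prob_space_restr_to_subalg[OF sub M]]])
  have HM: "H \<in> sets M" using H sub by (auto simp: subalgebra_def)
  let ?c = "esssup M (nn_cond_exp M G f)"
  have "(\<integral>\<^sup>+\<omega>. indicator H \<omega> * f \<omega> \<partial>M) = (\<integral>\<^sup>+\<omega>. indicator H \<omega> * nn_cond_exp M G f \<omega> \<partial>M)"
    using H f by (intro nn_cond_exp_intg[symmetric]) auto
  also have "\<dots> \<le> (\<integral>\<^sup>+\<omega>. ?c * indicator H \<omega> \<partial>M)"
  proof (rule nn_integral_mono_AE)
    show "AE \<omega> in M. indicator H \<omega> * nn_cond_exp M G f \<omega> \<le> ?c * indicator H \<omega>"
      using esssup_AE[of "nn_cond_exp M G f" M] by eventually_elim (auto simp: indicator_def)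
  qed
  also have "\<dots> = ?c * ennreal (measure M H)"
    using HM by (simp add: nn_integral_cmult_indicator M.emeasure_eq_measure)
  finally have *: "ennreal (a * measure M H) \<le> ?c * ennreal (measure M H)"
    using le by (rule order_trans[rotated])
  show ?thesis
  proof (cases ?c)
    case (real c)
    then show ?thesis
      using * H(2) \<open>0 \<le> a\<close> by (simp add: ennreal_mult[symmetric])
  qed simp
qed

context sensor
begin

lemma subalgebra_observations: "subalgebra (Pr \<nu>) (observations \<mu> t)"
  by (simp add: subalgebra_def space_Pr space_observations sets_Pr sets_observations_subset)

lemma vulnerable_event_sets:
  assumes T: "stopping_time (observations \<mu>) T" and k: "1 \<le> k"
  shows "{\<omega>\<in>outcome_space \<mu>. enat k < T \<omega> \<and> Q k \<omega> = 0} \<in> sets (observations \<mu> (enat k))"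
proof -
  have "{\<omega>\<in>outcome_space \<mu>. enat k < T \<omega> \<and> Q k \<omega> = 0} =
      {\<omega>\<in>outcome_space \<mu>. enat k < T \<omega>} \<inter> {\<omega>\<in>outcome_space \<mu>. Q k \<omega> = 0}" by auto
  also have "\<dots> \<in> sets (observations \<mu> (enat k))"
    by (intro sets.Int stopping_time_greater_sets[OF T] observations_queue_empty[OF k])
  finally show ?thesis .
qed

text \<open>With change point \<open>Suc k\<close> the delay is conditioned on the observations up
  to \<open>k\<close>, which contain \<open>?H\<close>, and \<open>?H\<close> keeps its pre-change
  probability. Given \<open>?H\<close>, an alarm inside the window costs at most
  \<open>K * \<epsilon>\<close> where the ratio is at most \<open>K\<close>, and at most
  \<open>\<eta>\<close> elsewhere.\<close>

lemma worst_case_delay_ge: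
  assumes T: "stopping_time (observations \<mu>) T" and k: "1 \<le> k"
    and vulnerable: "measure (Pr \<infinity>) {\<omega>\<in>outcome_space \<mu>. enat k < T \<omega> \<and> Q k \<omega> = 0 \<and> T \<omega> \<le> enat (k + Suc m)}
      < \<epsilon> * measure (Pr \<infinity>) {\<omega>\<in>outcome_space \<mu>. enat k < T \<omega> \<and> Q k \<omega> = 0}"
    and LR: "measure (Pr (enat (Suc k))) {\<omega>\<in>{\<omega>\<in>outcome_space \<mu>. enat k < T \<omega> \<and> Q k \<omega> = 0}. K < LR (Suc k) (Suc k + m) \<omega>}
      \<le> \<eta> * measure (Pr (enat (Suc k))) {\<omega>\<in>outcome_space \<mu>. enat k < T \<omega> \<and> Q k \<omega> = 0}"
    and pos: "0 \<le> K" "0 \<le> 1 - K * \<epsilon> - \<eta>"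
  shows "ennreal (real m * (1 - K * \<epsilon> - \<eta>)) \<le> worst_case_delay Pr (observations \<mu>) T"
proof -
  let ?H = "{\<omega>\<in>outcome_space \<mu>. enat k < T \<omega> \<and> Q k \<omega> = 0}"
  let ?E = "{\<omega>\<in>outcome_space \<mu>. enat k < T \<omega> \<and> Q k \<omega> = 0 \<and> T \<omega> \<le> enat (k + Suc m)}"
  let ?P = "Pr (enat (Suc k))"
  let ?f = "\<lambda>\<omega>. ennreal_of_enat (T \<omega> + 1 - enat (Suc k))"
  interpret P: prob_space ?P by (rule prob_space_Pr)
  interpret P': prob_space "Pr \<infinity>" by (rule prob_space_Pr)
  have H: "?H \<in> sets (observations \<mu> (enat k))"
    by (rule vulnerable_event_sets[OF T k])
  have E: "?E \<in> sets (observations \<mu> (enat (Suc k + m)))"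
  proof -
    have "?E = ?H - {\<omega>\<in>outcome_space \<mu>. enat (Suc k + m) < T \<omega>}" by (auto simp: not_less)
    moreover have "?H \<in> sets (observations \<mu> (enat (Suc k + m)))"
      by (rule subsetD[OF sets_observations_mono H]) simp
    ultimately show ?thesis
      using stopping_time_greater_sets[OF T, of "enat (Suc k + m)"] by (simp only: sets.Diff)
  qed
  have HP: "?H \<in> P.events" and EP: "?E \<in> P.events"
    unfolding sets_Pr by (rule subsetD[OF sets_observations_subset H], rule subsetD[OF sets_observations_subset E])
  have PH: "P.prob ?H = P'.prob ?H"
    using Pr_agree[OF H, of "enat (Suc k)" \<infinity>] by (simp add: measure_def)
  have "\<not> P'.prob ?H \<le> 0"
  proof
    assume "P'.prob ?H \<le> 0"
    then have "P'.prob ?H = 0" by (simp add: antisym)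
    then show False using vulnerable measure_nonneg[of "Pr \<infinity>" ?E] by simp
  qed
  then have Hpos: "0 < P.prob ?H" using PH by simp
  have "emeasure ?P ?E \<le> ennreal K * emeasure (Pr \<infinity>) ?E + emeasure ?P {\<omega>\<in>?E. LR (Suc k) (Suc k + m) \<omega> > K}"
    by (rule Pr_le_change[OF E _ pos(1)]) simp
  then have "ennreal (P.prob ?E) \<le> ennreal (K * P'.prob ?E + P.prob {\<omega>\<in>?E. LR (Suc k) (Suc k + m) \<omega> > K})"
    using pos by (simp add: P.emeasure_eq_measure P'.emeasure_eq_measure ennreal_mult)
  then have "P.prob ?E \<le> K * P'.prob ?E + P.prob {\<omega>\<in>?E. LR (Suc k) (Suc k + m) \<omega> > K}"
    by (rule iffD1[OF ennreal_le_iff, rotated]) (intro add_nonneg_nonneg mult_nonneg_nonneg measure_nonneg pos)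
  also have "P.prob {\<omega>\<in>?E. LR (Suc k) (Suc k + m) \<omega> > K} \<le> P.prob {\<omega>\<in>?H. K < LR (Suc k) (Suc k + m) \<omega>}"
  proof (rule P.finite_measure_mono)
    have "?H \<in> sets (outcome_algebra \<mu>)" using HP by (simp add: sets_Pr)
    then show "{\<omega>\<in>?H. K < LR (Suc k) (Suc k + m) \<omega>} \<in> P.events"
      unfolding sets_Pr by measurable
  qed auto
  also have "\<dots> \<le> \<eta> * P.prob ?H" by (rule LR)
  also have "K * P'.prob ?E \<le> K * (\<epsilon> * P.prob ?H)"
    using vulnerable pos unfolding PH by (intro mult_left_mono) auto
  finally have PE: "P.prob ?E \<le> (K * \<epsilon> + \<eta>) * P.prob ?H" by (simp add: algebra_simps)
  have "ennreal (real m * (1 - K * \<epsilon> - \<eta>) * P.prob ?H) \<le> ennreal (real m * P.prob (?H - ?E))"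
  proof (intro ennreal_leI)
    have "P.prob (?H - ?E) = P.prob ?H - P.prob ?E"
      using HP EP by (intro P.finite_measure_Diff) auto
    then have "(1 - K * \<epsilon> - \<eta>) * P.prob ?H \<le> P.prob (?H - ?E)"
      using PE by (simp add: algebra_simps)
    then show "real m * (1 - K * \<epsilon> - \<eta>) * P.prob ?H \<le> real m * P.prob (?H - ?E)"
      unfolding mult.assoc by (intro mult_left_mono) auto
  qed
  also have "\<dots> = (\<integral>\<^sup>+\<omega>. ennreal (real m) * indicator (?H - ?E) \<omega> \<partial>?P)"
    using HP EP by (subst nn_integral_cmult_indicator) (auto simp: P.emeasure_eq_measure ennreal_mult)
  also have "\<dots> \<le> (\<integral>\<^sup>+\<omega>. indicator ?H \<omega> * ?f \<omega> \<partial>?P)"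
  proof (intro nn_integral_mono)
    fix \<omega>
    \<comment> \<open>The delay is \<open>T \<omega> - k\<close>, here at least m + 2; m is enough
      for the asymptotics.\<close>
    have "ennreal (real m) \<le> ?f \<omega>" if "\<not> T \<omega> \<le> enat (k + Suc m)"
    proof (cases "T \<omega>")
      case (enat n)
      then have "m \<le> n - k" using that by simp
      then show ?thesis using enat by (simp add: one_enat_def ennreal_of_nat_eq_real_of_nat)
    qed (simp add: one_enat_def)
    then show "ennreal (real m) * indicator (?H - ?E) \<omega> \<le> indicator ?H \<omega> * ?f \<omega>"
      by (auto simp: indicator_def)
  qed
  finally have le: "ennreal (real m * (1 - K * \<epsilon> - \<eta>) * P.prob ?H) \<le> (\<integral>\<^sup>+\<omega>. indicator ?H \<omega> * ?f \<omega> \<partial>?P)" .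
  have "ennreal (real m * (1 - K * \<epsilon> - \<eta>)) \<le> esssup ?P (nn_cond_exp ?P (observations \<mu> (enat (Suc k - 1))) ?f)"
  proof (rule esssup_nn_cond_exp_ge[OF prob_space_Pr subalgebra_observations _ _ Hpos le])
    show "?f \<in> borel_measurable ?P"
      by (rule measurable_compose[OF measurable_stopping_time_Pr[OF T]]) simp
  qed (use H pos in auto)
  also have "\<dots> \<le> worst_case_delay Pr (observations \<mu>) T"
    unfolding worst_case_delay_def by (intro SUP_upper2[of "Suc k"]) auto
  finally show ?thesis .
qed

text \<open>With window length about \<open>c' * ln \<gamma>\<close> and level
  \<open>K = exp (real m * J)\<close>, the level is of order \<open>\<gamma> powr b\<close>. Taking
  \<open>\<epsilon> = \<gamma> powr (- b')\<close> with \<open>b < b' < 1\<close> makes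
  \<open>K * \<epsilon>\<close> vanish, while the threshold of
  \<open>exists_vulnerable_slot\<close>, of order \<open>ln \<gamma> * \<gamma> powr b'\<close>,
  stays below \<gamma>.\<close>

lemma worst_case_delay_asymptotic:
  assumes info: "0 < info" and c: "0 < c" "c < 1 / info"
  shows "\<forall>\<^sub>F \<gamma> in at_top. \<forall>T. stopping_time (observations \<mu>) T \<longrightarrow> ennreal \<gamma> \<le> mean_run_length Pr T \<longrightarrow>
    ennreal (c * ln \<gamma>) \<le> worst_case_delay Pr (observations \<mu>) T"
proof -
  define c' where "c' = (c + 1 / info) / 2"
  have c': "c < c'" "c' < 1 / info" using c by (auto simp: c'_def)
  then have c'0: "0 < c'" using c by simp
  have c'i: "c' * info < 1" using c'(2) info by (simp add: field_simps)
  \<comment> \<open>Half of the slack between \<open>info\<close> and \<open>1 / c'\<close>; it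
    places \<open>b\<close> midway between \<open>c' * info\<close> and 1.\<close>
  define \<delta> where "\<delta> = (1 / c' - info) / 2"
  define J where "J = info + \<delta>"
  define b where "b = c' * J"
  have \<delta>: "0 < \<delta>" using c'i c'0 by (simp add: \<delta>_def field_simps)
  have "b = (c' * info + 1) / 2"
    using c'0 by (simp add: b_def J_def \<delta>_def field_simps)
  then have b: "b < 1" using c'i by simp
  have J: "0 < J" using info \<delta> by (simp add: J_def)
  have b0: "0 < b" using J c'0 by (simp add: b_def)
  \<comment> \<open>Room on both sides: below, for \<open>K * \<epsilon>\<close> to tend to 0, and
    above, for the factor \<open>ln \<gamma>\<close> of the window length.\<close>
  define b' where "b' = (b + 1) / 2"
  have b': "b < b'" "b' < 1" "0 < b'" using b b0 by (auto simp: b'_def)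
  \<comment> \<open>Chosen so that \<open>1 - 2 * \<eta> = c / c'\<close>: the two error
    probabilities together reduce the rate from \<open>c'\<close> to \<open>c\<close>.\<close>
  define \<eta> where "\<eta> = (1 - c / c') / 2"
  have \<eta>: "0 < \<eta>" using c' c'0 by (simp add: \<eta>_def field_simps)
  obtain m0 where m0: "\<And>m k H. m0 \<le> m \<Longrightarrow> 1 \<le> k \<Longrightarrow> H \<in> sets (observations \<mu> (enat k)) \<Longrightarrow> \<forall>\<omega>\<in>H. Q k \<omega> = 0 \<Longrightarrow>
    measure (Pr (enat (Suc k))) {\<omega>\<in>H. exp (real m * J) < LR (Suc k) (Suc k + m) \<omega>}
      \<le> \<eta> * measure (Pr (enat (Suc k))) H"
    using LR_concentration[OF \<delta> \<eta>] unfolding J_def by blast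
  \<comment> \<open>The logarithm is bounded by \<open>\<gamma> powr a / a\<close>; half of the gap
    above \<open>b'\<close> keeps \<open>a + b'\<close> below 1.\<close>
  define a where "a = (1 - b') / 2"
  have a: "0 < a" "a + b' - 1 < 0" using b' by (auto simp: a_def field_simps)
  define C where "C = mean_queue + p0 + p0 * (c' / a + 2)"
  have "0 < p0 * (c' / a + 2)" using p_pos c'0 a by (intro mult_pos_pos add_pos_pos divide_pos_pos) auto
  then have C: "0 < C" using mean_queue(2) p_pos by (simp add: C_def)
  have "((\<lambda>\<gamma>. exp J * \<gamma> powr (b - b')) \<longlongrightarrow> exp J * 0) at_top"
    using b' by (intro tendsto_mult tendsto_const tendsto_neg_powr filterlim_ident) auto
  then have ev1: "\<forall>\<^sub>F \<gamma> in at_top. exp J * \<gamma> powr (b - b') < \<eta>"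
    using \<eta> by (intro order_tendstoD(2)) auto
  have "((\<lambda>\<gamma>. C * \<gamma> powr (a + b' - 1)) \<longlongrightarrow> C * 0) at_top"
    using a by (intro tendsto_mult tendsto_const tendsto_neg_powr filterlim_ident) auto
  then have ev2: "\<forall>\<^sub>F \<gamma> in at_top. C * \<gamma> powr (a + b' - 1) < p0 - r"
    using r_less by (intro order_tendstoD(2)) auto
  have ev3: "\<forall>\<^sub>F \<gamma> in at_top. real m0 / c' \<le> ln (\<gamma> :: real)"
    using ln_at_top by (simp add: filterlim_at_top)
  show ?thesis
    using ev1 ev2 ev3 eventually_gt_at_top[of "1::real"]
  proof eventually_elim
    case (elim \<gamma>)
    have ln: "0 \<le> ln \<gamma>" using elim by simp
    define m where "m = nat \<lceil>c' * ln \<gamma>\<rceil>"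
    have "0 \<le> c' * ln \<gamma>" using c'0 ln by simp
    then have m: "c' * ln \<gamma> \<le> real m" "real m \<le> c' * ln \<gamma> + 1"
      unfolding m_def by (linarith, linarith)
    have "real m0 \<le> c' * ln \<gamma>" using elim(3) c'0 by (simp add: field_simps)
    then have m0m: "m0 \<le> m" using m by simp
    define \<epsilon> where "\<epsilon> = \<gamma> powr (- b')"
    have \<epsilon>: "0 < \<epsilon>" "1 / \<epsilon> = \<gamma> powr b'" using elim by (auto simp: \<epsilon>_def powr_minus field_simps)
    define K where "K = exp (real m * J)"
    have "K \<le> exp ((c' * ln \<gamma> + 1) * J)"
      unfolding K_def using m J by (simp add: mult_right_mono)
    also have "\<dots> = exp J * \<gamma> powr b"
      using elim by (simp add: powr_def b_def exp_add[symmetric] algebra_simps)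
    finally have "K * \<epsilon> \<le> exp J * \<gamma> powr b * \<epsilon>" using \<epsilon> by (intro mult_right_mono) auto
    also have "\<dots> = exp J * \<gamma> powr (b - b')"
      unfolding \<epsilon>_def by (simp add: powr_add[symmetric])
    finally have K\<epsilon>: "K * \<epsilon> \<le> \<eta>" using elim(1) by simp
    have "1 - 2 * \<eta> = c / c'" using c'0 by (simp add: \<eta>_def field_simps)
    then have frac: "c / c' \<le> 1 - K * \<epsilon> - \<eta>" using K\<epsilon> by simp
    have cc: "0 \<le> c / c'" using c c'0 by simp
    have threshold: "(mean_queue + p0 + p0 * real (Suc m) / \<epsilon>) / (p0 - r) < \<gamma>"
    proof -
      have g1: "1 \<le> \<gamma> powr a" "1 \<le> \<gamma> powr (a + b')"
        using elim a b' by (auto intro!: ge_one_powr_ge_zero)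
      have "real (Suc m) \<le> c' * ln \<gamma> + 2" using m by simp
      also have "\<dots> \<le> c' * (\<gamma> powr a / a) + 2 * \<gamma> powr a"
        using ln_powr_bound[of \<gamma> a] elim a c'0 g1 by (intro add_mono mult_left_mono) auto
      also have "\<dots> = (c' / a + 2) * \<gamma> powr a" by (simp add: algebra_simps)
      finally have "real (Suc m) / \<epsilon> \<le> (c' / a + 2) * \<gamma> powr a * \<gamma> powr b'"
        unfolding \<epsilon>(2)[symmetric] using \<epsilon>(1) by (simp add: divide_right_mono)
      then have 1: "p0 * (real (Suc m) / \<epsilon>) \<le> p0 * ((c' / a + 2) * \<gamma> powr (a + b'))"
        using p_pos by (intro mult_left_mono) (auto simp: powr_add mult.assoc)
      have "mean_queue + p0 \<le> (mean_queue + p0) * \<gamma> powr (a + b')"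
        using g1 mean_queue(2) p_pos by (intro mult_le_cancel_left1[THEN iffD2]) auto
      then have "mean_queue + p0 + p0 * real (Suc m) / \<epsilon> \<le> C * \<gamma> powr (a + b')"
        using 1 by (simp add: C_def algebra_simps)
      also have "C * \<gamma> powr (a + b') = C * \<gamma> powr (a + b' - 1) * \<gamma>"
        using elim by (simp add: powr_diff)
      also have "\<dots> < (p0 - r) * \<gamma>"
        using elim by (intro mult_strict_right_mono) auto
      finally show ?thesis using r_less by (simp add: field_simps)
    qed
    show ?case
    proof (intro allI impI)
      fix T assume T: "stopping_time (observations \<mu>) T" and \<gamma>: "ennreal \<gamma> \<le> mean_run_length Pr T"
      obtain k where k: "1 \<le> k" and v:
        "measure (Pr \<infinity>) {\<omega>\<in>outcome_space \<mu>. enat k < T \<omega> \<and> Q k \<omega> = 0 \<and> T \<omega> \<le> enat (k + Suc m)}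
          < \<epsilon> * measure (Pr \<infinity>) {\<omega>\<in>outcome_space \<mu>. enat k < T \<omega> \<and> Q k \<omega> = 0}"
        using exists_vulnerable_slot[OF T \<gamma>[unfolded mean_run_length_def] \<epsilon>(1) threshold] by blast
      have "c * ln \<gamma> = c' * ln \<gamma> * (c / c')" using c'0 by simp
      also have "\<dots> \<le> real m * (1 - K * \<epsilon> - \<eta>)"
        using m(1) frac cc by (intro mult_mono) auto
      finally have "ennreal (c * ln \<gamma>) \<le> ennreal (real m * (1 - K * \<epsilon> - \<eta>))"
        by (rule ennreal_leI)
      also have "\<dots> \<le> worst_case_delay Pr (observations \<mu>) T"
      proof (rule worst_case_delay_ge[OF T k v])
        show "0 \<le> K" by (simp add: K_def)
        show "0 \<le> 1 - K * \<epsilon> - \<eta>" using frac cc by simp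
      qed (unfold K_def, intro m0 m0m k vulnerable_event_sets[OF T k], auto)
      finally show "ennreal (c * ln \<gamma>) \<le> worst_case_delay Pr (observations \<mu>) T" .
    qed
  qed
qed

end

text \<open>Rates arbitrarily close to \<open>i\<close> are turned into the o(1) form. The
  correction is 0 where the rate \<open>i\<close> itself is attained, which covers infinite
  \<open>V \<gamma>\<close>. Elsewhere it is the exact deficit, which is nonpositive and eventually
  at least \<open>c - i\<close> for each \<open>c < i\<close>.\<close>

lemma exists_vanishing_correction:
  fixes V :: "real \<Rightarrow> ereal"
  assumes "\<And>c. c < i \<Longrightarrow> \<forall>\<^sub>F \<gamma> in at_top. ereal (c * ln \<gamma>) \<le> V \<gamma>"
  shows "\<exists>h :: real \<Rightarrow> real. (h \<longlongrightarrow> 0) at_top \<and> (\<forall>\<^sub>F \<gamma> in at_top. (ereal i + ereal (h \<gamma>)) * ereal (ln \<gamma>) \<le> V \<gamma>)"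
proof -
  define h where "h \<gamma> = (if ereal (i * ln \<gamma>) \<le> V \<gamma> then 0 else real_of_ereal (V \<gamma>) / ln \<gamma> - i)" for \<gamma>
  have key: "(ereal i + ereal (h \<gamma>)) * ereal (ln \<gamma>) \<le> V \<gamma> \<and> c - i \<le> h \<gamma> \<and> h \<gamma> \<le> 0"
    if \<gamma>: "1 < \<gamma>" and V: "ereal (c * ln \<gamma>) \<le> V \<gamma>" and c: "c < i" for \<gamma> c
  proof (cases "ereal (i * ln \<gamma>) \<le> V \<gamma>")
    case True
    then show ?thesis using c by (simp add: h_def)
  next
    case False
    then obtain v where v: "V \<gamma> = ereal v" using V by (cases "V \<gamma>") auto
    have l: "0 < ln \<gamma>" using \<gamma> by simp
    have "c * ln \<gamma> \<le> v" "v \<le> i * ln \<gamma>" using V False v by auto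
    then show ?thesis using False v l by (simp add: h_def field_simps)
  qed
  have "(h \<longlongrightarrow> 0) at_top"
  proof (rule tendstoI)
    fix e :: real assume "0 < e"
    have "\<forall>\<^sub>F \<gamma> in at_top. ereal ((i - e / 2) * ln \<gamma>) \<le> V \<gamma>" using \<open>0 < e\<close> by (intro assms) simp
    then show "\<forall>\<^sub>F \<gamma> in at_top. dist (h \<gamma>) 0 < e"
      using eventually_gt_at_top[of "1::real"]
    proof eventually_elim
      case (elim \<gamma>)
      then show ?case using key[of \<gamma> "i - e / 2"] \<open>0 < e\<close> by (auto simp: dist_real_def)
    qed
  qed
  moreover have "\<forall>\<^sub>F \<gamma> in at_top. (ereal i + ereal (h \<gamma>)) * ereal (ln \<gamma>) \<le> V \<gamma>"
  proof -
    have "\<forall>\<^sub>F \<gamma> in at_top. ereal ((i - 1) * ln \<gamma>) \<le> V \<gamma>" by (intro assms) simp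
    then show ?thesis
      using eventually_gt_at_top[of "1::real"]
    proof eventually_elim
      case (elim \<gamma>)
      then show ?case using key[of \<gamma> "i - 1"] by simp
    qed
  qed
  ultimately show ?thesis by blast
qed

text \<open>Subtracting \<open>f x - g x\<close>, whose integral is 0, makes the integrand
  nonnegative, with zeros only where the densities agree. Strict positivity makes the information
  number positive even if the channel does not change.\<close>

lemma relative_entropy_pos:
  fixes f g :: "'a \<Rightarrow> real"
  assumes f: "f \<in> borel_measurable M" "\<And>x. 0 \<le> f x" "prob_space (density M (\<lambda>x. ennreal (f x)))"
    and g: "g \<in> borel_measurable M" "\<And>x. 0 \<le> g x" "prob_space (density M (\<lambda>x. ennreal (g x)))"
    and ac: "AE x in M. g x = 0 \<longrightarrow> f x = 0" and int: "integrable M (\<lambda>x. f x * ln (f x / g x))"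
    and neq: "\<not> (AE x in M. g x = f x)"
  shows "0 < (\<integral>x. f x * ln (f x / g x) \<partial>M)"
proof -
  have prob: "integrable M h \<and> (\<integral>x. h x \<partial>M) = 1"
    if "h \<in> borel_measurable M" "\<And>x. 0 \<le> h x" "prob_space (density M (\<lambda>x. ennreal (h x)))" for h :: "'a \<Rightarrow> real"
  proof -
    have "(\<integral>\<^sup>+x. ennreal (h x) \<partial>M) = ennreal 1"
      using prob_space.emeasure_space_1[OF that(3)] that(1) by (simp add: emeasure_density cong: nn_integral_cong)
    then have "has_bochner_integral M h 1"
      using that by (intro has_bochner_integral_nn_integral) auto
    then show ?thesis by (simp add: has_bochner_integral_iff)
  qed
  note F = prob[OF f] and G = prob[OF g]
  let ?d = "\<lambda>x. f x * ln (f x / g x) - (f x - g x)"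
  have nonneg: "0 \<le> x * ln (x / y) - (x - y) \<and> (x * ln (x / y) - (x - y) = 0 \<longrightarrow> y = x)"
    if "0 \<le> x" "0 \<le> y" "y = 0 \<longrightarrow> x = 0" for x y :: real
  proof (cases "x = 0")
    case False
    then have xy: "0 < x" "0 < y" using that by auto
    have "x * ln (x / y) = - x * ln (y / x)" using xy by (simp add: ln_div algebra_simps)
    moreover have "ln (y / x) \<le> y / x - 1" using xy by (intro ln_le_minus_one) simp
    moreover have "y / x = 1" if "ln (y / x) = y / x - 1"
      using xy that by (intro ln_eq_minus_one) auto
    moreover have "x * (y / x - 1) = y - x" using xy by (simp add: field_simps)
    ultimately show ?thesis using xy
      by (smt (verit, best) divide_eq_1_iff minus_mult_left mult_cancel_left mult_left_mono)
  qed (use that in auto)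
  have i: "integrable M ?d" using F G int by simp
  have AE: "AE x in M. 0 \<le> ?d x"
    using ac by eventually_elim (use nonneg f(2) g(2) in blast)
  have "0 \<le> (\<integral>x. ?d x \<partial>M)" "(\<integral>x. ?d x \<partial>M) = 0 \<longleftrightarrow> (AE x in M. ?d x = 0)"
    by (rule integral_nonneg_AE[OF AE], rule integral_nonneg_eq_0_iff_AE[OF i AE])
  moreover have "\<not> (AE x in M. ?d x = 0)"
  proof
    assume "AE x in M. ?d x = 0"
    with ac have "AE x in M. g x = f x"
      by eventually_elim (use nonneg f(2) g(2) in blast)
    with neq show False by simp
  qed
  moreover have "(\<integral>x. ?d x \<partial>M) = (\<integral>x. f x * ln (f x / g x) \<partial>M)"
    using F G int by simp
  ultimately show ?thesis by simp
qed

theorem theorem1: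
  fixes r p0 p1 :: real
    and \<mu> :: "'x measure"
    and f0 f1 :: "'x \<Rightarrow> real"
    and \<rho> :: "nat pmf"
  defines "P \<equiv> law r p0 p1 \<mu> f0 f1 \<rho>"
    and "F \<equiv> observations \<mu>"
    and "I \<equiv> info_number r p0 p1 \<mu> f0 f1"
  assumes "0 < r" "r < min p0 p1" "p0 \<le> 1" "p1 \<le> 1"
    and "sigma_finite_measure \<mu>"
    and "f0 \<in> borel_measurable \<mu>" "\<And>x. 0 \<le> f0 x" "prob_space (density \<mu> (\<lambda>x. ennreal (f0 x)))"
    and "f1 \<in> borel_measurable \<mu>" "\<And>x. 0 \<le> f1 x" "prob_space (density \<mu> (\<lambda>x. ennreal (f1 x)))"
    and "\<not> (AE x in \<mu>. f0 x = f1 x)"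
    and "stationary_queue r p0 \<rho>"
  shows "\<exists>h :: real \<Rightarrow> real. (h \<longlongrightarrow> 0) at_top \<and>
    (\<forall>\<^sub>F \<gamma> in at_top.
      (1 / I + ereal (h \<gamma>)) * ereal (ln \<gamma>)
      \<le> enn2ereal (INF T\<in>{T. stopping_time F T \<and> ennreal \<gamma> \<le> mean_run_length P T}.
                      worst_case_delay P F T))"
proof -
  let ?V = "\<lambda>\<gamma>. enn2ereal (INF T\<in>{T. stopping_time F T \<and> ennreal \<gamma> \<le> mean_run_length P T}. worst_case_delay P F T)"
  note r = assms(4-7) and f0 = assms(9-11) and f1 = assms(12-14)
  have p: "0 < p0" "0 < p1" "r < p0" "r < p1" using r by auto
  show ?thesis
  proof (cases "I = \<infinity>")
    case True
    \<comment> \<open>For an infinite information number the inverse is 0, and the claimed lower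
      bound is 0.\<close>
    then show ?thesis by (intro exI[of _ "\<lambda>_. 0"]) simp
  next
    case False
    \<comment> \<open>Neither summand of the information number can be -\<infinity>, so its
      finiteness passes to both of them.\<close>
    have channel: "\<not> (p0 = 1 \<and> p1 \<noteq> 1)"
    proof
      assume "p0 = 1 \<and> p1 \<noteq> 1"
      then have "info_channel p1 p0 = \<infinity>" by (simp add: info_channel_def)
      then have "I = \<infinity>" using p r(1) by (simp add: I_def info_number_def info_density_def)
      with False show False by simp
    qed
    have dens: "(AE x in \<mu>. f0 x = 0 \<longrightarrow> f1 x = 0) \<and> integrable \<mu> (\<lambda>x. f1 x * ln (f1 x / f0 x))"
    proof (rule ccontr)
      assume "\<not> ?thesis"
      then have "info_density \<mu> f1 f0 = \<infinity>" by (simp add: info_density_def)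
      then have "I = \<infinity>" using p r(1) channel by (simp add: I_def info_number_def info_channel_def)
      with False show False by simp
    qed
    define D where "D = (\<integral>x. f1 x * ln (f1 x / f0 x) \<partial>\<mu>)"
    have D: "0 < D"
      unfolding D_def using f0 f1 dens assms(15) by (intro relative_entropy_pos) auto
    define \<l> where "\<l> x = f1 x / f0 x" for x
    let ?N0 = "density \<mu> (\<lambda>x. ennreal (f0 x))" and ?N1 = "density \<mu> (\<lambda>x. ennreal (f1 x))"
    have m[measurable]: "f0 \<in> borel_measurable \<mu>" "f1 \<in> borel_measurable \<mu>" by fact+
    have N1: "?N1 = density ?N0 (\<lambda>x. ennreal (\<l> x))"
    proof -
      have "density ?N0 (\<lambda>x. ennreal (\<l> x)) = density \<mu> (\<lambda>x. ennreal (f0 x) * ennreal (\<l> x))"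
        unfolding \<l>_def by (rule density_density_eq) measurable
      also have "\<dots> = ?N1"
      proof (rule density_cong)
        have "AE x in \<mu>. f0 x = 0 \<longrightarrow> f1 x = 0" using dens by simp
        then show "AE x in \<mu>. ennreal (f0 x) * ennreal (\<l> x) = ennreal (f1 x)"
          by eventually_elim (use f0(2) f1(2) in \<open>auto simp: \<l>_def ennreal_mult[symmetric]\<close>)
      qed (auto simp: \<l>_def)
      finally show ?thesis ..
    qed
    have int: "integrable ?N1 (\<lambda>x. ln (\<l> x))" "(\<integral>x. ln (\<l> x) \<partial>?N1) = D"
      using dens f1(2) by (auto simp: \<l>_def integrable_density integral_density D_def)
    interpret sensor r \<rho> \<mu> ?N0 p0 p1 ?N1 \<l>
    proof (intro sensor.intro outcome_law.intro sensor_axioms.intro)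
      show "\<l> \<in> borel_measurable \<mu>" unfolding \<l>_def by measurable
      show "0 \<le> \<l> x" for x using f0(2) f1(2) by (simp add: \<l>_def)
      show "p0 = 1 \<Longrightarrow> p1 = 1" using channel by simp
    qed (fact f0 f1 r p N1 int assms(16) sets_density)+
    have P: "P = Pr"
    proof
      fix \<nu>
      show "P \<nu> = Pr \<nu>"
        unfolding P_def law_def Pr_def glaw_def
        by (intro arg_cong2[where f="(\<Otimes>\<^sub>M)"] PiM_cong refl) auto
    qed
    have I: "I = ereal info"
      using channel dens
      by (simp add: I_def info_number_def info_channel_def info_density_def info_def \<kappa>_def int(2) D_def)
    have info: "0 < info"
      using r(1) p D \<kappa>_nonneg by (auto simp: info_def int(2) intro!: mult_pos_pos add_nonneg_pos)
    have "\<forall>\<^sub>F \<gamma> in at_top. ereal (c * ln \<gamma>) \<le> ?V \<gamma>" if c: "c < 1 / info" for c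
    proof -
      \<comment> \<open>\<open>worst_case_delay_asymptotic\<close> requires a positive rate, while
        \<open>c\<close> may be zero or negative here.\<close>
      define c' where "c' = max c (1 / (2 * info))"
      have c': "0 < c'" "c' < 1 / info" "c \<le> c'" using c info by (auto simp: c'_def less_max_iff_disj field_simps)
      show ?thesis
        using worst_case_delay_asymptotic[OF info c'(1,2)] eventually_gt_at_top[of "1::real"]
      proof eventually_elim
        case (elim \<gamma>)
        have "ennreal (c' * ln \<gamma>) \<le> (INF T\<in>{T. stopping_time F T \<and> ennreal \<gamma> \<le> mean_run_length P T}. worst_case_delay P F T)"
          using elim by (intro INF_greatest) (auto simp: P F_def)
        then have "enn2ereal (ennreal (c' * ln \<gamma>)) \<le> ?V \<gamma>"
          by (simp add: less_eq_ennreal.rep_eq)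
        moreover have "enn2ereal (ennreal (c' * ln \<gamma>)) = ereal (c' * ln \<gamma>)"
          using c' elim by (intro enn2ereal_ennreal) simp
        ultimately have V: "ereal (c' * ln \<gamma>) \<le> ?V \<gamma>" by (simp only:)
        have "ereal (c * ln \<gamma>) \<le> ereal (c' * ln \<gamma>)"
          using c' elim by (simp add: mult_right_mono)
        then show ?case using V by (rule order_trans)
      qed
    qed
    from exists_vanishing_correction[OF this]
    show ?thesis using info by (simp add: I one_ereal_def)
  qed
qed

end
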